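(* Let $p$ be a prime and let $\hat F_p$ be a finitely generated free pro-$p$-group of rank $\geq 2$. Then the discrete homology group $H_2(\hat F_p,\mathbb Z/p)$ (the second homology with coefficients in the trivial module $\mathbb Z/p$ of $\hat F_p$ regarded as an abstract discrete group) is uncountable.
   Context: For a profinite group $G$, $H_2^{\sf disc}(G,\mathbb Z/p)=H_2(G,\mathbb Z/p)$ denotes the ordinary group homology of $G$ viewed as a discrete group, ignoring the topology. Equivalently, $\hat F_p$ is the pro-$p$-completion of a finitely generated free group $F$ with at least two generators. *)

theory Defs
  imports "HOL-Analysis.Analysis" "HOL-Algebra.Algebra"
begin

definition totally_disconnected_space :: "'a topology \<Rightarrow> bool" where
  "totally_disconnected_space T \<longleftrightarrow>
     (\<forall>S. connectedin T S \<longrightarrow> (\<forall>x\<in>S. \<forall>y\<in>S. x = y))"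

definition topological_group :: "('a, 'b) monoid_scheme \<Rightarrow> 'a topology \<Rightarrow> bool" where
  "topological_group G T \<longleftrightarrow> group G \<and> topspace T = carrier G
     \<and> continuous_map (prod_topology T T) T (\<lambda>(x, y). x \<otimes>\<^bsub>G\<^esub> y)
     \<and> continuous_map T T (\<lambda>x. inv\<^bsub>G\<^esub> x)"

definition profinite_group :: "('a, 'b) monoid_scheme \<Rightarrow> 'a topology \<Rightarrow> bool" where
  "profinite_group G T \<longleftrightarrow> topological_group G T \<and> compact_space T
     \<and> Hausdorff_space T \<and> totally_disconnected_space T"

definition p_group :: "nat \<Rightarrow> ('a, 'b) monoid_scheme \<Rightarrow> bool" where
  "p_group p P \<longleftrightarrow> group P \<and> finite (carrier P) \<and> (\<exists>k. card (carrier P) = p ^ k)"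

definition pro_p_group :: "nat \<Rightarrow> ('a, 'b) monoid_scheme \<Rightarrow> 'a topology \<Rightarrow> bool" where
  "pro_p_group p G T \<longleftrightarrow> profinite_group G T \<and>
     (\<forall>N. normal N G \<longrightarrow> openin T N \<longrightarrow> (\<exists>k. card (rcosets\<^bsub>G\<^esub> N) = p ^ k))"

text \<open>A free pro-p group on the finite basis B: pro-p, B \<subseteq> G, and every map from B
  to a finite p-group P extends uniquely to a continuous homomorphism G \<rightarrow> P
  (finite groups carry the discrete topology).  Finite p-groups are taken with carrier
  in nat, which covers all of them up to isomorphism.\<close>
definition free_pro_p_group_on :: "nat \<Rightarrow> ('a, 'b) monoid_scheme \<Rightarrow> 'a topology \<Rightarrow> 'a set \<Rightarrow> bool" where
  "free_pro_p_group_on p G T B \<longleftrightarrow> pro_p_group p G T \<and> B \<subseteq> carrier G \<and>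
     (\<forall>(P :: nat monoid) f. p_group p P \<longrightarrow> f ` B \<subseteq> carrier P \<longrightarrow>
        (\<exists>phi. phi \<in> hom G P \<and> continuous_map T (discrete_topology (carrier P)) phi
             \<and> (\<forall>x\<in>B. phi x = f x)
             \<and> (\<forall>psi. psi \<in> hom G P \<longrightarrow> continuous_map T (discrete_topology (carrier P)) psi
                    \<longrightarrow> (\<forall>x\<in>B. psi x = f x) \<longrightarrow> (\<forall>g\<in>carrier G. psi g = phi g))))"

text \<open>Chains are finitely supported integer-valued functions on G^n, read modulo p.\<close>
definition fin_chain :: "('c \<Rightarrow> int) \<Rightarrow> ('c set) \<Rightarrow> bool" where
  "fin_chain c D \<longleftrightarrow> finite {x. c x \<noteq> 0} \<and> {x. c x \<noteq> 0} \<subseteq> D"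

definition bar_d2 :: "('a, 'b) monoid_scheme \<Rightarrow> ('a \<times> 'a \<Rightarrow> int) \<Rightarrow> 'a \<Rightarrow> int" where
  "bar_d2 G c x = (\<Sum>gh\<in>{y. c y \<noteq> 0}. c gh *
      ((if snd gh = x then 1 else 0) - (if fst gh \<otimes>\<^bsub>G\<^esub> snd gh = x then 1 else 0)
       + (if fst gh = x then 1 else 0)))"

definition bar_d3 :: "('a, 'b) monoid_scheme \<Rightarrow> ('a \<times> 'a \<times> 'a \<Rightarrow> int) \<Rightarrow> 'a \<times> 'a \<Rightarrow> int" where
  "bar_d3 G e y = (\<Sum>t\<in>{z. e z \<noteq> 0}. (case t of (g, h, k) \<Rightarrow> e t *
      ((if (h, k) = y then 1 else 0) - (if (g \<otimes>\<^bsub>G\<^esub> h, k) = y then 1 else 0)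
       + (if (g, h \<otimes>\<^bsub>G\<^esub> k) = y then 1 else 0) - (if (g, h) = y then 1 else 0))))"

definition bar_cycles2 :: "nat \<Rightarrow> ('a, 'b) monoid_scheme \<Rightarrow> ('a \<times> 'a \<Rightarrow> int) set" where
  "bar_cycles2 p G = {c. fin_chain c (carrier G \<times> carrier G)
                        \<and> (\<forall>x. bar_d2 G c x mod int p = 0)}"

definition bar_homologous2 :: "nat \<Rightarrow> ('a, 'b) monoid_scheme \<Rightarrow> (('a \<times> 'a \<Rightarrow> int) \<times> ('a \<times> 'a \<Rightarrow> int)) set" where
  "bar_homologous2 p G = {(c, c'). c \<in> bar_cycles2 p G \<and> c' \<in> bar_cycles2 p G \<and>
      (\<exists>e. fin_chain e (carrier G \<times> carrier G \<times> carrier G) \<and>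
           (\<forall>y. (c y - c' y - bar_d3 G e y) mod int p = 0))}"

definition H2_disc_mod :: "nat \<Rightarrow> ('a, 'b) monoid_scheme \<Rightarrow> ('a \<times> 'a \<Rightarrow> int) set set" where
  "H2_disc_mod p G = bar_cycles2 p G // bar_homologous2 p G"

end

theory Submission
  imports Defs "HOL-Computational_Algebra.Formal_Power_Series" "HOL-Number_Theory.Cong"
begin

text \<open>
  Let \<open>u \<noteq> v\<close> be two basis elements. Sending \<open>u\<close> to \<open>(1, 0)\<close>, \<open>v\<close> to the generator of the acting group and all
  other basis elements to the identity maps \<open>G\<close> to the pro-\<open>p\<close> lamplighter group \<open>F_p[[X]] \<rtimes> Z_p\<close>, where
  \<open>Z_p\<close> acts by powers of \<open>1 + X\<close>; this is a character \<open>chi\<close> together with a derivation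
  \<open>D\<close>, and \<open>N\<close> is the kernel.

  For a set \<open>I\<close> of natural numbers let \<open>b\<close> be the limit of the products over \<open>i \<in> I\<close> of
  \<open>u^(v^q) u^(v^-q) u^-2\<close>, \<open>q = p^i\<close>. Every \<open>[u, u^(v^q) u^(v^-q)]\<close> is a commutator with an element of
  \<open>N\<close>, and since \<open>G\<close> is topologically finitely generated, a product of boundedly many commutators
  \<open>[n, x]\<close> (one for each basis element \<open>x\<close>) suffices to express \<open>[u, b]\<close>. Such an identity between
  commutators is a 2-cycle \<open>z_I\<close>.

  The cochain \<open>(g, h) \<mapsto> D'(g) \<otimes> chi(g) D(h)\<close>, where \<open>D'\<close> is \<open>D\<close> after the substitution
  \<open>1 + X \<mapsto> (1 + X)^-1\<close>, has values in \<open>F_p[[X]] \<otimes> F_p[[X]]\<close> and is a cocycle modulo the relations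
  \<open>(1 - chi' \<otimes> chi) (a \<otimes> c)\<close>. It sends \<open>z_I\<close> to \<open>1 \<otimes> D(b) - D'(b) \<otimes> chi(b)\<close>. Let \<open>R\<close> be the span of the values
  of \<open>chi\<close> in \<open>F_p[[X]]\<close>. If no nonzero multiple of \<open>b0\<close> by an element of \<open>R\<close> lies in \<open>R\<close>, a map
  that is linear over \<open>R\<close>, kills \<open>R\<close> and is nonzero at \<open>b0\<close> shows that \<open>1 \<otimes> b0\<close> is nontrivial. As a measure on
  \<open>Z_p\<close>, the difference \<open>b0\<close> of the series for \<open>I\<close> and \<open>J\<close> has an atom at \<open>p^i\<close> for every \<open>i\<close> in the
  symmetric difference, while elements of \<open>R\<close> have finitely many atoms. So \<open>z_I\<close> and \<open>z_J\<close> are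
  homologous only if \<open>I\<close> and \<open>J\<close> differ in finitely many places.
\<close>

unbundle no vec_syntax
unbundle fps_syntax

section \<open>Power series modulo p and finite lamplighter groups\<close>

text \<open>F_p[[X]] is represented by integer series, with equality replaced by a congruence. This
  predicate is membership in the ideal \<open>(p, X^k)\<close>; \<open>pdvd\<close> is vanishing in
  F_p[[X]].\<close>

definition pdvd_upto :: "nat \<Rightarrow> nat \<Rightarrow> int fps \<Rightarrow> bool" where
  "pdvd_upto p k f \<longleftrightarrow> (\<forall>n<k. int p dvd f $ n)"

definition pdvd :: "nat \<Rightarrow> int fps \<Rightarrow> bool" where
  "pdvd p f \<longleftrightarrow> (\<forall>n. int p dvd f $ n)"

lemma pdvd_iff_pdvd_upto: "pdvd p f \<longleftrightarrow> (\<forall>k. pdvd_upto p k f)"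
  unfolding pdvd_def pdvd_upto_def by blast

lemma pdvd_upto_mono: "pdvd_upto p k f \<Longrightarrow> l \<le> k \<Longrightarrow> pdvd_upto p l f"
  unfolding pdvd_upto_def by auto

lemma pdvd_upto_0 [simp]: "pdvd_upto p k 0" by (simp add: pdvd_upto_def)
lemma pdvd_upto_add: "pdvd_upto p k f \<Longrightarrow> pdvd_upto p k g \<Longrightarrow> pdvd_upto p k (f + g)" by (simp add: pdvd_upto_def)
lemma pdvd_upto_diff: "pdvd_upto p k f \<Longrightarrow> pdvd_upto p k g \<Longrightarrow> pdvd_upto p k (f - g)" by (simp add: pdvd_upto_def)
lemma pdvd_upto_uminus: "pdvd_upto p k f \<Longrightarrow> pdvd_upto p k (- f)" by (simp add: pdvd_upto_def)
lemma pdvd_upto_mult_right: "pdvd_upto p k f \<Longrightarrow> pdvd_upto p k (f * g)"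
  unfolding pdvd_upto_def fps_mult_nth by (auto intro!: dvd_sum)
lemma pdvd_upto_mult_left: "pdvd_upto p k f \<Longrightarrow> pdvd_upto p k (g * f)"
  using pdvd_upto_mult_right[of p k f g] by (simp add: mult.commute)
lemma pdvd_upto_sum: "(\<And>i. i \<in> I \<Longrightarrow> pdvd_upto p k (f i)) \<Longrightarrow> pdvd_upto p k (sum f I)"
  by (induction I rule: infinite_finite_induct) (auto intro: pdvd_upto_add)

lemma pdvd_0 [simp]: "pdvd p 0" by (simp add: pdvd_def)
lemma pdvd_add: "pdvd p f \<Longrightarrow> pdvd p g \<Longrightarrow> pdvd p (f + g)" by (simp add: pdvd_def)
lemma pdvd_diff: "pdvd p f \<Longrightarrow> pdvd p g \<Longrightarrow> pdvd p (f - g)" by (simp add: pdvd_def)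
lemma pdvd_uminus: "pdvd p f \<Longrightarrow> pdvd p (- f)" by (simp add: pdvd_def)
lemma pdvd_mult_right: "pdvd p f \<Longrightarrow> pdvd p (f * g)" by (simp add: pdvd_iff_pdvd_upto pdvd_upto_mult_right)
lemma pdvd_mult_left: "pdvd p f \<Longrightarrow> pdvd p (g * f)" by (simp add: pdvd_iff_pdvd_upto pdvd_upto_mult_left)
lemma pdvd_sum: "(\<And>i. i \<in> I \<Longrightarrow> pdvd p (f i)) \<Longrightarrow> pdvd p (sum f I)"
  by (simp add: pdvd_iff_pdvd_upto pdvd_upto_sum)
lemma pdvd_of_int: "int p dvd c \<Longrightarrow> pdvd p (of_int c * f)"
  by (simp add: pdvd_def fps_of_int[symmetric])

text \<open>F_p[[X]] is an integral domain: if \<open>i\<close> and \<open>j\<close> are the first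
  indices at which \<open>p\<close> does not divide the coefficients of \<open>f\<close> and
  \<open>g\<close>, then the coefficient of the product at \<open>i + j\<close> is
  \<open>f $ i * g $ j\<close> modulo \<open>p\<close>.\<close>

lemma pdvd_mult_cases:
  assumes p: "Factorial_Ring.prime p" and fg: "pdvd p (f * g)"
  shows "pdvd p f \<or> pdvd p g"
proof (rule ccontr)
  assume "\<not> ?thesis"
  then obtain a b where ab: "\<not> int p dvd f $ a" "\<not> int p dvd g $ b" unfolding pdvd_def by blast
  define i where "i = (LEAST a. \<not> int p dvd f $ a)"
  define j where "j = (LEAST a. \<not> int p dvd g $ a)"
  have i: "\<not> int p dvd f $ i" "\<And>a. a < i \<Longrightarrow> int p dvd f $ a"
    unfolding i_def using ab(1) by (rule LeastI) (metis not_less_Least)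
  have j: "\<not> int p dvd g $ j" "\<And>a. a < j \<Longrightarrow> int p dvd g $ a"
    unfolding j_def using ab(2) by (rule LeastI) (metis not_less_Least)
  have "(f * g) $ (i + j) = (\<Sum>k\<in>{0..i+j}. f $ k * g $ (i + j - k))" by (simp add: fps_mult_nth)
  also have "\<dots> = f $ i * g $ j + (\<Sum>k\<in>{0..i+j} - {i}. f $ k * g $ (i + j - k))"
    by (subst sum.remove[of _ i]) auto
  finally have e: "(f * g) $ (i + j) = \<dots>" .
  have "int p dvd (\<Sum>k\<in>{0..i+j} - {i}. f $ k * g $ (i + j - k))"
  proof (rule dvd_sum)
    fix k assume k: "k \<in> {0..i+j} - {i}"
    show "int p dvd f $ k * g $ (i + j - k)"
    proof (cases "k < i")
      case True then show ?thesis using i(2) by simp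
    next
      case False
      then have "i + j - k < j" using k by auto
      then show ?thesis using j(2) by simp
    qed
  qed
  moreover have "int p dvd (f * g) $ (i + j)" using fg by (simp add: pdvd_def)
  ultimately have "int p dvd f $ i * g $ j" unfolding e using dvd_add_left_iff by blast
  then have "int p dvd f $ i \<or> int p dvd g $ j" using p by (simp add: prime_dvd_mult_iff)
  then show False using i(1) j(1) by blast
qed

section \<open>Powers of 1 + X modulo p\<close>

lemma one_plus_X_power_nth: "((1 + fps_X :: int fps) ^ n) $ k = int (n choose k)"
proof (induction n arbitrary: k)
  case 0 then show ?case by (cases k) auto
next
  case (Suc n) then show ?case by (cases k) (auto simp: algebra_simps)
qed

lemma prime_dvd_prime_power_choose:
  assumes "Factorial_Ring.prime p" "0 < k" "k < p ^ m"
  shows "p dvd (p ^ m choose k)"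
proof -
  obtain j where k: "k = Suc j" using assms by (cases k) auto
  obtain q where q: "p ^ m = Suc q" using assms by (cases "p ^ m") auto
  have e: "Suc j * (p ^ m choose k) = p ^ m * (q choose j)" unfolding k q using Suc_times_binomial[of j q] by simp
  show ?thesis
  proof (rule ccontr)
    assume "\<not> p dvd (p ^ m choose k)"
    then have "coprime (p ^ m) (p ^ m choose k)"
      using assms(1) by (simp add: prime_imp_coprime)
    moreover have "p ^ m dvd Suc j * (p ^ m choose k)" unfolding e by simp
    ultimately have "p ^ m dvd Suc j" using coprime_dvd_mult_left_iff by blast
    then show False using assms k by (meson dvd_imp_le not_less zero_less_Suc)
  qed
qed

text \<open>Modulo \<open>p\<close> the inner binomial coefficients vanish, so
  \<open>(1 + X)^(p^m)\<close> is \<open>1 + X^(p^m)\<close>, and the same holds up to higher terms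
  for its powers.\<close>

lemma one_plus_X_power_prime_power:
  assumes "Factorial_Ring.prime p"
  shows "pdvd_upto p (p ^ m) ((1 + fps_X) ^ (p ^ m * j) - 1)"
proof (induction j)
  case 0 then show ?case by simp
next
  case (Suc j)
  have 1: "pdvd_upto p (p ^ m) ((1 + fps_X) ^ (p ^ m) - 1)"
    unfolding pdvd_upto_def
  proof (intro allI impI)
    fix n assume "n < p ^ m"
    then show "int p dvd ((1 + fps_X) ^ (p ^ m) - 1) $ n"
      using prime_dvd_prime_power_choose[OF assms, of n m]
      by (cases "n = 0") (auto simp: one_plus_X_power_nth)
  qed
  have "(1 + fps_X) ^ (p ^ m * Suc j) - (1 :: int fps)
     = (1 + fps_X) ^ (p ^ m * j) * ((1 + fps_X) ^ (p ^ m) - 1) + ((1 + fps_X) ^ (p ^ m * j) - 1)"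
    by (simp add: power_add algebra_simps)
  then show ?case using 1 Suc by (simp only: pdvd_upto_add pdvd_upto_mult_left)
qed

text \<open>At truncation level \<open>p^m\<close> an exponent matters only modulo
  \<open>p^m\<close>. This gives powers of \<open>1 + X\<close> with exponents in Z_p a
  meaning.\<close>

lemma power_cong_pdvd_upto:
  assumes "Factorial_Ring.prime p" "[a = b] (mod p ^ m)"
  shows "pdvd_upto p (p ^ m) ((1 + fps_X) ^ a - (1 + fps_X) ^ b)"
proof -
  have *: "pdvd_upto p (p ^ m) ((1 + fps_X) ^ a - (1 + fps_X) ^ (a mod p ^ m))" for a
  proof -
    have "(1 + fps_X) ^ a - (1 + fps_X :: int fps) ^ (a mod p ^ m)
      = (1 + fps_X) ^ (a mod p ^ m) * ((1 + fps_X) ^ (p ^ m * (a div p ^ m)) - 1)"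
      by (simp add: algebra_simps flip: power_add)
    then show ?thesis using one_plus_X_power_prime_power[OF assms(1)] by (simp only: pdvd_upto_mult_left)
  qed
  from pdvd_upto_diff[OF *[of a] *[of b]] assms(2) show ?thesis by (simp add: cong_def)
qed

text \<open>The matrix of binomial coefficients \<open>z choose y\<close> is unitriangular, so the
  powers \<open>(1 + X)^y\<close> with \<open>y < q\<close> are independent modulo \<open>p\<close>
  and \<open>X^q\<close>. The induction descends from \<open>y = q - 1\<close>.\<close>

lemma independent_reduced:
  fixes A :: "nat \<Rightarrow> int"
  assumes "pdvd_upto p q (\<Sum>y<q. of_int (A y) * (1 + fps_X) ^ y)" "y < q"
  shows "int p dvd A y"
  using assms(2)
proof (induction "q - y" arbitrary: y rule: less_induct)
  case less
  have "(\<Sum>y<q. of_int (A y) * (1 + fps_X) ^ y :: int fps) $ y = (\<Sum>z<q. A z * int (z choose y))"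
    by (simp add: fps_sum_nth fps_of_int[symmetric] one_plus_X_power_nth)
  also have "\<dots> = A y + (\<Sum>z\<in>{..<q} - {y}. A z * int (z choose y))"
    using less by (subst sum.remove[of _ y]) auto
  finally have e: "(\<Sum>y<q. of_int (A y) * (1 + fps_X) ^ y :: int fps) $ y = \<dots>" .
  have "int p dvd (\<Sum>z\<in>{..<q} - {y}. A z * int (z choose y))"
  proof (rule dvd_sum)
    fix z assume "z \<in> {..<q} - {y}"
    then show "int p dvd A z * int (z choose y)"
      using less by (cases "z < y") (auto simp: binomial_eq_0 intro!: dvd_mult2 less(1))
  qed
  moreover have "int p dvd (\<Sum>y<q. of_int (A y) * (1 + fps_X) ^ y :: int fps) $ y"
    using assms(1) less by (simp add: pdvd_upto_def)
  ultimately show ?case unfolding e using dvd_add_left_iff by blast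
qed

text \<open>\<open>F_p[X]/(X^(p^m))\<close> is the group algebra of \<open>Z/p^m\<close>, so a
  vanishing combination has total weight zero on every residue class. This is how single atoms are
  read off.\<close>

lemma independent_mod:
  fixes \<alpha> :: "'l \<Rightarrow> int"
  assumes p: "Factorial_Ring.prime p" and L: "finite L"
    and z: "pdvd_upto p (p ^ m) (\<Sum>l\<in>L. of_int (\<alpha> l) * (1 + fps_X) ^ n l)"
  shows "int p dvd (\<Sum>l | l \<in> L \<and> [n l = y] (mod p ^ m). \<alpha> l)"
proof -
  let ?q = "p ^ m"
  define A where "A y = (\<Sum>l | l \<in> L \<and> n l mod ?q = y. \<alpha> l)" for y
  have q: "?q > 0" using p by (simp add: prime_gt_0_nat)
  have "(\<Sum>y<?q. of_int (A y) * (1 + fps_X) ^ y) = (\<Sum>y<?q. \<Sum>l | l \<in> L \<and> n l mod ?q = y. of_int (\<alpha> l) * (1 + fps_X) ^ (n l mod ?q) :: int fps)"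
    unfolding A_def of_int_sum sum_distrib_right by (intro sum.cong) auto
  also have "\<dots> = (\<Sum>l\<in>L. of_int (\<alpha> l) * (1 + fps_X) ^ (n l mod ?q))"
    using L q by (intro sum.group) auto
  finally have e: "(\<Sum>y<?q. of_int (A y) * (1 + fps_X) ^ y) = (\<Sum>l\<in>L. of_int (\<alpha> l) * (1 + fps_X :: int fps) ^ (n l mod ?q))" .
  have "pdvd_upto p ?q ((\<Sum>l\<in>L. of_int (\<alpha> l) * (1 + fps_X) ^ (n l mod ?q)) - (\<Sum>l\<in>L. of_int (\<alpha> l) * (1 + fps_X) ^ n l))"
    unfolding sum_subtractf[symmetric] right_diff_distrib[symmetric]
    by (intro pdvd_upto_sum pdvd_upto_mult_left power_cong_pdvd_upto p) (simp add: cong_def)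
  from pdvd_upto_add[OF this z] have "pdvd_upto p ?q (\<Sum>y<?q. of_int (A y) * (1 + fps_X) ^ y)" by (simp add: e)
  from independent_reduced[OF this, of "y mod ?q"] q show ?thesis by (simp add: A_def cong_def)
qed

section \<open>Truncated series and the finite lamplighter groups\<close>

definition red :: "nat \<Rightarrow> nat \<Rightarrow> int fps \<Rightarrow> int fps" where
  "red p q f = Abs_fps (\<lambda>n. if n < q then f $ n mod int p else 0)"

lemma red_nth: "red p q f $ n = (if n < q then f $ n mod int p else 0)"
  by (simp add: red_def)

lemma pdvd_upto_red: "pdvd_upto p q (red p q f - f)"
  by (auto simp: pdvd_upto_def red_nth mod_eq_dvd_iff[symmetric])

lemma red_eq_iff: "red p q f = red p q g \<longleftrightarrow> pdvd_upto p q (f - g)"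
  by (auto simp: fps_eq_iff red_nth pdvd_upto_def mod_eq_dvd_iff[symmetric])

lemma red_red [simp]: "red p q (red p q f) = red p q f"
  by (simp add: red_eq_iff pdvd_upto_red)

lemma red_0 [simp]: "red p q 0 = 0" by (simp add: fps_eq_iff red_nth)

text \<open>The semidirect product of \<open>F_p[X]/(X^q)\<close> and \<open>Z/q\<close>, where \<open>1\<close> acts as \<open>1 + X\<close>. It is a group when \<open>q\<close> is a power of \<open>p\<close>,
  because then \<open>(1 + X)^q = 1\<close> in \<open>F_p[X]/(X^q)\<close>.\<close>

definition lampgroup :: "nat \<Rightarrow> nat \<Rightarrow> (int fps \<times> nat) monoid" where
  "lampgroup p q = \<lparr>carrier = {f. red p q f = f} \<times> {..<q},
     mult = (\<lambda>(a, s) (b, t). (red p q (a + (1 + fps_X) ^ s * b), (s + t) mod q)),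
     one = (0, 0)\<rparr>"

lemma lampgroup_simps:
  "carrier (lampgroup p q) = {f. red p q f = f} \<times> {..<q}"
  "(a, s) \<otimes>\<^bsub>lampgroup p q\<^esub> (b, t) = (red p q (a + (1 + fps_X) ^ s * b), (s + t) mod q)"
  "\<one>\<^bsub>lampgroup p q\<^esub> = (0, 0)"
  by (simp_all add: lampgroup_def)

lemma pdvd_upto_trans: "pdvd_upto p k (f - g) \<Longrightarrow> pdvd_upto p k (g - h) \<Longrightarrow> pdvd_upto p k (f - h)"
  using pdvd_upto_add[of p k "f - g" "g - h"] by simp

lemma pdvd_upto_sym: "pdvd_upto p k (f - g) \<Longrightarrow> pdvd_upto p k (g - f)"
  using pdvd_upto_uminus[of p k "f - g"] by simp

lemma group_lampgroup:
  assumes p: "Factorial_Ring.prime p" and q: "q = p ^ m"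
  shows "group (lampgroup p q)"
proof (rule groupI)
  have q0: "q > 0" using p q by (simp add: prime_gt_0_nat)
  show "\<one>\<^bsub>lampgroup p q\<^esub> \<in> carrier (lampgroup p q)" using q0 by (simp add: lampgroup_simps)
  fix x assume "x \<in> carrier (lampgroup p q)"
  then obtain a s where x: "x = (a, s)" "red p q a = a" "s < q" by (auto simp: lampgroup_simps)
  show "\<one>\<^bsub>lampgroup p q\<^esub> \<otimes>\<^bsub>lampgroup p q\<^esub> x = x" using x by (simp add: lampgroup_simps)
  show "\<exists>y\<in>carrier (lampgroup p q). y \<otimes>\<^bsub>lampgroup p q\<^esub> x = \<one>\<^bsub>lampgroup p q\<^esub>"
  proof (rule bexI)
    \<comment> \<open>The inverse is \<open>(-(1 + X)^(-s) a, -s)\<close>; the outer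
      \<open>mod q\<close> keeps the exponent in range when \<open>s = 0\<close>.\<close>
    let ?y = "(red p q (- ((1 + fps_X) ^ ((q - s) mod q) * a)), (q - s) mod q)"
    show "?y \<in> carrier (lampgroup p q)" using q0 by (simp add: lampgroup_simps)
    have "((q - s) mod q + s) mod q = 0" using x by (simp add: mod_add_left_eq)
    moreover have "red p q (red p q (- ((1 + fps_X) ^ ((q - s) mod q) * a)) + (1 + fps_X) ^ ((q - s) mod q) * a) = red p q 0"
      unfolding red_eq_iff using pdvd_upto_red[of p q "- ((1 + fps_X) ^ ((q - s) mod q) * a)"] by simp
    ultimately show "?y \<otimes>\<^bsub>lampgroup p q\<^esub> x = \<one>\<^bsub>lampgroup p q\<^esub>"
      by (simp add: lampgroup_simps x)
  qed
  fix y assume "y \<in> carrier (lampgroup p q)"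
  then obtain b t where y: "y = (b, t)" "red p q b = b" "t < q" by (auto simp: lampgroup_simps)
  show "x \<otimes>\<^bsub>lampgroup p q\<^esub> y \<in> carrier (lampgroup p q)" using q0 by (simp add: lampgroup_simps x y)
  fix z assume "z \<in> carrier (lampgroup p q)"
  then obtain c r where z: "z = (c, r)" "red p q c = c" "r < q" by (auto simp: lampgroup_simps)
  let ?w = "1 + fps_X :: int fps"
  have "red p q (red p q (a + ?w ^ s * b) + ?w ^ ((s + t) mod q) * c)
      = red p q (a + ?w ^ s * red p q (b + ?w ^ t * c))"
    unfolding red_eq_iff
  proof -
    have 1: "pdvd_upto p q (red p q (a + ?w ^ s * b) - (a + ?w ^ s * b))" by (rule pdvd_upto_red)
    \<comment> \<open>Reducing the exponent modulo \<open>q\<close> changes nothing because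
      \<open>q\<close> is a power of \<open>p\<close>; associativity rests on this.\<close>
    have 2: "pdvd_upto p q ((?w ^ ((s + t) mod q) - ?w ^ (s + t)) * c)"
      unfolding q by (intro pdvd_upto_mult_right power_cong_pdvd_upto p) (simp add: cong_def)
    have 3: "pdvd_upto p q (?w ^ s * (red p q (b + ?w ^ t * c) - (b + ?w ^ t * c)))"
      by (intro pdvd_upto_mult_left pdvd_upto_red)
    have "red p q (a + ?w ^ s * b) + ?w ^ ((s + t) mod q) * c - (a + ?w ^ s * red p q (b + ?w ^ t * c))
      = (red p q (a + ?w ^ s * b) - (a + ?w ^ s * b)) + (?w ^ ((s + t) mod q) - ?w ^ (s + t)) * c
        - ?w ^ s * (red p q (b + ?w ^ t * c) - (b + ?w ^ t * c))"
      by (simp add: power_add algebra_simps)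
    then show "pdvd_upto p q (red p q (a + ?w ^ s * b) + ?w ^ ((s + t) mod q) * c - (a + ?w ^ s * red p q (b + ?w ^ t * c)))"
      using pdvd_upto_diff[OF pdvd_upto_add[OF 1 2] 3] by (simp only:)
  qed
  then show "x \<otimes>\<^bsub>lampgroup p q\<^esub> y \<otimes>\<^bsub>lampgroup p q\<^esub> z = x \<otimes>\<^bsub>lampgroup p q\<^esub> (y \<otimes>\<^bsub>lampgroup p q\<^esub> z)"
    unfolding x y z lampgroup_simps prod.case by (simp add: mod_add_left_eq mod_add_right_eq add.assoc)
qed

lemma card_red:
  assumes "p > 0" shows "finite {f. red p q f = f}" "card {f. red p q f = f} = p ^ q"
proof -
  have b: "bij_betw (\<lambda>f. restrict (fps_nth f) {..<q}) {f. red p q f = f} (PiE {..<q} (\<lambda>_. {0..<int p}))"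
  proof (rule bij_betw_imageI)
    show "inj_on (\<lambda>f. restrict (fps_nth f) {..<q}) {f. red p q f = f}"
    proof (rule inj_onI)
      fix f g assume f: "f \<in> {f. red p q f = f}" and g: "g \<in> {f. red p q f = f}"
        and e: "restrict (fps_nth f) {..<q} = restrict (fps_nth g) {..<q}"
      have "red p q f = red p q g"
      proof (rule fps_ext)
        fix n show "red p q f $ n = red p q g $ n"
          using fun_cong[OF e, of n] by (cases "n < q") (simp_all add: red_nth)
      qed
      then show "f = g" using f g by simp
    qed
    show "(\<lambda>f. restrict (fps_nth f) {..<q}) ` {f. red p q f = f} = PiE {..<q} (\<lambda>_. {0..<int p})"
    proof (intro equalityI subsetI)
      fix h assume "h \<in> (\<lambda>f. restrict (fps_nth f) {..<q}) ` {f. red p q f = f}"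
      then obtain f where f: "red p q f = f" "h = restrict (fps_nth f) {..<q}" by auto
      have "f $ n \<in> {0..<int p}" if "n < q" for n
      proof -
        have "f $ n = f $ n mod int p" using arg_cong[OF f(1), of "\<lambda>f. f $ n"] that by (simp add: red_nth)
        then show ?thesis using assms pos_mod_bound[of "int p" "f $ n"] pos_mod_sign[of "int p" "f $ n"] by simp
      qed
      then show "h \<in> PiE {..<q} (\<lambda>_. {0..<int p})" unfolding f(2) by (simp add: PiE_iff)
    next
      fix h assume h: "h \<in> PiE {..<q} (\<lambda>_. {0..<int p})"
      define f where "f = Abs_fps (\<lambda>n. if n < q then h n else 0)"
      have "red p q f = f"
        by (rule fps_ext) (use h in \<open>auto simp: red_nth f_def PiE_iff\<close>)
      moreover have "h = restrict (fps_nth f) {..<q}"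
        using h by (auto simp: f_def fun_eq_iff PiE_iff extensional_def)
      ultimately show "h \<in> (\<lambda>f. restrict (fps_nth f) {..<q}) ` {f. red p q f = f}" by blast
    qed
  qed
  show "finite {f. red p q f = f}" unfolding bij_betw_finite[OF b] by (intro finite_PiE) auto
  show "card {f. red p q f = f} = p ^ q" unfolding bij_betw_same_card[OF b] by (subst card_PiE) auto
qed

lemma p_group_lampgroup:
  assumes "Factorial_Ring.prime p"
  shows "p_group p (lampgroup p (p ^ m))"
proof -
  have "p > 0" using assms by (simp add: prime_gt_0_nat)
  then have "card (carrier (lampgroup p (p ^ m))) = p ^ (p ^ m + m)"
    by (simp add: lampgroup_simps card_cartesian_product card_red power_add)
  then show ?thesis unfolding p_group_def
    using group_lampgroup[OF assms refl] card_red(1)[OF \<open>p > 0\<close>] by (auto simp: lampgroup_simps)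
qed

text \<open>Transition map of the inverse system of finite lamplighter groups, used to compare the
  maps from \<open>G\<close> to consecutive levels.\<close>

lemma lampgroup_truncate:
  assumes p: "Factorial_Ring.prime p"
  shows "(\<lambda>(a, s). (red p (p ^ m) a, s mod p ^ m)) \<in> hom (lampgroup p (p ^ Suc m)) (lampgroup p (p ^ m))"
proof (rule homI)
  let ?q = "p ^ m" and ?w = "1 + fps_X :: int fps"
  have q0: "?q > 0" using p by (simp add: prime_gt_0_nat)
  fix x y assume "x \<in> carrier (lampgroup p (p ^ Suc m))" "y \<in> carrier (lampgroup p (p ^ Suc m))"
  obtain a s b t where xy: "x = (a, s)" "y = (b, t)" by fastforce
  show "(\<lambda>(a, s). (red p ?q a, s mod ?q)) x \<in> carrier (lampgroup p ?q)"
    using q0 by (simp add: xy lampgroup_simps)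
  have 1: "(s + t) mod p ^ Suc m mod ?q = (s mod ?q + t mod ?q) mod ?q"
    by (simp add: mod_add_eq mod_mod_cancel)
  have "red p ?q (red p (p ^ Suc m) (a + ?w ^ s * b)) = red p ?q (red p ?q a + ?w ^ (s mod ?q) * red p ?q b)"
    unfolding red_eq_iff
  proof -
    have "pdvd_upto p ?q (red p (p ^ Suc m) (a + ?w ^ s * b) - (a + ?w ^ s * b))"
      by (rule pdvd_upto_mono[OF pdvd_upto_red]) (use prime_gt_0_nat[OF p] in simp)
    moreover have "pdvd_upto p ?q (red p ?q a - a)" "pdvd_upto p ?q (?w ^ (s mod ?q) * (red p ?q b - b))"
      by (intro pdvd_upto_mult_left pdvd_upto_red)+
    moreover have "pdvd_upto p ?q ((?w ^ (s mod ?q) - ?w ^ s) * b)"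
      by (intro pdvd_upto_mult_right power_cong_pdvd_upto p) (simp add: cong_def)
    moreover have "red p (p ^ Suc m) (a + ?w ^ s * b) - (red p ?q a + ?w ^ (s mod ?q) * red p ?q b)
       = (red p (p ^ Suc m) (a + ?w ^ s * b) - (a + ?w ^ s * b)) - (red p ?q a - a)
         - ?w ^ (s mod ?q) * (red p ?q b - b) - (?w ^ (s mod ?q) - ?w ^ s) * b"
      by (simp add: algebra_simps)
    ultimately show "pdvd_upto p ?q (red p (p ^ Suc m) (a + ?w ^ s * b) - (red p ?q a + ?w ^ (s mod ?q) * red p ?q b))"
      by (simp only: pdvd_upto_diff)
  qed
  then show "(\<lambda>(a, s). (red p ?q a, s mod ?q)) (x \<otimes>\<^bsub>lampgroup p (p ^ Suc m)\<^esub> y)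
     = (\<lambda>(a, s). (red p ?q a, s mod ?q)) x \<otimes>\<^bsub>lampgroup p ?q\<^esub> (\<lambda>(a, s). (red p ?q a, s mod ?q)) y"
    unfolding xy lampgroup_simps prod.case 1 by (rule arg_cong)
qed

section \<open>Elimination of tensors\<close>

text \<open>The pair \<open>H\<close>, \<open>r\<close> encodes, without division, an \<open>R\<close>-linear functional \<open>c \<mapsto> s/r\<close> on the span of \<open>R\<close>, \<open>b\<close>, \<open>C\<close>
  that vanishes on \<open>R\<close> and is \<open>1\<close> at \<open>b\<close>.\<close>

lemma elimination_submodule:
  fixes R :: "int fps set" and b :: "int fps"
  assumes p: "Factorial_Ring.prime p"
    and Radd: "\<And>f g. f \<in> R \<Longrightarrow> g \<in> R \<Longrightarrow> f + g \<in> R"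
    and Rmult: "\<And>f g. f \<in> R \<Longrightarrow> g \<in> R \<Longrightarrow> f * g \<in> R"
    and Rint: "\<And>n. of_int n \<in> R"
    and Rzp: "\<And>f. pdvd p f \<Longrightarrow> f \<in> R"
    and b: "\<And>r. r \<in> R \<Longrightarrow> r * b \<in> R \<Longrightarrow> pdvd p r"
    and C: "finite C"
  shows "\<exists>H r. R \<subseteq> H \<and> (\<forall>f\<in>H. \<forall>g\<in>H. f + g \<in> H) \<and> (\<forall>f\<in>R. \<forall>g\<in>H. f * g \<in> H)
     \<and> (\<forall>s\<in>R. s * b \<in> H \<longrightarrow> pdvd p s) \<and> r \<in> R \<and> \<not> pdvd p r
     \<and> (\<forall>c\<in>C. \<exists>s\<in>R. r * c - s * b \<in> H)"
  using C
proof (induction C)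
  case empty
  have "\<not> pdvd p 1" using p by (auto simp: pdvd_def intro!: exI[of _ 0] dest: not_prime_unit)
  then show ?case using Radd Rmult Rint[of 1] b by (intro exI[of _ R] exI[of _ 1]) auto
next
  case (insert c C)
  then obtain H r where H: "R \<subseteq> H" "\<And>f g. f \<in> H \<Longrightarrow> g \<in> H \<Longrightarrow> f + g \<in> H"
    "\<And>f g. f \<in> R \<Longrightarrow> g \<in> H \<Longrightarrow> f * g \<in> H"
    "\<And>s. s \<in> R \<Longrightarrow> s * b \<in> H \<Longrightarrow> pdvd p s" "r \<in> R" "\<not> pdvd p r"
    "\<And>c. c \<in> C \<Longrightarrow> \<exists>s\<in>R. r * c - s * b \<in> H" by metis
  have R0: "0 \<in> R" and R1: "1 \<in> R" and Rm1: "- 1 \<in> R" using Rint[of 0] Rint[of 1] Rint[of "-1"] by simp_all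
  have Rneg: "- f \<in> R" if "f \<in> R" for f using Rmult[OF Rm1 that] by simp
  have Hneg: "- f \<in> H" if "f \<in> H" for f using H(3)[OF Rm1 that] by simp
  show ?case
  proof (cases "\<forall>s\<in>R. \<forall>s'\<in>R. s * b - s' * c \<in> H \<longrightarrow> pdvd p s")
    case True
    \<comment> \<open>No nonzero multiple of \<open>b\<close> lies in \<open>H + R c\<close>, so
      \<open>c\<close> may be adjoined to \<open>H\<close>: the functional is extended by
      \<open>0\<close> at \<open>c\<close>.\<close>
    define H' where "H' = {f. \<exists>s'\<in>R. f - s' * c \<in> H}"
    have HH': "H \<subseteq> H'" unfolding H'_def using R0 by (auto intro!: bexI[of _ 0])
    have "f + g \<in> H'" if "f \<in> H'" "g \<in> H'" for f g
    proof -
      from that obtain s t where "s \<in> R" "t \<in> R" "f - s * c \<in> H" "g - t * c \<in> H" unfolding H'_def by blast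
      then have "(f + g) - (s + t) * c \<in> H" using H(2)[of "f - s * c" "g - t * c"] by (simp add: algebra_simps)
      then show ?thesis unfolding H'_def using Radd \<open>s \<in> R\<close> \<open>t \<in> R\<close> by blast
    qed
    moreover have "f * g \<in> H'" if "f \<in> R" "g \<in> H'" for f g
    proof -
      from that obtain t where "t \<in> R" "g - t * c \<in> H" unfolding H'_def by blast
      then have "f * g - (f * t) * c \<in> H" using H(3)[OF that(1), of "g - t * c"] by (simp add: algebra_simps)
      then show ?thesis unfolding H'_def using Rmult that(1) \<open>t \<in> R\<close> by blast
    qed
    moreover have "pdvd p s" if "s \<in> R" "s * b \<in> H'" for s
      using that True unfolding H'_def by blast
    moreover have "\<exists>s\<in>R. r * d - s * b \<in> H'" if "d \<in> insert c C" for d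
    proof (cases "d = c")
      case True
      have "r * c \<in> H'" unfolding H'_def using H(1,5) R0 by (auto intro!: bexI[of _ r])
      then show ?thesis using True R0 by (auto intro!: bexI[of _ 0])
    next
      case False then show ?thesis using that H(7) HH' by blast
    qed
    ultimately show ?thesis using H(1,5,6) HH'
      by (intro exI[of _ H'] exI[of _ r]) blast
  next
    case False
    \<comment> \<open>Here \<open>s b = s' c\<close> modulo \<open>H\<close> with \<open>s\<close>
      nonzero modulo \<open>p\<close>. The value at \<open>c\<close> is forced to be
      \<open>s/s'\<close>, and \<open>s'\<close> joins the common denominator
      \<open>r\<close>.\<close>
    then obtain s s' where s: "s \<in> R" "s' \<in> R" "s * b - s' * c \<in> H" "\<not> pdvd p s" by blast
    have s': "\<not> pdvd p s'"
    proof
      assume "pdvd p s'"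
      then have "s' * c \<in> H" using H(1) Rzp pdvd_mult_right by blast
      then have "s * b \<in> H" using H(2)[OF s(3), of "s' * c"] by simp
      then show False using H(4) s by blast
    qed
    have "\<not> pdvd p (r * s')" using pdvd_mult_cases[OF p] H(6) s' by blast
    moreover have "\<exists>t\<in>R. (r * s') * d - t * b \<in> H" if d: "d \<in> insert c C" for d
    proof (cases "d = c")
      case True
      have "(r * s') * c - (r * s) * b = r * - (s * b - s' * c)" by (simp add: algebra_simps)
      also have "\<dots> \<in> H" by (rule H(3)[OF H(5) Hneg[OF s(3)]])
      finally show ?thesis using True Rmult[OF H(5) s(1)] by blast
    next
      case False
      then obtain t where t: "t \<in> R" "r * d - t * b \<in> H" using H(7)[of d] d by blast
      have "(r * s') * d - (s' * t) * b = s' * (r * d - t * b)" by (simp add: algebra_simps)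
      also have "\<dots> \<in> H" by (rule H(3)[OF s(2) t(2)])
      finally show ?thesis using Rmult[OF s(2) t(1)] by blast
    qed
    ultimately show ?thesis using H(1-4) Rmult[OF H(5) s(2)]
      by (intro exI[of _ H] exI[of _ "r * s'"]) blast
  qed
qed

lemma fps_mult_nth_atMost: "(f * g) $ n = (\<Sum>i\<le>n. f $ i * g $ (n - i))"
  by (simp add: fps_mult_nth atLeast0AtMost)

text \<open>A tensor is represented by the family, indexed by \<open>i\<close>, of the coefficients of \<open>X^i\<close> in its first factor.\<close>

lemma tensor_not_boundary:
  fixes R :: "int fps set" and b :: "int fps" and e :: "'t \<Rightarrow> int"
  assumes p: "Factorial_Ring.prime p"
    and Radd: "\<And>f g. f \<in> R \<Longrightarrow> g \<in> R \<Longrightarrow> f + g \<in> R"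
    and Rmult: "\<And>f g. f \<in> R \<Longrightarrow> g \<in> R \<Longrightarrow> f * g \<in> R"
    and Rint: "\<And>n. of_int n \<in> R"
    and Rzp: "\<And>f. pdvd p f \<Longrightarrow> f \<in> R"
    and b: "\<And>r. r \<in> R \<Longrightarrow> r * b \<in> R \<Longrightarrow> pdvd p r"
    and T: "finite T"
    and chi: "\<And>t. t \<in> T \<Longrightarrow> chi t \<in> R" "\<And>t. t \<in> T \<Longrightarrow> pdvd p (chi' t * chi t - 1)"
    and beta: "\<And>i. beta i \<in> R"
    and h: "\<And>i. pdvd p ((if i = 0 then b else 0) - beta i
       - (\<Sum>t\<in>T. of_int (e t) * (of_int (a t $ i) * c t - of_int ((chi' t * a t) $ i) * (chi t * c t))))"
  shows False
proof -
  have "\<exists>H r. R \<subseteq> H \<and> (\<forall>f\<in>H. \<forall>g\<in>H. f + g \<in> H) \<and> (\<forall>f\<in>R. \<forall>g\<in>H. f * g \<in> H)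
     \<and> (\<forall>s\<in>R. s * b \<in> H \<longrightarrow> pdvd p s) \<and> r \<in> R \<and> \<not> pdvd p r \<and> (\<forall>d\<in>c ` T. \<exists>s\<in>R. r * d - s * b \<in> H)"
    by (rule elimination_submodule[OF p], erule (1) Radd, erule (1) Rmult, rule Rint, erule Rzp,
        erule (1) b, rule finite_imageI[OF T])
  then obtain H r where H0: "R \<subseteq> H" "\<forall>f\<in>H. \<forall>g\<in>H. f + g \<in> H" "\<forall>f\<in>R. \<forall>g\<in>H. f * g \<in> H"
     "\<forall>s\<in>R. s * b \<in> H \<longrightarrow> pdvd p s" "r \<in> R" "\<not> pdvd p r" "\<forall>d\<in>c ` T. \<exists>s\<in>R. r * d - s * b \<in> H"
    by (elim exE conjE)
  note H = H0(1) H0(2,3,4)[rule_format] H0(5-6) H0(7)[rule_format]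
  have "\<forall>t\<in>T. \<exists>s. s \<in> R \<and> r * c t - s * b \<in> H" using H(7) by blast
  then obtain s where s: "\<And>t. t \<in> T \<Longrightarrow> s t \<in> R" "\<And>t. t \<in> T \<Longrightarrow> r * c t - s t * b \<in> H" by metis
  have Rdiff: "f - g \<in> R" if "f \<in> R" "g \<in> R" for f g
    using Radd[OF that(1) Rmult[OF Rint[of "-1"] that(2)]] by simp
  have Hdiff: "f - g \<in> H" if "f \<in> H" "g \<in> H" for f g
    using H(2)[OF that(1) H(3)[OF Rint[of "-1"] that(2)]] by simp
  have Rsum: "(\<And>t. t \<in> T \<Longrightarrow> f t \<in> R) \<Longrightarrow> sum f T \<in> R" for f
    using T Rint[of 0] Radd by (induction T) auto
  have Hsum: "(\<And>t. t \<in> T \<Longrightarrow> f t \<in> H) \<Longrightarrow> sum f T \<in> H" for f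
    using T Rint[of 0] H(1,2) by (induction T) auto
  \<comment> \<open>The functional is applied to the second tensor factor of the assumed identity,
    and denominators are cleared by \<open>r\<close>; \<open>s t\<close> is \<open>r\<close> times
    its value at \<open>c t\<close>. The terms \<open>beta i\<close> disappear because the
    functional kills \<open>R\<close>.\<close>
  define Q where "Q i = (if i = 0 then r else 0)
      - (\<Sum>t\<in>T. of_int (e t) * (of_int (a t $ i) * s t - of_int ((chi' t * a t) $ i) * (chi t * s t)))" for i
  have QR: "Q i \<in> R" for i
    unfolding Q_def by (intro Rdiff Rsum Rmult) (use Rint Rint[of 0] H(5) chi(1) s(1) in auto)
  \<comment> \<open>As \<open>Q i\<close> is in \<open>R\<close>, it suffices that
    \<open>Q i * b\<close> is in \<open>H\<close>. Modulo \<open>H\<close> each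
    \<open>s t * b\<close> may be replaced by \<open>r * c t\<close>, and then the assumed identity
    applies.\<close>
  have "pdvd p (Q i)" for i
  proof (rule H(4)[OF QR])
    let ?S = "\<Sum>t\<in>T. of_int (e t) * (of_int (a t $ i) * c t - of_int ((chi' t * a t) $ i) * (chi t * c t))"
    let ?S' = "\<Sum>t\<in>T. of_int (e t) * (of_int (a t $ i) * s t - of_int ((chi' t * a t) $ i) * (chi t * s t))"
    have "r * ?S - ?S' * b = (\<Sum>t\<in>T. of_int (e t) * (of_int (a t $ i) * (r * c t - s t * b)
        - of_int ((chi' t * a t) $ i) * (chi t * (r * c t - s t * b))))"
      unfolding sum_distrib_left sum_distrib_right sum_subtractf[symmetric]
      by (intro sum.cong) (auto simp: algebra_simps)
    also have "\<dots> \<in> H"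
    proof (rule Hsum)
      fix t assume t: "t \<in> T"
      show "of_int (e t) * (of_int (a t $ i) * (r * c t - s t * b)
        - of_int ((chi' t * a t) $ i) * (chi t * (r * c t - s t * b))) \<in> H"
        by (rule H(3)[OF Rint Hdiff[OF H(3)[OF Rint s(2)[OF t]] H(3)[OF Rint H(3)[OF chi(1)[OF t] s(2)[OF t]]]]])
    qed
    finally have 1: "r * ?S - ?S' * b \<in> H" .
    have 2: "r * ((if i = 0 then b else 0) - beta i - ?S) \<in> H"
      using h[of i] Rzp H(1) pdvd_mult_left by blast
    have 3: "r * beta i \<in> H" using Rmult[OF H(5) beta] H(1) by blast
    have "Q i * b = r * ((if i = 0 then b else 0) - beta i - ?S) + (r * ?S - ?S' * b) + r * beta i"
      by (cases "i = 0") (simp_all add: Q_def algebra_simps)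
    then show "Q i * b \<in> H" using H(2)[OF H(2)[OF 2 1] 3] by simp
  qed
  then have Qd: "int p dvd Q i $ n" for i n by (simp add: pdvd_def)
  have "pdvd p r" unfolding pdvd_def
  proof
    fix n
    let ?U = "\<Sum>t\<in>T. e t * ((a t * s t) $ n - ((chi' t * a t) * (chi t * s t)) $ n)"
    \<comment> \<open>Summing over the indices \<open>i\<close> and \<open>n - i\<close> multiplies
      the two tensor factors together. This kills every relation because
      \<open>chi' t * chi t = 1\<close> modulo \<open>p\<close>, so only \<open>r\<close>
      survives.\<close>
    have "(\<Sum>i\<le>n. Q i $ (n - i)) = (\<Sum>i\<le>n. (if i = 0 then r $ n else 0))
       - (\<Sum>i\<le>n. \<Sum>t\<in>T. e t * (a t $ i * s t $ (n - i) - (chi' t * a t) $ i * (chi t * s t) $ (n - i)))"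
      unfolding sum_subtractf[symmetric]
      by (intro sum.cong) (auto simp: Q_def fps_sum_nth fps_of_int[symmetric])
    also have "(\<Sum>i\<le>n. (if i = 0 then r $ n else 0)) = r $ n" by (simp add: sum.delta)
    also have "(\<Sum>i\<le>n. \<Sum>t\<in>T. e t * (a t $ i * s t $ (n - i) - (chi' t * a t) $ i * (chi t * s t) $ (n - i))) = ?U"
      unfolding fps_mult_nth_atMost[of "a _" "s _"] fps_mult_nth_atMost[of "chi' _ * a _" "chi _ * s _"]
      by (subst sum.swap) (simp add: sum_distrib_left sum_subtractf right_diff_distrib)
    finally have r: "r $ n = (\<Sum>i\<le>n. Q i $ (n - i)) + ?U" by simp
    have "int p dvd ?U"
    proof (intro dvd_sum dvd_mult)
      fix t assume t: "t \<in> T"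
      have "pdvd p ((chi' t * chi t - 1) * (a t * s t))" by (rule pdvd_mult_right[OF chi(2)[OF t]])
      moreover have "(chi' t * a t) * (chi t * s t) - a t * s t = (chi' t * chi t - 1) * (a t * s t)"
        by (simp add: algebra_simps)
      ultimately have "pdvd p (a t * s t - (chi' t * a t) * (chi t * s t))"
        by (metis pdvd_uminus minus_diff_eq)
      then show "int p dvd (a t * s t) $ n - ((chi' t * a t) * (chi t * s t)) $ n"
        by (simp add: pdvd_def)
    qed
    then show "int p dvd r $ n" unfolding r by (rule dvd_add[OF dvd_sum[OF Qd]])
  qed
  then show False using H(6) by blast
qed

section \<open>Spans of powers of 1 + X\<close>

text \<open>The base case admits every series divisible by \<open>p\<close>, so membership depends
  only on the class in F_p[[X]]; there the set is the F_p-span of the values of \<open>chi\<close>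
  on \<open>S\<close>.\<close>

inductive_set chispan :: "nat \<Rightarrow> 'g set \<Rightarrow> ('g \<Rightarrow> int fps) \<Rightarrow> int fps set"
  for p :: nat and S :: "'g set" and chi :: "'g \<Rightarrow> int fps" where
    zero: "pdvd p f \<Longrightarrow> f \<in> chispan p S chi"
  | step: "f \<in> chispan p S chi \<Longrightarrow> g \<in> S \<Longrightarrow> f + of_int c * chi g \<in> chispan p S chi"

lemma chispan_add:
  assumes "f \<in> chispan p S chi" "g \<in> chispan p S chi"
  shows "f + g \<in> chispan p S chi"
  using assms(2)
proof induction
  case (zero g)
  show ?case using assms(1)
  proof induction
    case (zero f) then show ?case using \<open>pdvd p g\<close> by (simp add: chispan.zero pdvd_add)
  next
    case (step f h c)
    then show ?case using chispan.step[OF step(3) step(2), of c] by (simp add: algebra_simps)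
  qed
next
  case (step g h c)
  then show ?case using chispan.step[OF step(3) step(2), of c] by (simp add: algebra_simps)
qed

lemma chispan_of_int:
  assumes "g \<in> S" "pdvd p (chi g - 1)"
  shows "of_int n \<in> chispan p S chi"
proof -
  have "of_int (- n) * (chi g - 1) + of_int n * chi g \<in> chispan p S chi"
    by (intro chispan.step chispan.zero pdvd_mult_left assms)
  then show ?thesis by (simp add: algebra_simps)
qed

lemma chispan_mem: "g \<in> S \<Longrightarrow> chi g \<in> chispan p S chi"
  using chispan.step[OF chispan.zero[OF pdvd_0], of g S 1 chi p] by simp

lemma chispan_mult:
  assumes mul: "\<And>g h. g \<in> S \<Longrightarrow> h \<in> S \<Longrightarrow> \<exists>k\<in>S. pdvd p (chi g * chi h - chi k)"
    and f: "f \<in> chispan p S chi" and g: "g \<in> chispan p S chi"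
  shows "f * g \<in> chispan p S chi"
  using g
proof induction
  case (zero g) then show ?case by (intro chispan.zero pdvd_mult_left)
next
  case (step g h c)
  have "f * chi h \<in> chispan p S chi" using f
  proof induction
    case (zero f) then show ?case by (intro chispan.zero pdvd_mult_right)
  next
    case (step f k d)
    obtain l where l: "l \<in> S" "pdvd p (chi k * chi h - chi l)" using mul step(2) \<open>h \<in> S\<close> by blast
    have "(f + of_int d * chi k) * chi h = (f * chi h + of_int d * chi l) + of_int d * (chi k * chi h - chi l)"
      by (simp add: algebra_simps)
    then show ?case using chispan_add[OF chispan.step[OF step(3) l(1)] chispan.zero[OF pdvd_mult_left[OF l(2)]]]
      by simp
  qed
  then have *: "(of_int c * f) * chi h \<in> chispan p S chi" for c
  proof -
    assume a: "f * chi h \<in> chispan p S chi"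
    have "of_int c * x \<in> chispan p S chi" if "x \<in> chispan p S chi" for x
      using that
    proof induction
      case (zero x) then show ?case by (intro chispan.zero pdvd_mult_left)
    next
      case (step x k d)
      then show ?case using chispan.step[OF step(3) step(2), of "c * d"] by (simp add: algebra_simps)
    qed
    from this[OF a] show ?thesis by (simp add: mult.assoc)
  qed
  show ?case using chispan_add[OF step(3) *[of c]] by (simp add: algebra_simps)
qed

text \<open>Terms whose values of \<open>chi\<close> agree modulo \<open>p\<close> are merged, and
  terms with coefficient divisible by \<open>p\<close> are dropped. What remains are distinct atoms
  with nonzero weights.\<close>

lemma chispan_normal_form:
  assumes "f \<in> chispan p S chi"
  shows "\<exists>J c. finite J \<and> J \<subseteq> S \<and> (\<forall>j\<in>J. \<not> int p dvd c j)
    \<and> (\<forall>j\<in>J. \<forall>k\<in>J. j \<noteq> k \<longrightarrow> \<not> pdvd p (chi j - chi k)) \<and> pdvd p (f - (\<Sum>j\<in>J. of_int (c j) * chi j))"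
  using assms
proof induction
  case (zero f) then show ?case by (intro exI[of _ "{}"]) simp
next
  case (step f g d)
  then obtain J c where J: "finite J" "J \<subseteq> S" "\<forall>j\<in>J. \<not> int p dvd c j"
    "\<forall>j\<in>J. \<forall>k\<in>J. j \<noteq> k \<longrightarrow> \<not> pdvd p (chi j - chi k)" "pdvd p (f - (\<Sum>j\<in>J. of_int (c j) * chi j))"
    by blast
  show ?case
  proof (cases "\<exists>j\<in>J. pdvd p (chi g - chi j)")
    case True
    then obtain j where j: "j \<in> J" "pdvd p (chi g - chi j)" by blast
    define c' where "c' = c(j := c j + d)"
    have r: "(\<Sum>k\<in>J - {j}. of_int (c' k) * chi k) = (\<Sum>k\<in>J - {j}. of_int (c k) * chi k)"
      by (intro sum.cong) (auto simp: c'_def)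
    have s: "pdvd p (f + of_int d * chi g - (of_int (c j + d) * chi j + (\<Sum>k\<in>J - {j}. of_int (c' k) * chi k)))"
    proof -
      have "pdvd p ((f - (\<Sum>j\<in>J. of_int (c j) * chi j)) + of_int d * (chi g - chi j))"
        by (intro pdvd_add J(5) pdvd_mult_left j(2))
      then show ?thesis unfolding r sum.remove[OF J(1) j(1)] by (simp add: algebra_simps)
    qed
    show ?thesis
    proof (cases "int p dvd c j + d")
      case True
      have "pdvd p (f + of_int d * chi g - (\<Sum>k\<in>J - {j}. of_int (c' k) * chi k))"
        using pdvd_add[OF s pdvd_of_int[OF True, of "chi j"]] by (simp add: algebra_simps)
      then show ?thesis using J by (intro exI[of _ "J - {j}"] exI[of _ c']) (auto simp: c'_def)
    next
      case False
      have "pdvd p (f + of_int d * chi g - (\<Sum>k\<in>J. of_int (c' k) * chi k))"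
        using s unfolding sum.remove[OF J(1) j(1)] by (simp add: c'_def)
      then show ?thesis using J False by (intro exI[of _ J] exI[of _ c']) (auto simp: c'_def)
    qed
  next
    case False
    show ?thesis
    proof (cases "int p dvd d")
      case True
      have "pdvd p ((f - (\<Sum>j\<in>J. of_int (c j) * chi j)) + of_int d * chi g)"
        by (intro pdvd_add J(5) pdvd_of_int True)
      then show ?thesis using J by (intro exI[of _ J] exI[of _ c]) (simp add: algebra_simps)
    next
      case d: False
      have gJ: "g \<notin> J" using False by auto
      define c' where "c' = c(g := d)"
      have "(\<Sum>k\<in>J. of_int (c' k) * chi k) = (\<Sum>k\<in>J. of_int (c k) * chi k)"
        using gJ by (intro sum.cong) (auto simp: c'_def)
      then have "pdvd p (f + of_int d * chi g - (\<Sum>k\<in>insert g J. of_int (c' k) * chi k))"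
        using J(1,5) gJ by (simp add: c'_def)
      moreover have "\<forall>j\<in>insert g J. \<forall>k\<in>insert g J. j \<noteq> k \<longrightarrow> \<not> pdvd p (chi j - chi k)"
        using J(4) False by (metis insert_iff minus_diff_eq pdvd_uminus)
      moreover have "\<forall>j\<in>insert g J. \<not> int p dvd c' j" using J(3) d by (auto simp: c'_def)
      ultimately show ?thesis using J(1,2) step(2) by (intro exI[of _ "insert g J"] exI[of _ c'] conjI) simp_all
    qed
  qed
qed

section \<open>Atoms of truncated measures on Z_p\<close>

lemma cong_prime_power_less:
  fixes p :: nat
  assumes "1 < p" "[p ^ i = p ^ j] (mod p ^ m)" "i < m" "j < m"
  shows "i = j"
proof -
  have "p ^ i < p ^ m" "p ^ j < p ^ m" using assms by (simp_all add: power_strict_increasing)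
  then have "p ^ i = p ^ j" using assms(2) by (simp add: cong_def)
  then show ?thesis using assms(1) by (simp add: power_inject_exp)
qed

text \<open>The truncation at level \<open>m\<close> of the measure on \<open>Z_p\<close> with weights \<open>\<epsilon> i\<close> at \<open>p^i\<close> and \<open>-p^i\<close>, balanced at \<open>0\<close>.\<close>

definition atom_series :: "nat \<Rightarrow> nat set \<Rightarrow> (nat \<Rightarrow> int) \<Rightarrow> nat \<Rightarrow> int fps" where
  "atom_series p E \<epsilon> m = (\<Sum>i\<in>E \<inter> {..<m}. of_int (\<epsilon> i) *
      ((1 + fps_X) ^ (p ^ i) + (1 + fps_X) ^ (p ^ m - p ^ i) - 2))"

text \<open>Multiplication of series is convolution of measures. The label \<open>t\<close> runs
  over the atoms \<open>p^i\<close>, \<open>-p^i\<close> and \<open>0\<close> belonging to the index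
  \<open>i\<close>, with \<open>-p^i\<close> written as \<open>p^m - p^i\<close>.\<close>

lemma atom_series_product:
  assumes "finite J"
  shows "(\<Sum>j\<in>J. of_int (c j) * (1 + fps_X) ^ s j) * atom_series p E \<epsilon> m =
    (\<Sum>(j, i, t)\<in>J \<times> (E \<inter> {..<m}) \<times> {0, 1, 2}. of_int (c j * \<epsilon> i * (if t = 2 then -2 else 1)) *
      (1 + fps_X) ^ (s j + (if t = (0::nat) then p ^ i else if t = 1 then p ^ m - p ^ i else 0)))"
  unfolding atom_series_def sum_product sum.cartesian_product[symmetric]
  by (intro sum.cong refl) (simp add: algebra_simps power_add)

text \<open>Modulo \<open>p^m\<close>, the product has an atom at \<open>s j0 + p^i\<close> unless another term hits this point. Only boundedly many \<open>i\<close> are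
  excluded in this way, independently of \<open>m\<close>.\<close>

lemma atom_series_multiple_not_in_span:
  fixes s :: "nat \<Rightarrow> 'g \<Rightarrow> nat"
  assumes p: "Factorial_Ring.prime p"
    and chi: "\<And>g m. g \<in> S \<Longrightarrow> pdvd_upto p (p ^ m) (chi g - (1 + fps_X) ^ s m g)"
    and s: "\<And>g m m'. g \<in> S \<Longrightarrow> m \<le> m' \<Longrightarrow> [s m' g = s m g] (mod p ^ m)"
    and E: "infinite E" and eps: "\<And>i. i \<in> E \<Longrightarrow> \<not> int p dvd \<epsilon> i"
    and b: "\<And>m. pdvd_upto p (p ^ m) (b - atom_series p E \<epsilon> m)"
    and r: "r \<in> chispan p S chi" "r * b \<in> chispan p S chi"
  shows "pdvd p r"
proof (rule ccontr)
  assume nr: "\<not> pdvd p r"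
  have p1: "1 < p" by (rule prime_gt_1_nat[OF p])
  obtain J c where J: "finite J" "J \<subseteq> S" "\<And>j. j \<in> J \<Longrightarrow> \<not> int p dvd c j"
    "\<And>j k. j \<in> J \<Longrightarrow> k \<in> J \<Longrightarrow> j \<noteq> k \<Longrightarrow> \<not> pdvd p (chi j - chi k)" "pdvd p (r - (\<Sum>j\<in>J. of_int (c j) * chi j))"
    using chispan_normal_form[OF r(1)] by metis
  obtain K d where K: "finite K" "K \<subseteq> S" "pdvd p (r * b - (\<Sum>j\<in>K. of_int (d j) * chi j))"
    using chispan_normal_form[OF r(2)] by metis
  have "J \<noteq> {}" using J(5) nr by auto
  then obtain j0 where j0: "j0 \<in> J" by blast
  \<comment> \<open>Elements with different values of \<open>chi\<close> have different exponents in
    Z_p, hence different exponents modulo some \<open>p^m\<close>.\<close>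
  have "\<exists>m. \<not> [s m j = s m j0] (mod p ^ m)" if j: "j \<in> J" "j \<noteq> j0" for j
  proof (rule ccontr)
    assume "\<not> ?thesis"
    then have c: "[s m j = s m j0] (mod p ^ m)" for m by blast
    have "pdvd_upto p (p ^ m) (chi j - chi j0)" for m
    proof -
      have "pdvd_upto p (p ^ m) ((chi j - (1 + fps_X) ^ s m j) + ((1 + fps_X) ^ s m j - (1 + fps_X) ^ s m j0) - (chi j0 - (1 + fps_X) ^ s m j0))"
        by (intro pdvd_upto_add pdvd_upto_diff chi power_cong_pdvd_upto[OF p c]) (use j j0 J(2) in auto)
      then show ?thesis by simp
    qed
    then have "pdvd p (chi j - chi j0)"
      unfolding pdvd_iff_pdvd_upto using pdvd_upto_mono[OF _ less_imp_le[OF power_gt_expt[of p]]] p1 by auto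
    then show False using J(4) j j0 by blast
  qed
  then obtain M where M: "\<And>j. j \<in> J \<Longrightarrow> j \<noteq> j0 \<Longrightarrow> \<not> [s (M j) j = s (M j) j0] (mod p ^ M j)" by metis
  \<comment> \<open>The sum serves only as a common upper bound of the \<open>M j\<close>: modulo
    \<open>p^m0\<close> the exponent of \<open>j0\<close> differs from that of every other
    \<open>j\<close>.\<close>
  define m0 where "m0 = (\<Sum>j\<in>J. M j)"
  have sep: "\<not> [s m j = s m j0] (mod p ^ m0)" if j: "j \<in> J" "j \<noteq> j0" and m: "m0 \<le> m" for j m
  proof
    assume a: "[s m j = s m j0] (mod p ^ m0)"
    have le: "M j \<le> m0" unfolding m0_def using J(1) j(1) by (rule member_le_sum[rotated 2]) auto
    have "[s m j = s m j0] (mod p ^ M j)" by (rule cong_dvd_modulus_nat[OF a]) (simp add: le_imp_power_dvd le)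
    moreover have "[s m j = s (M j) j] (mod p ^ M j)" "[s m j0 = s (M j) j0] (mod p ^ M j)"
      by (intro s; use j j0 J(2) le m in auto)+
    ultimately show False using M[OF j] by (metis cong_sym cong_trans)
  qed
  \<comment> \<open>Apart from the main term, only these terms can meet the point
    \<open>s j0 + p^i\<close> for \<open>i \<ge> m0\<close>: atoms with a small index, and the terms
    of \<open>r * b\<close>. Their number does not depend on \<open>m\<close>.\<close>
  define W where "W = (J \<times> {..<m0} \<times> {0, 1::nat}) <+> K"
  have finW: "finite W" unfolding W_def using J(1) K(1) by auto
  have "infinite (E \<inter> {m0..})"
  proof
    assume "finite (E \<inter> {m0..})"
    then have "finite ((E \<inter> {m0..}) \<union> {..<m0})" by simp
    moreover have "E \<subseteq> (E \<inter> {m0..}) \<union> {..<m0}" by auto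
    ultimately show False using E finite_subset by blast
  qed
  then obtain I where I: "I \<subseteq> E \<inter> {m0..}" "finite I" "card I = Suc (card W)"
    using infinite_arbitrarily_large by blast
  have Ine: "I \<noteq> {}" using I(3) by auto
  \<comment> \<open>The margin \<open>2\<close> gives \<open>p^i + p^i' < p^m\<close> for
    \<open>i\<close> in \<open>I\<close> and every \<open>i' < m\<close>, so \<open>p^i\<close> is
    never congruent to \<open>-p^i'\<close>.\<close>
  define m where "m = Max I + 2"
  have im: "i + 2 \<le> m" if "i \<in> I" for i using I(2) that by (simp add: m_def)
  have m0m: "m0 \<le> m" using im Ine I(1) by fastforce
  define tau where "tau t i = (if t = (0::nat) then p ^ i else if t = 1 then p ^ m - p ^ i else 0)" for t i
  define v where "v w = (case w of Inl (j, i, t) \<Rightarrow> s m j + tau t i | Inr k \<Rightarrow> s m k)" for w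
  define y where "y i = s m j0 + p ^ i" for i
  \<comment> \<open>All terms of the product of \<open>r\<close> with the truncated series and, with
    the opposite sign, all terms of \<open>r * b\<close>; together they vanish at level
    \<open>m\<close>.\<close>
  define L where "L = (J \<times> (E \<inter> {..<m}) \<times> {0, 1, 2::nat}) <+> K"
  define al where "al w = (case w of Inl (j, i, t) \<Rightarrow> c j * \<epsilon> i * (if t = (2::nat) then -2 else 1) | Inr k \<Rightarrow> - d k)" for w
  have finL: "finite L" unfolding L_def using J(1) K(1) by auto
  let ?w = "1 + fps_X :: int fps"
  have tot: "pdvd_upto p (p ^ m) (\<Sum>l\<in>L. of_int (al l) * ?w ^ v l)"
  proof -
    have e: "(\<Sum>l\<in>L. of_int (al l) * ?w ^ v l) = (\<Sum>j\<in>J. of_int (c j) * ?w ^ s m j) * atom_series p E \<epsilon> m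
       - (\<Sum>k\<in>K. of_int (d k) * ?w ^ s m k)"
      unfolding L_def atom_series_product[OF J(1)]
      by (subst sum.Plus) (use J(1) K(1) in \<open>auto simp: al_def v_def tau_def sum_negf split_def intro!: arg_cong2[where f="(+)"] sum.cong\<close>)
    have 1: "pdvd_upto p (p ^ m) ((\<Sum>j\<in>J. of_int (c j) * chi j) - (\<Sum>j\<in>J. of_int (c j) * ?w ^ s m j))"
      unfolding sum_subtractf[symmetric] right_diff_distrib[symmetric]
      by (intro pdvd_upto_sum pdvd_upto_mult_left chi) (use J(2) in auto)
    have 2: "pdvd_upto p (p ^ m) ((\<Sum>j\<in>K. of_int (d j) * chi j) - (\<Sum>j\<in>K. of_int (d j) * ?w ^ s m j))"
      unfolding sum_subtractf[symmetric] right_diff_distrib[symmetric]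
      by (intro pdvd_upto_sum pdvd_upto_mult_left chi) (use K(2) in auto)
    have 3: "pdvd_upto p (p ^ m) (r - (\<Sum>j\<in>J. of_int (c j) * chi j))" "pdvd_upto p (p ^ m) (r * b - (\<Sum>j\<in>K. of_int (d j) * chi j))"
      using J(5) K(3) by (simp_all add: pdvd_iff_pdvd_upto)
    define A A' C C' B where AA: "A = (\<Sum>j\<in>J. of_int (c j) * chi j)" "A' = (\<Sum>j\<in>J. of_int (c j) * ?w ^ s m j)"
      "C = (\<Sum>j\<in>K. of_int (d j) * chi j)" "C' = (\<Sum>j\<in>K. of_int (d j) * ?w ^ s m j)" "B = atom_series p E \<epsilon> m"
    have "A' * B - C' = - ((A - A') * B) - (r - A) * B - r * (b - B) + (r * b - C) + (C - C')"
      by (simp add: algebra_simps)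
    also have "pdvd_upto p (p ^ m) \<dots>" using 1 2 3 b[of m] unfolding AA[symmetric]
      by (simp only: pdvd_upto_add pdvd_upto_diff pdvd_upto_uminus pdvd_upto_mult_right pdvd_upto_mult_left)
    finally show ?thesis unfolding e AA .
  qed
  have hit: "\<exists>w\<in>W. [v w = y i] (mod p ^ m)" if i: "i \<in> I" for i
  proof (rule ccontr)
    assume nh: "\<not> ?thesis"
    have iE: "i \<in> E" "m0 \<le> i" "i < m" using I(1) i im[OF i] by auto
    \<comment> \<open>Without a hit from \<open>W\<close> the main term is alone at
      \<open>y i\<close>, so its weight \<open>c j0 * \<epsilon> i\<close> would have to be
      divisible by \<open>p\<close>.\<close>
    have "{l \<in> L. [v l = y i] (mod p ^ m)} = {Inl (j0, i, 0)}"
    proof (intro equalityI subsetI)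
      fix l :: "'g \<times> nat \<times> nat + 'g"
      assume "l \<in> {Inl (j0, i, 0)}"
      then show "l \<in> {l \<in> L. [v l = y i] (mod p ^ m)}"
        using iE j0 by (auto simp: L_def v_def y_def tau_def)
    next
      fix l assume "l \<in> {l \<in> L. [v l = y i] (mod p ^ m)}"
      then have l: "l \<in> L" "[v l = y i] (mod p ^ m)" by auto
      show "l \<in> {Inl (j0, i, 0)}"
      proof (cases l)
        case (Inr k)
        then have "l \<in> W" using l(1) by (auto simp: L_def W_def)
        then show ?thesis using nh l(2) by blast
      next
        case (Inl jit)
        obtain j i' t where jit: "jit = (j, i', t)" by (cases jit)
        have j: "j \<in> J" "i' \<in> E" "i' < m" "t \<in> {0, 1, 2}" using l(1) by (auto simp: L_def Inl jit)
        have cg: "[s m j + tau t i' = s m j0 + p ^ i] (mod p ^ m)" using l(2) by (simp add: Inl jit v_def y_def)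
        show ?thesis
        proof (cases "j = j0")
          case True
          then have cg': "[tau t i' = p ^ i] (mod p ^ m)" using cg by (simp add: cong_add_lcancel_nat)
          have lt: "p ^ i < p ^ m" using iE p1 by (simp add: power_strict_increasing)
          consider "t = 0" | "t = 1" | "t = 2" using j(4) by blast
          then show ?thesis
          proof cases
            case 1
            then have "i' = i" using cong_prime_power_less[OF p1 _ j(3) iE(3)] cg' by (simp add: tau_def)
            then show ?thesis using True 1 by (simp add: Inl jit)
          next
            case 2
            have "[p ^ m - p ^ i' + p ^ i' = p ^ i + p ^ i'] (mod p ^ m)"
              using cg' 2 by (intro cong_add) (simp_all add: tau_def)
            then have "[0 = p ^ i + p ^ i'] (mod p ^ m)"
              using j(3) p1 by (simp add: cong_def less_imp_le power_strict_increasing power_increasing)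
            moreover have "p ^ i + p ^ i' < p ^ m"
            proof -
              obtain m' where m': "m = Suc m'" using j(3) by (cases m) auto
              have "p ^ i < p ^ m'" using im[OF i] p1 m' by (intro power_strict_increasing) auto
              moreover have "p ^ i' \<le> p ^ m'" using j(3) p1 m' by (intro power_increasing) auto
              moreover have "2 * p ^ m' \<le> p ^ m" using p1 m' by simp
              ultimately show ?thesis by linarith
            qed
            ultimately have "p ^ i + p ^ i' = 0" by (simp add: cong_def)
            then show ?thesis using p1 by simp
          next
            case 3
            then have "p ^ i = 0" using cg' lt by (simp add: tau_def cong_def)
            then show ?thesis using p1 by simp
          qed
        next
          case False
          have cg0: "[s m j + tau t i' = s m j0 + p ^ i] (mod p ^ m0)"
            by (rule cong_dvd_modulus_nat[OF cg]) (simp add: le_imp_power_dvd m0m)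
          have z: "[p ^ i = 0] (mod p ^ m0)" using iE by (simp add: cong_0_iff le_imp_power_dvd)
          show ?thesis
          proof (cases "i' < m0 \<and> t \<noteq> 2")
            case True
            then have "l \<in> W" using j by (auto simp: W_def Inl jit)
            then show ?thesis using nh l(2) by blast
          next
            case F: False
            \<comment> \<open>The shifts outside \<open>W\<close> vanish modulo \<open>p^m0\<close>,
              as does \<open>p^i\<close>, so the exponents of \<open>j\<close> and \<open>j0\<close>
              would agree there.\<close>
            have "[tau t i' = 0] (mod p ^ m0)"
              using F j(4) m0m by (auto simp: tau_def cong_0_iff le_imp_power_dvd intro!: dvd_diff_nat)
            then have "[s m j + 0 = s m j0 + 0] (mod p ^ m0)"
              by (rule cong_trans[OF cong_sym[OF cong_add[OF cong_refl]] cong_trans[OF cg0 cong_add[OF cong_refl z]]])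
            then show ?thesis using sep[OF j(1) False m0m] by simp
          qed
        qed
      qed
    qed
    then have "int p dvd al (Inl (j0, i, 0))"
      using independent_mod[OF p finL tot, of "y i"] by simp
    then have "int p dvd c j0 * \<epsilon> i" by (simp add: al_def)
    then show False using J(3)[OF j0] eps[OF iE(1)] p by (simp add: prime_dvd_mult_iff)
  qed
  have inj: "inj_on (\<lambda>i. y i mod p ^ m) I"
  proof (rule inj_onI)
    fix i i' assume ii: "i \<in> I" "i' \<in> I" "y i mod p ^ m = y i' mod p ^ m"
    then have "[p ^ i = p ^ i'] (mod p ^ m)" unfolding y_def cong_def[symmetric] by (simp add: cong_add_lcancel_nat)
    then show "i = i'" using cong_prime_power_less[OF p1] im[OF ii(1)] im[OF ii(2)] by simp
  qed
  have sub: "(\<lambda>i. y i mod p ^ m) ` I \<subseteq> (\<lambda>w. v w mod p ^ m) ` W"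
  proof (rule image_subsetI)
    fix i assume "i \<in> I"
    then obtain w where "w \<in> W" "[v w = y i] (mod p ^ m)" using hit by blast
    then show "y i mod p ^ m \<in> (\<lambda>w. v w mod p ^ m) ` W" by (intro image_eqI[of _ _ w]) (simp_all add: cong_def)
  qed
  \<comment> \<open>Pigeonhole: the points \<open>y i\<close> are distinct and each is hit by an
    element of \<open>W\<close>, but \<open>I\<close> has one element more than
    \<open>W\<close>.\<close>
  have "card I \<le> card ((\<lambda>w. v w mod p ^ m) ` W)"
    using card_mono[OF finite_imageI[OF finW] sub] unfolding card_image[OF inj] .
  also have "\<dots> \<le> card W" by (rule card_image_le[OF finW])
  finally have "card I \<le> card W" .
  then show False using I(3) by simp
qed

section \<open>Commutators in finite p-groups\<close>

definition gcomm :: "('a, 'b) monoid_scheme \<Rightarrow> 'a \<Rightarrow> 'a \<Rightarrow> 'a" where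
  "gcomm G x y = x \<otimes>\<^bsub>G\<^esub> y \<otimes>\<^bsub>G\<^esub> inv\<^bsub>G\<^esub> x \<otimes>\<^bsub>G\<^esub> inv\<^bsub>G\<^esub> y"

text \<open>There is exactly one commutator per list entry, in the order of the list. The fixed
  length is what makes the set compact for compact \<open>N\<close>.\<close>

fun commprods :: "('a, 'b) monoid_scheme \<Rightarrow> 'a set \<Rightarrow> 'a list \<Rightarrow> 'a set" where
  "commprods G N [] = {\<one>\<^bsub>G\<^esub>}"
| "commprods G N (x # xs) = {gcomm G n x \<otimes>\<^bsub>G\<^esub> y | n y. n \<in> N \<and> y \<in> commprods G N xs}"

definition commsub :: "('a, 'b) monoid_scheme \<Rightarrow> 'a set \<Rightarrow> 'a set" where
  "commsub G N = generate G {gcomm G n g | n g. n \<in> N \<and> g \<in> carrier G}"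

context group begin

lemma cancel_left [simp]:
  "x \<in> carrier G \<Longrightarrow> y \<in> carrier G \<Longrightarrow> x \<otimes> (inv x \<otimes> y) = y"
  "x \<in> carrier G \<Longrightarrow> y \<in> carrier G \<Longrightarrow> inv x \<otimes> (x \<otimes> y) = y"
  by (simp_all flip: m_assoc)

lemma gcomm_closed [simp]:
  "x \<in> carrier G \<Longrightarrow> y \<in> carrier G \<Longrightarrow> gcomm G x y \<in> carrier G"
  by (simp add: gcomm_def)

lemma gcomm_eq_one_iff:
  assumes "x \<in> carrier G" "y \<in> carrier G"
  shows "gcomm G x y = \<one> \<longleftrightarrow> x \<otimes> y = y \<otimes> x"
proof
  assume "gcomm G x y = \<one>"
  then have "gcomm G x y \<otimes> (y \<otimes> x) = y \<otimes> x" using assms by simp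
  then show "x \<otimes> y = y \<otimes> x" using assms by (simp add: gcomm_def m_assoc)
next
  assume "x \<otimes> y = y \<otimes> x"
  then show "gcomm G x y = \<one>" using assms by (simp add: gcomm_def m_assoc)
qed

lemma gcomm_mult_right:
  assumes "m \<in> carrier G" "g \<in> carrier G" "h \<in> carrier G"
  shows "gcomm G m (g \<otimes> h) = gcomm G m g \<otimes> (g \<otimes> gcomm G m h \<otimes> inv g)"
  using assms by (simp add: gcomm_def m_assoc inv_mult_group)

lemma gcomm_mult_left:
  assumes "m \<in> carrier G" "n \<in> carrier G" "x \<in> carrier G"
  shows "gcomm G (m \<otimes> n) x = m \<otimes> gcomm G n x \<otimes> inv m \<otimes> gcomm G m x"
  using assms by (simp add: gcomm_def m_assoc inv_mult_group)

lemma gcomm_conj: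
  assumes "g \<in> carrier G" "m \<in> carrier G" "x \<in> carrier G"
  shows "g \<otimes> gcomm G m x \<otimes> inv g = gcomm G (g \<otimes> m \<otimes> inv g) (g \<otimes> x \<otimes> inv g)"
  using assms by (simp add: gcomm_def m_assoc inv_mult_group)

lemma commprods_subset:
  assumes "N \<subseteq> carrier G" "set xs \<subseteq> carrier G"
  shows "commprods G N xs \<subseteq> carrier G"
  using assms by (induction xs) (auto intro!: m_closed gcomm_closed)

lemma one_in_commprods:
  assumes "\<one> \<in> N" "set xs \<subseteq> carrier G"
  shows "\<one> \<in> commprods G N xs"
  using assms(2)
proof (induction xs)
  case (Cons x xs)
  have "gcomm G \<one> x \<otimes> \<one> = \<one>" using Cons.prems by (simp add: gcomm_def)
  then show ?case using assms(1) Cons by force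
qed simp

lemma commprods_in_normal:
  assumes N: "N \<lhd> G" and xs: "set xs \<subseteq> carrier G"
  shows "commprods G N xs \<subseteq> N"
  using xs
proof (induction xs)
  case Nil then show ?case using normal_imp_subgroup[OF N] by (simp add: subgroup.one_closed)
next
  case (Cons x xs)
  interpret N: normal N G by (rule N)
  have "gcomm G n x \<in> N" if "n \<in> N" for n
  proof -
    have "gcomm G n x = n \<otimes> (x \<otimes> inv n \<otimes> inv x)" using that Cons.prems by (simp add: gcomm_def m_assoc)
    then show ?thesis using that Cons.prems by (simp add: N.inv_op_closed2)
  qed
  then show ?case using Cons by auto
qed

text \<open>For \<open>m\<close> in \<open>W\<close> the map \<open>g \<mapsto> [m, g]\<close> is a
  homomorphism with central values, so by \<open>gen\<close> the group \<open>[W, G]\<close> is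
  generated by the \<open>[m, x]\<close> with \<open>x\<close> in \<open>xs\<close>. Each of these
  is absorbed into the factor at \<open>x\<close>, since
  \<open>[n, x] [m, x] = [m n, x]\<close>.\<close>

lemma commprods_extend_central:
  assumes N: "subgroup N G" and W: "W \<subseteq> N" "\<And>m. m \<in> W \<Longrightarrow> inv m \<in> W"
    and central: "\<And>m g h. m \<in> W \<Longrightarrow> g \<in> carrier G \<Longrightarrow> h \<in> carrier G \<Longrightarrow> gcomm G m g \<otimes> h = h \<otimes> gcomm G m g"
    and xs: "set xs \<subseteq> carrier G"
    and gen: "\<And>f H. f \<in> hom G G \<Longrightarrow> H \<lhd> G \<Longrightarrow> (\<And>x. x \<in> set xs \<Longrightarrow> f x \<in> H) \<Longrightarrow> f ` carrier G \<subseteq> H"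
    and c: "c \<in> commprods G N xs" and e: "e \<in> commsub G W"
  shows "c \<otimes> e \<in> commprods G N xs"
proof -
  interpret N: subgroup N G by (rule N)
  have WG: "m \<in> carrier G" if "m \<in> W" for m using W(1) that by auto
  have hom: "gcomm G m (g \<otimes> h) = gcomm G m g \<otimes> gcomm G m h" if "m \<in> W" "g \<in> carrier G" "h \<in> carrier G" for m g h
    unfolding gcomm_mult_right[OF WG[OF that(1)] that(2,3)]
    using central[OF that(1,3,2)] that WG by (simp add: m_assoc flip: central[OF that(1,3,2)])
  have cinv: "inv (gcomm G m g) = gcomm G m (inv g)" if "m \<in> W" "g \<in> carrier G" for m g
    using hom[OF that(1) inv_closed[OF that(2)] that(2)] that WG
    by (intro inv_equality) (simp_all add: gcomm_def[of G m \<one>])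
  \<comment> \<open>\<open>[m, [n, x]] = [[m, n], [m, x]]\<close> because \<open>[m, -]\<close> is a
    homomorphism, and the right side is trivial because its entries are central.\<close>
  have triv: "m \<otimes> gcomm G n x \<otimes> inv m = gcomm G n x" if "m \<in> W" "n \<in> carrier G" "x \<in> carrier G" for m n x
  proof -
    let ?a = "gcomm G m n" and ?b = "gcomm G m x"
    have G: "?a \<in> carrier G" "?b \<in> carrier G" using that WG by auto
    have "gcomm G m (gcomm G n x) = ?a \<otimes> ?b \<otimes> inv ?a \<otimes> inv ?b"
      using that by (simp add: gcomm_def[of G n x] hom cinv)
    also have "\<dots> = \<one>" using G central[OF that(1,2) G(2)] by (simp add: m_assoc)
    finally have "m \<otimes> gcomm G n x = gcomm G n x \<otimes> m" using that WG by (simp add: gcomm_eq_one_iff)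
    then show ?thesis using that WG by (simp add: m_assoc)
  qed
  have step: "c \<otimes> gcomm G m x \<in> commprods G N ys"
    if "set ys \<subseteq> carrier G" "c \<in> commprods G N ys" "m \<in> W" "x \<in> set ys" for c m x ys
    using that
  proof (induction ys arbitrary: c)
    case (Cons y ys)
    then obtain n d where c: "c = gcomm G n y \<otimes> d" "n \<in> N" "d \<in> commprods G N ys" by auto
    have dG: "d \<in> carrier G" using commprods_subset[of N ys] c(3) Cons.prems N.subset by auto
    have xG: "x \<in> carrier G" "y \<in> carrier G" using Cons.prems by auto
    have nG: "n \<in> carrier G" using c(2) by simp
    have mG: "m \<in> carrier G" using WG Cons.prems by simp
    show ?case
    proof (cases "x = y")
      case True
      have "c \<otimes> gcomm G m x = gcomm G n y \<otimes> gcomm G m y \<otimes> d"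
        using central[OF \<open>m \<in> W\<close> xG(2) dG] dG nG mG xG by (simp add: c(1) True m_assoc)
      also have "gcomm G n y \<otimes> gcomm G m y = gcomm G (m \<otimes> n) y"
        unfolding gcomm_mult_left[OF mG nG xG(2)] triv[OF \<open>m \<in> W\<close> nG xG(2)] ..
      finally show ?thesis using c(2,3) W(1) Cons.prems(3) by auto
    next
      case False
      then have "d \<otimes> gcomm G m x \<in> commprods G N ys" using Cons.IH[OF _ c(3)] Cons.prems by auto
      moreover have "c \<otimes> gcomm G m x = gcomm G n y \<otimes> (d \<otimes> gcomm G m x)"
        using dG nG mG xG by (simp add: c(1) m_assoc)
      ultimately show ?thesis using c(2) by auto
    qed
  qed simp
  define K where "K = {gcomm G m x | m x. m \<in> W \<and> x \<in> set xs}"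
  define H where "H = generate G K"
  have KG: "K \<subseteq> carrier G" unfolding K_def using WG xs by auto
  have Hcen: "k \<otimes> h = h \<otimes> k" if "k \<in> H" "h \<in> carrier G" for k h
    using that(1) unfolding H_def
  proof induction
    case one then show ?case using that by simp
  next
    case (incl k) then show ?case using central xs that unfolding K_def by auto
  next
    case (inv k)
    then obtain m x where k: "k = gcomm G m x" "m \<in> W" "x \<in> set xs" unfolding K_def by blast
    then show ?case using central[OF k(2) inv_closed that(2)] xs cinv by auto
  next
    case (eng k1 k2)
    then have "k1 \<in> carrier G" "k2 \<in> carrier G" using generate_in_carrier[OF KG] by auto
    then show ?case using eng that by (metis m_assoc)
  qed
  have Hsub: "subgroup H G" unfolding H_def by (rule generate_is_subgroup[OF KG])
  have Hnorm: "H \<lhd> G"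
  proof (rule normal_invI[OF Hsub])
    fix x h assume "x \<in> carrier G" "h \<in> H"
    then show "x \<otimes> h \<otimes> inv x \<in> H"
      using Hcen[of h x] subgroup.mem_carrier[OF Hsub] by (simp add: m_assoc flip: Hcen)
  qed
  have sub: "gcomm G m g \<in> H" if "m \<in> W" "g \<in> carrier G" for m g
  proof -
    \<comment> \<open>This homomorphism maps \<open>xs\<close> into \<open>H\<close>, so
      \<open>gen\<close> puts its whole image there.\<close>
    have "(\<lambda>g. gcomm G m g) \<in> hom G G" using that(1) WG by (intro homI) (auto simp: hom)
    from gen[OF this Hnorm] that show ?thesis
      unfolding H_def K_def by (auto intro: generate.incl)
  qed
  have "e \<in> H"
    using e generate_subgroup_incl[OF _ Hsub, of "{gcomm G n g | n g. n \<in> W \<and> g \<in> carrier G}"] sub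
    unfolding commsub_def by blast
  then show ?thesis using c unfolding H_def
  proof (induction arbitrary: c)
    case one
    then show ?case using commprods_subset[OF N.subset xs] by auto
  next
    case (incl k) then show ?case using step[OF xs] unfolding K_def by auto
  next
    case (inv k)
    then obtain m x where k: "k = gcomm G m x" "m \<in> W" "x \<in> set xs" unfolding K_def by blast
    have xG: "x \<in> carrier G" using k xs by auto
    \<comment> \<open>It follows that the inverse of \<open>[m, x]\<close> is
      \<open>[m^-1, x]\<close>, which is again of the form handled by \<open>step\<close>.\<close>
    have "gcomm G (inv m \<otimes> m) x = \<one>" using WG[OF k(2)] xG by (simp add: gcomm_def)
    then have "gcomm G m x \<otimes> gcomm G (inv m) x = \<one>"
      using gcomm_mult_left[of "inv m" m x] triv[OF W(2)[OF k(2)] WG[OF k(2)] xG] WG[OF k(2)] xG by simp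
    then have "inv k = gcomm G (inv m) x" using k(1) WG[OF k(2)] xG
      by (metis central gcomm_closed inv_closed inv_equality k(2))
    then show ?case using step[OF xs inv.prems W(2)[OF k(2)] k(3)] by simp
  next
    case (eng k1 k2)
    have "k1 \<in> carrier G" "k2 \<in> carrier G" using eng generate_in_carrier[OF KG] by auto
    moreover have "c \<in> carrier G" using eng.prems commprods_subset[OF N.subset xs] by auto
    ultimately show ?case using eng by (metis m_assoc)
  qed
qed

end


section \<open>Central elements in quotients that are p-groups\<close>

lemma gcomm_hom:
  assumes "group G" "group H" "f \<in> hom G H" "x \<in> carrier G" "y \<in> carrier G"
  shows "f (gcomm G x y) = gcomm H (f x) (f y)"
proof -
  interpret group_hom G H f by (intro group_hom.intro group_hom_axioms.intro assms)
  show ?thesis using assms by (simp add: gcomm_def)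
qed

lemma commprods_image:
  assumes "group G" "group H" "f \<in> hom G H" "N \<subseteq> carrier G" "set xs \<subseteq> carrier G"
  shows "commprods H (f ` N) (map f xs) = f ` commprods G N xs"
  using assms(5)
proof (induction xs)
  interpret group_hom G H f by (intro group_hom.intro group_hom_axioms.intro assms)
  case Nil then show ?case by simp
next
  interpret group_hom G H f by (intro group_hom.intro group_hom_axioms.intro assms)
  case (Cons x xs)
  have "f (gcomm G n x \<otimes>\<^bsub>G\<^esub> y) = gcomm H (f n) (f x) \<otimes>\<^bsub>H\<^esub> f y" if "n \<in> N" "y \<in> commprods G N xs" for n y
  proof -
    have "y \<in> carrier G" using G.commprods_subset[OF assms(4)] Cons.prems that by auto
    then show ?thesis using that assms(4) Cons.prems by (subst gcomm_hom[OF assms(1-3), symmetric]) auto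
  qed
  then show ?case using Cons by (force simp: image_iff)
qed

text \<open>Conjugation orbits in \<open>N - {1}\<close> have p-power size. Without a central
  element none is a singleton, so \<open>p\<close> divides \<open>|N| - 1\<close>; but
  \<open>p\<close> also divides \<open>|N|\<close>.\<close>

lemma p_group_normal_center:
  assumes p: "Factorial_Ring.prime p" and Q: "p_group p Q" and N: "normal N Q" and ne: "N \<noteq> {\<one>\<^bsub>Q\<^esub>}"
  shows "\<exists>n\<in>N. n \<noteq> \<one>\<^bsub>Q\<^esub> \<and> (\<forall>g\<in>carrier Q. n \<otimes>\<^bsub>Q\<^esub> g = g \<otimes>\<^bsub>Q\<^esub> n)"
proof (rule ccontr)
  assume nex: "\<not> ?thesis"
  interpret group Q using Q by (simp add: p_group_def)
  interpret N: normal N Q by (rule N)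
  obtain k where k: "card (carrier Q) = p ^ k" and fin: "finite (carrier Q)" using Q by (auto simp: p_group_def)
  define \<phi> where "\<phi> = (\<lambda>g. \<lambda>h\<in>carrier Q. g \<otimes>\<^bsub>Q\<^esub> h \<otimes>\<^bsub>Q\<^esub> inv\<^bsub>Q\<^esub> g)"
  interpret act: group_action Q "carrier Q" \<phi> unfolding \<phi>_def by (rule action_by_conjugation)
  have finN: "finite N" using fin N.subset finite_subset by blast
  let ?C = "orbit Q \<phi> ` (N - {\<one>\<^bsub>Q\<^esub>})"
  have orb_sub: "orbit Q \<phi> x \<subseteq> N - {\<one>\<^bsub>Q\<^esub>}" if x: "x \<in> N - {\<one>\<^bsub>Q\<^esub>}" for x
  proof
    fix y assume "y \<in> orbit Q \<phi> x"
    then obtain g where g: "g \<in> carrier Q" "y = g \<otimes>\<^bsub>Q\<^esub> x \<otimes>\<^bsub>Q\<^esub> inv\<^bsub>Q\<^esub> g"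
      using x by (auto simp: orbit_def \<phi>_def)
    have xG: "x \<in> carrier Q" using x by auto
    have "y \<noteq> \<one>\<^bsub>Q\<^esub>"
    proof
      assume "y = \<one>\<^bsub>Q\<^esub>"
      then have "inv\<^bsub>Q\<^esub> g \<otimes>\<^bsub>Q\<^esub> (g \<otimes>\<^bsub>Q\<^esub> x \<otimes>\<^bsub>Q\<^esub> inv\<^bsub>Q\<^esub> g) \<otimes>\<^bsub>Q\<^esub> g = \<one>\<^bsub>Q\<^esub>" using g by simp
      then show False using g(1) xG x by (simp add: m_assoc)
    qed
    then show "y \<in> N - {\<one>\<^bsub>Q\<^esub>}" using g x N.inv_op_closed2 by auto
  qed
  have self: "x \<in> orbit Q \<phi> x" if "x \<in> carrier Q" for x by (rule act.orbit_refl[OF that])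
  have dv: "p dvd card (orbit Q \<phi> x)" if x: "x \<in> N - {\<one>\<^bsub>Q\<^esub>}" for x
  proof -
    have xG: "x \<in> carrier Q" using x by auto
    have "card (orbit Q \<phi> x) dvd p ^ k"
      using act.orbit_stabilizer_theorem[OF xG] k by (metis dvd_triv_left order_def)
    then obtain j where j: "card (orbit Q \<phi> x) = p ^ j" using p by (auto simp: divides_primepow_nat)
    show ?thesis
    proof (cases j)
      case 0
      then have "orbit Q \<phi> x = {x}" using j self[OF xG] by (metis card_1_singletonE power_0 singletonD)
      then have "g \<otimes>\<^bsub>Q\<^esub> x \<otimes>\<^bsub>Q\<^esub> inv\<^bsub>Q\<^esub> g = x" if "g \<in> carrier Q" for g
        using that xG by (auto simp: orbit_def \<phi>_def)
      then have "x \<otimes>\<^bsub>Q\<^esub> g = g \<otimes>\<^bsub>Q\<^esub> x" if "g \<in> carrier Q" for g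
        using that xG by (metis inv_solve_right m_closed)
      then show ?thesis using nex x by blast
    qed (use j in simp)
  qed
  have "\<Union>?C = N - {\<one>\<^bsub>Q\<^esub>}" using orb_sub self N.subset by auto
  moreover have "card (\<Union>?C) = sum card ?C"
  proof (rule card_Union_disjoint)
    show "pairwise disjnt ?C"
    proof (rule pairwiseI)
      fix A B assume "A \<in> ?C" "B \<in> ?C" "A \<noteq> B"
      moreover have "A \<in> orbits Q (carrier Q) \<phi>" "B \<in> orbits Q (carrier Q) \<phi>"
        using calculation N.subset by (auto simp: orbits_def)
      ultimately show "disjnt A B" using act.disjoint_union unfolding disjnt_def by blast
    qed
    show "finite A" if "A \<in> ?C" for A
      using that finite_subset[OF orb_sub] finN by blast
  qed
  ultimately have "card (N - {\<one>\<^bsub>Q\<^esub>}) = sum card ?C" by simp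
  moreover have "p dvd sum card ?C" using dv by (intro dvd_sum) auto
  ultimately have d1: "p dvd card (N - {\<one>\<^bsub>Q\<^esub>})" by simp
  have "card N dvd p ^ k" using lagrange[OF N.subgroup_axioms] k by (metis dvd_triv_right order_def)
  then obtain j where j: "card N = p ^ j" using p by (auto simp: divides_primepow_nat)
  have cN: "card N = Suc (card (N - {\<one>\<^bsub>Q\<^esub>}))" using finN N.one_closed by (metis card.remove)
  have "j \<noteq> 0"
  proof
    assume "j = 0"
    then have "card N = 1" using j by simp
    then obtain a where "N = {a}" by (rule card_1_singletonE)
    then show False using ne N.one_closed by auto
  qed
  then have "p dvd card N" using j by simp
  then have "p dvd 1" using d1 cN by (metis Suc_eq_plus1 dvd_add_right_iff)
  then show False using p by (simp add: prime_nat_iff)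
qed

lemma FactGroup_rcoset_hom:
  assumes "normal V G" shows "(\<lambda>g. V #>\<^bsub>G\<^esub> g) \<in> hom G (G Mod V)" "group (G Mod V)" "group G"
  using normal.r_coset_hom_Mod[OF assms] normal.factorgroup_is_group[OF assms] assms
  by (simp_all add: normal_def)

lemma rcoset_eq_self_iff:
  assumes "normal V G" "g \<in> carrier G" shows "V #>\<^bsub>G\<^esub> g = V \<longleftrightarrow> g \<in> V"
proof -
  interpret normal V G by (rule assms)
  show ?thesis using assms(2) coset_join1[of V g] coset_join2[of g V] subgroup_axioms subset by auto
qed

text \<open>The image of \<open>N\<close> in \<open>G/V\<close> is a nontrivial normal subgroup of a
  p-group, so it contains a nontrivial central element; \<open>n\<close> is a lift of it.\<close>

lemma p_group_center_mod:
  assumes p: "Factorial_Ring.prime p" and V: "normal V G" "p_group p (G Mod V)"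
    and N: "normal N G" "\<not> N \<subseteq> V"
  shows "\<exists>n\<in>N - V. \<forall>g\<in>carrier G. gcomm G n g \<in> V"
proof -
  interpret V: normal V G by (rule V)
  interpret N: normal N G by (rule N)
  let ?f = "\<lambda>g. V #>\<^bsub>G\<^esub> g"
  interpret f: group_hom G "G Mod V" ?f
    using FactGroup_rcoset_hom[OF V(1)] by (intro group_hom.intro group_hom_axioms.intro)
  have surj: "?f ` carrier G = carrier (G Mod V)" by (simp add: carrier_FactGroup)
  have "normal (?f ` N) (G Mod V)"
  proof (rule f.H.normal_invI)
    show "subgroup (?f ` N) (G Mod V)" by (rule f.subgroup_img_is_subgroup[OF N.subgroup_axioms])
    fix x h assume "x \<in> carrier (G Mod V)" "h \<in> ?f ` N"
    then obtain g n where gn: "g \<in> carrier G" "x = ?f g" "n \<in> N" "h = ?f n" unfolding surj[symmetric] by blast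
    have e: "x \<otimes>\<^bsub>G Mod V\<^esub> h \<otimes>\<^bsub>G Mod V\<^esub> inv\<^bsub>G Mod V\<^esub> x = ?f (g \<otimes>\<^bsub>G\<^esub> n \<otimes>\<^bsub>G\<^esub> inv\<^bsub>G\<^esub> g)"
      unfolding gn using gn(1,3) by (simp del: mult_FactGroup)
    show "x \<otimes>\<^bsub>G Mod V\<^esub> h \<otimes>\<^bsub>G Mod V\<^esub> inv\<^bsub>G Mod V\<^esub> x \<in> ?f ` N"
      unfolding e by (rule imageI[OF N.inv_op_closed2[OF gn(1,3)]])
  qed
  moreover have "?f ` N \<noteq> {\<one>\<^bsub>G Mod V\<^esub>}"
  proof
    assume a: "?f ` N = {\<one>\<^bsub>G Mod V\<^esub>}"
    have "n \<in> V" if "n \<in> N" for n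
      using that a rcoset_eq_self_iff[OF V(1), of n] by auto
    then show False using N(2) by blast
  qed
  ultimately have "\<exists>n\<in>?f ` N. n \<noteq> \<one>\<^bsub>G Mod V\<^esub> \<and>
      (\<forall>g\<in>carrier (G Mod V). n \<otimes>\<^bsub>G Mod V\<^esub> g = g \<otimes>\<^bsub>G Mod V\<^esub> n)"
    by (rule p_group_normal_center[OF p V(2)])
  then obtain m where m0: "m \<in> ?f ` N" "m \<noteq> \<one>\<^bsub>G Mod V\<^esub>"
    "\<forall>g\<in>carrier (G Mod V). m \<otimes>\<^bsub>G Mod V\<^esub> g = g \<otimes>\<^bsub>G Mod V\<^esub> m" by (elim bexE conjE)
  note m = m0(1,2) m0(3)[rule_format]
  obtain n where n: "n \<in> N" "m = ?f n" using m(1) by (rule imageE)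
  have "gcomm G n g \<in> V" if g: "g \<in> carrier G" for g
  proof -
    have "gcomm (G Mod V) m (?f g) = \<one>\<^bsub>G Mod V\<^esub>"
      using m(3)[of "?f g"] n g by (subst f.H.gcomm_eq_one_iff) (auto simp del: mult_FactGroup one_FactGroup)
    then have "?f (gcomm G n g) = V"
      using gcomm_hom[OF FactGroup_rcoset_hom(3,2,1)[OF V(1)], of n g] n g by simp
    then show ?thesis using rcoset_eq_self_iff[OF V(1)] n g by simp
  qed
  moreover have "n \<notin> V" using m(2) n rcoset_eq_self_iff[OF V(1), of n] by simp
  ultimately show ?thesis using n(1) by blast
qed

lemma p_group_Mod:
  assumes p: "Factorial_Ring.prime p" and Q: "p_group p Q" and H: "normal H Q"
  shows "p_group p (Q Mod H)"
proof -
  interpret H: normal H Q by (rule H)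
  obtain k where k: "card (carrier Q) = p ^ k" "finite (carrier Q)" using Q by (auto simp: p_group_def)
  have "card (rcosets\<^bsub>Q\<^esub> H) dvd p ^ k"
    using H.lagrange[OF H.subgroup_axioms] k by (metis dvd_triv_left order_def)
  then obtain j where "card (rcosets\<^bsub>Q\<^esub> H) = p ^ j" using p by (auto simp: divides_primepow_nat)
  moreover have "finite (rcosets\<^bsub>Q\<^esub> H)" using k(2) by (simp add: RCOSETS_def)
  ultimately show ?thesis
    unfolding p_group_def using H.factorgroup_is_group by (auto simp: FactGroup_def)
qed

section \<open>Relative commutator subgroups and finite width modulo an open subgroup\<close>

lemma (in group) commsub_normal:
  assumes N: "N \<lhd> G" shows "commsub G N \<lhd> G"
  unfolding commsub_def
proof (rule normal_generateI)
  interpret N: normal N G by (rule N)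
  show "{gcomm G n g |n g. n \<in> N \<and> g \<in> carrier G} \<subseteq> carrier G" by auto
  fix h g assume "h \<in> {gcomm G n g |n g. n \<in> N \<and> g \<in> carrier G}" and g: "g \<in> carrier G"
  then obtain n x where nx: "h = gcomm G n x" "n \<in> N" "x \<in> carrier G" by blast
  then have "g \<otimes> h \<otimes> inv g = gcomm G (g \<otimes> n \<otimes> inv g) (g \<otimes> x \<otimes> inv g)"
    using g by (simp add: gcomm_conj)
  then show "g \<otimes> h \<otimes> inv g \<in> {gcomm G n g |n g. n \<in> N \<and> g \<in> carrier G}"
    using nx g N.inv_op_closed2 by blast
qed

text \<open>This is the preimage in \<open>G\<close> of the centre of \<open>G/U\<close>; applied
  twice it gives the second centre modulo \<open>U\<close>.\<close>

lemma (in group) normal_centralizer_mod: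
  assumes U: "U \<lhd> G" shows "{g \<in> carrier G. \<forall>h\<in>carrier G. gcomm G g h \<in> U} \<lhd> G" (is "?Z \<lhd> G")
proof (rule normal_invI)
  interpret U: normal U G by (rule U)
  have conj: "x \<otimes> u \<otimes> inv x \<in> U" if "u \<in> U" "x \<in> carrier G" for u x
    using that by (rule U.inv_op_closed2[rotated])
  show "subgroup ?Z G"
  proof
    show "\<one> \<in> ?Z" by (auto simp: gcomm_def)
    fix x y assume x: "x \<in> ?Z" and y: "y \<in> ?Z"
    then show "x \<otimes> y \<in> ?Z" using conj by (auto simp: gcomm_mult_left)
  next
    fix x assume x: "x \<in> ?Z"
    have "gcomm G (inv x) h = inv x \<otimes> inv (gcomm G x h) \<otimes> inv (inv x)" if "h \<in> carrier G" for h
      using x that by (simp add: gcomm_def m_assoc inv_mult_group)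
    then show "inv x \<in> ?Z" using x conj[of "inv (gcomm G x _)" "inv x"] by auto
  qed auto
  fix x h assume x: "x \<in> carrier G" and h: "h \<in> ?Z"
  have "gcomm G (x \<otimes> h \<otimes> inv x) g \<in> U" if g: "g \<in> carrier G" for g
  proof -
    have "gcomm G (x \<otimes> h \<otimes> inv x) g = x \<otimes> gcomm G h (inv x \<otimes> g \<otimes> x) \<otimes> inv x"
      using x h g by (simp add: gcomm_def m_assoc inv_mult_group)
    then show ?thesis using conj x h g by auto
  qed
  then show "x \<otimes> h \<otimes> inv x \<in> ?Z" using x h by auto
qed

text \<open>If \<open>N\<close> is not central modulo \<open>U\<close>, then some \<open>W \<le> N\<close> in the second centre modulo \<open>U\<close> is not central. The induction
  hypothesis for \<open>U [W, G]\<close> leaves an error in \<open>[W, G]\<close>, which can be absorbed because \<open>[W, G]\<close> is central modulo \<open>U\<close>.\<close>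

lemma (in group) finite_width_mod:
  assumes p: "Factorial_Ring.prime p"
    and OU: "\<And>U. OU U \<Longrightarrow> U \<lhd> G" "\<And>U. OU U \<Longrightarrow> p_group p (G Mod U)"
      "\<And>U U'. OU U \<Longrightarrow> U' \<lhd> G \<Longrightarrow> U \<subseteq> U' \<Longrightarrow> OU U'"
    and gen: "\<And>(P :: 'a set set monoid) f U. p_group p P \<Longrightarrow> f \<in> hom G P \<Longrightarrow> OU U \<Longrightarrow> (\<And>g. g \<in> U \<Longrightarrow> f g = \<one>\<^bsub>P\<^esub>)
        \<Longrightarrow> (\<And>x. x \<in> set xs \<Longrightarrow> f x = \<one>\<^bsub>P\<^esub>) \<Longrightarrow> f ` carrier G \<subseteq> {\<one>\<^bsub>P\<^esub>}"
    and xs: "set xs \<subseteq> carrier G" and N: "N \<lhd> G"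
    and U: "OU U" and y: "y \<in> commsub G N"
  shows "\<exists>c\<in>commprods G N xs. U #> y = U #> c"
  using U
proof (induction "card (rcosets U)" arbitrary: U rule: less_induct)
  case less
  interpret N: normal N G by (rule N)
  interpret U: normal U G by (rule OU(1)[OF less.prems])
  let ?C = "{gcomm G n g | n g. n \<in> N \<and> g \<in> carrier G}"
  have yG: "y \<in> carrier G"
    by (rule subgroup.mem_carrier[OF normal_imp_subgroup[OF commsub_normal[OF N]] y])
  define Z where "Z = {g \<in> carrier G. \<forall>h\<in>carrier G. gcomm G g h \<in> U}"
  have Zn: "Z \<lhd> G" unfolding Z_def by (rule normal_centralizer_mod[OF U.normal_axioms])
  interpret Z: normal Z G by (rule Zn)
  have comU: "gcomm G u h \<in> U" if "u \<in> U" "h \<in> carrier G" for u h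
  proof -
    have "gcomm G u h = u \<otimes> (h \<otimes> inv u \<otimes> inv h)" using that by (simp add: gcomm_def m_assoc)
    then show ?thesis using that U.inv_op_closed2 by auto
  qed
  have UZ: "U \<subseteq> Z" using comU U.subset unfolding Z_def by auto
  have OZ: "OU Z" by (rule OU(3)[OF less.prems Zn UZ])
  show ?case
  proof (cases "N \<subseteq> Z")
    case True
    \<comment> \<open>If \<open>N\<close> is central modulo \<open>U\<close>, then
      \<open>[N, G]\<close> lies in \<open>U\<close>, and the trivial product represents
      \<open>y\<close>.\<close>
    have "y \<in> U"
      using y generate_subgroup_incl[OF _ U.subgroup_axioms, of ?C] True
      unfolding commsub_def Z_def by blast
    then have "U #> y = U #> \<one>" 
      using rcoset_eq_self_iff[OF U.normal_axioms yG] coset_mult_one[OF U.subset] by simp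
    then show ?thesis using one_in_commprods[OF N.one_closed xs] by blast
  next
    case False
    obtain n0 where n0: "n0 \<in> N" "n0 \<notin> Z" "\<And>g. g \<in> carrier G \<Longrightarrow> gcomm G n0 g \<in> Z"
      using p_group_center_mod[OF p Zn OU(2)[OF OZ] N False] by blast
    \<comment> \<open>The part of \<open>N\<close> in the second centre modulo \<open>U\<close>;
      \<open>n0\<close> belongs to it but not to \<open>Z\<close>.\<close>
    define W where "W = N \<inter> {g \<in> carrier G. \<forall>h\<in>carrier G. gcomm G g h \<in> Z}"
    have Wn: "W \<lhd> G" unfolding W_def by (rule normal_subgroup_intersect[OF N normal_centralizer_mod[OF Zn]])
    interpret W: normal W G by (rule Wn)
    let ?E = "{gcomm G w h | w h. w \<in> W \<and> h \<in> carrier G}"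
    \<comment> \<open>This is \<open>U [W, G]\<close>. It is strictly larger than \<open>U\<close>
      because some \<open>[n0, h0]\<close> is not in \<open>U\<close>, so its index is
      smaller.\<close>
    define U' where "U' = generate G (U \<union> ?E)"
    have EG: "U \<union> ?E \<subseteq> carrier G" using U.subset by auto
    have U'n: "U' \<lhd> G" unfolding U'_def
    proof (rule normal_generateI[OF EG])
      fix h g assume h: "h \<in> U \<union> ?E" and g: "g \<in> carrier G"
      show "g \<otimes> h \<otimes> inv g \<in> U \<union> ?E"
      proof (cases "h \<in> U")
        case True then show ?thesis using g U.inv_op_closed2 by auto
      next
        case False
        then obtain n x where nx: "h = gcomm G n x" "n \<in> W" "x \<in> carrier G" using h by blast
        then have "g \<otimes> h \<otimes> inv g = gcomm G (g \<otimes> n \<otimes> inv g) (g \<otimes> x \<otimes> inv g)"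
          using g by (simp add: gcomm_conj)
        then show ?thesis using nx g W.inv_op_closed2 by blast
      qed
    qed
    interpret U': normal U' G by (rule U'n)
    have UU': "U \<subseteq> U'" unfolding U'_def by (auto intro: generate.incl)
    have OU': "OU U'" by (rule OU(3)[OF less.prems U'n UU'])
    have n0G: "n0 \<in> carrier G" using n0(1) by auto
    then obtain h0 where h0: "h0 \<in> carrier G" "gcomm G n0 h0 \<notin> U" using n0(2) unfolding Z_def by blast
    define z0 where "z0 = gcomm G n0 h0"
    have "n0 \<in> W" using n0 n0G unfolding W_def by blast
    then have "z0 \<in> ?E" using h0(1) unfolding z0_def by blast
    then have z0: "z0 \<in> U'" "z0 \<notin> U"
      using h0(2) unfolding z0_def U'_def by (blast intro: generate.incl)+
    have finQ: "finite (rcosets U)" using OU(2)[OF less.prems] by (simp add: p_group_def FactGroup_def)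
    have fU: "U' <#> (U #> g) = U' #> g" if "g \<in> carrier G" for g
    proof -
      have "U' <#> (U #> g) = (U' <#> U) #> g" using that U.subset U'.subset by (simp add: setmult_rcos_assoc)
      also have "U' <#> U = U'"
        using set_mult_subgroup_idem[OF U'.subgroup_axioms subgroup_incl[OF U.subgroup_axioms U'.subgroup_axioms UU']] .
      finally show ?thesis .
    qed
    have "card (rcosets U') < card (rcosets U)"
    proof -
      have im: "(\<lambda>C. U' <#> C) ` (rcosets U) = rcosets U'"
        unfolding RCOSETS_def using fU by (force simp: image_iff)
      \<comment> \<open>The cosets \<open>U\<close> and \<open>U z0\<close> are distinct but have
        the same image, so passing from cosets of \<open>U\<close> to cosets of \<open>U'\<close>
        lowers their number.\<close>
      have "\<not> inj_on (\<lambda>C. U' <#> C) (rcosets U)"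
      proof
        assume inj: "inj_on (\<lambda>C. U' <#> C) (rcosets U)"
        have z0G: "z0 \<in> carrier G" using z0(1) by auto
        have "U' <#> (U #> z0) = U' <#> (U #> \<one>)"
          unfolding fU[OF z0G] fU[OF one_closed] 
          using z0(1) rcoset_eq_self_iff[OF U'n z0G] coset_mult_one[OF U'.subset] by simp
        then have "U #> z0 = U #> \<one>" using inj z0G by (auto simp: inj_on_def RCOSETS_def)
        then show False using z0(2) rcoset_eq_self_iff[OF U.normal_axioms z0G] U.subset by simp
      qed
      then have "card ((\<lambda>C. U' <#> C) ` (rcosets U)) \<noteq> card (rcosets U)"
        using finQ eq_card_imp_inj_on by blast
      then show ?thesis unfolding im[symmetric] using card_image_le[OF finQ, of "\<lambda>C. U' <#> C"] by linarith
    qed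
    from less.hyps[OF this OU'] obtain c where c: "c \<in> commprods G N xs" "U' #> y = U' #> c" by blast
    have cG: "c \<in> carrier G" using c(1) commprods_subset[OF N.subset xs] by blast
    \<comment> \<open>The error left by the induction hypothesis; it lies in
      \<open>U [W, G]\<close>.\<close>
    define z where "z = inv c \<otimes> y"
    have zU': "z \<in> U'"
    proof -
      have "y \<in> U' #> c" using c(2) rcos_self[OF yG U'.subgroup_axioms] by simp
      then obtain u where u: "u \<in> U'" "y = u \<otimes> c" by (auto simp: r_coset_def)
      then have "z = inv c \<otimes> u \<otimes> inv (inv c)" using cG unfolding z_def by (simp add: m_assoc)
      then show ?thesis using U'.inv_op_closed2[OF inv_closed[OF cG] u(1)] by simp
    qed
    have zG: "z \<in> carrier G" using yG cG by (simp add: z_def)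
    let ?Q = "G Mod U"
    let ?f = "\<lambda>g. U #> g"
    interpret f: group_hom G ?Q ?f
      using FactGroup_rcoset_hom[OF U.normal_axioms] by (intro group_hom.intro group_hom_axioms.intro)
    have surj: "?f ` carrier G = carrier ?Q" by (simp add: carrier_FactGroup)
    have fcomm: "?f (gcomm G a b) = gcomm ?Q (?f a) (?f b)" if "a \<in> carrier G" "b \<in> carrier G" for a b
      by (rule gcomm_hom[OF FactGroup_rcoset_hom(3,2,1)[OF U.normal_axioms] that])
    have fone: "?f u = \<one>\<^bsub>?Q\<^esub>" if "u \<in> U" for u
      using that rcoset_eq_self_iff[OF U.normal_axioms, of u] U.subset by auto
    \<comment> \<open>In \<open>G/U\<close> the commutators \<open>[w, g]\<close> with
      \<open>w\<close> in \<open>W\<close> are central, so the error is absorbed and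
      \<open>c z = y\<close> becomes a product of the required form.\<close>
    have "?f c \<otimes>\<^bsub>?Q\<^esub> ?f z \<in> commprods ?Q (?f ` N) (map ?f xs)"
    proof (rule f.H.commprods_extend_central[where W = "?f ` W"])
      show "subgroup (?f ` N) ?Q" by (rule f.subgroup_img_is_subgroup[OF N.subgroup_axioms])
      show "?f ` W \<subseteq> ?f ` N" unfolding W_def by auto
      show "inv\<^bsub>?Q\<^esub> m \<in> ?f ` W" if "m \<in> ?f ` W" for m
      proof -
        from that obtain w where w: "w \<in> W" "m = ?f w" by blast
        have "inv\<^bsub>?Q\<^esub> m = ?f (inv w)" unfolding w(2) by (rule f.hom_inv[OF W.mem_carrier[OF w(1)], symmetric])
        also have "\<dots> \<in> ?f ` W" by (rule imageI[OF W.m_inv_closed[OF w(1)]])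
        finally show ?thesis .
      qed
      show "gcomm ?Q m g \<otimes>\<^bsub>?Q\<^esub> h = h \<otimes>\<^bsub>?Q\<^esub> gcomm ?Q m g"
        if m: "m \<in> ?f ` W" and g: "g \<in> carrier ?Q" and h: "h \<in> carrier ?Q" for m g h
      proof -
        obtain w where w: "w \<in> W" "m = ?f w" using m by blast
        obtain a where a: "g = ?f a" "a \<in> carrier G" using g unfolding surj[symmetric] by (rule imageE)
        obtain b where b: "h = ?f b" "b \<in> carrier G" using h unfolding surj[symmetric] by (rule imageE)
        note ab = a(2,1) b(2,1)
        have wG: "w \<in> carrier G" using w(1) by auto
        have "gcomm G (gcomm G w a) b \<in> U" using w(1) ab unfolding W_def Z_def by blast
        then have "?f (gcomm G (gcomm G w a) b) = \<one>\<^bsub>?Q\<^esub>" by (rule fone)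
        then have one: "gcomm ?Q (gcomm ?Q m g) h = \<one>\<^bsub>?Q\<^esub>"
          unfolding fcomm[OF gcomm_closed[OF wG ab(1)] ab(3)] fcomm[OF wG ab(1)] w(2) ab(2,4) .
        have mQ: "m \<in> carrier ?Q" unfolding w(2) by (rule f.hom_closed[OF wG])
        show ?thesis by (rule iffD1[OF f.H.gcomm_eq_one_iff[OF f.H.gcomm_closed[OF mQ g] h] one])
      qed
      show "set (map ?f xs) \<subseteq> carrier ?Q" using xs by auto
      show "?f c \<in> commprods ?Q (?f ` N) (map ?f xs)"
        unfolding commprods_image[OF FactGroup_rcoset_hom(3,2,1)[OF U.normal_axioms] N.subset xs] using c(1) by blast
      show "?f z \<in> commsub ?Q (?f ` W)"
      proof -
        have "?f z \<in> ?f ` generate G (U \<union> ?E)" using zU' unfolding U'_def by blast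
        also have "\<dots> = generate ?Q (?f ` (U \<union> ?E))" by (rule f.generate_img[OF EG, symmetric])
        also have "\<dots> \<subseteq> commsub ?Q (?f ` W)" unfolding commsub_def
        proof (rule f.H.generate_subgroup_incl)
          have sub: "{gcomm ?Q n g |n g. n \<in> ?f ` W \<and> g \<in> carrier ?Q} \<subseteq> carrier ?Q"
          proof
            fix k assume "k \<in> {gcomm ?Q n g |n g. n \<in> ?f ` W \<and> g \<in> carrier ?Q}"
            then obtain n g where ng: "k = gcomm ?Q n g" "n \<in> ?f ` W" "g \<in> carrier ?Q"
              by (elim CollectE exE conjE)
            obtain w where w: "n = ?f w" "w \<in> W" using ng(2) by (rule imageE)
            show "k \<in> carrier ?Q" unfolding ng(1) w(1)
              by (rule f.H.gcomm_closed[OF f.hom_closed[OF W.mem_carrier[OF w(2)]] ng(3)])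
          qed
          show "subgroup (generate ?Q {gcomm ?Q n g |n g. n \<in> ?f ` W \<and> g \<in> carrier ?Q}) ?Q"
            by (rule f.H.generate_is_subgroup[OF sub])
          show "?f ` (U \<union> ?E) \<subseteq> generate ?Q {gcomm ?Q n g |n g. n \<in> ?f ` W \<and> g \<in> carrier ?Q}"
          proof (intro image_subsetI)
            fix e assume "e \<in> U \<union> ?E"
            then consider "e \<in> U" | w h where "e = gcomm G w h" "w \<in> W" "h \<in> carrier G" by blast
            then show "?f e \<in> generate ?Q {gcomm ?Q n g |n g. n \<in> ?f ` W \<and> g \<in> carrier ?Q}"
            proof cases
              case 1 show ?thesis unfolding fone[OF 1] by (rule generate.one)
            next
              case 2
              have e: "?f e = gcomm ?Q (?f w) (?f h)" unfolding 2(1) by (rule fcomm[OF W.mem_carrier[OF 2(2)] 2(3)])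
              show ?thesis unfolding e
                by (rule generate.incl, rule CollectI, intro exI conjI, rule refl, rule imageI[OF 2(2)],
                    rule f.hom_closed[OF 2(3)])
            qed
          qed
        qed
        finally show ?thesis .
      qed
      show "k ` carrier ?Q \<subseteq> H" if k: "k \<in> hom ?Q ?Q" and H: "H \<lhd> ?Q" and kH: "\<And>x. x \<in> set (map ?f xs) \<Longrightarrow> k x \<in> H" for k H
      proof -
        \<comment> \<open>The generation hypothesis for \<open>G/U\<close>: following
          \<open>k\<close> by the projection modulo \<open>H\<close> gives a map on \<open>G\<close>
          that kills \<open>U\<close> and \<open>xs\<close>, hence all of \<open>G\<close>.\<close>
        define F where "F = (\<lambda>g. H #>\<^bsub>?Q\<^esub> k (?f g))"
        have kc: "k x \<in> carrier ?Q" if "x \<in> carrier ?Q" for x using k that by (auto simp: hom_def)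
        have F: "F \<in> hom G (?Q Mod H)"
        proof -
          have "k \<circ> ?f \<in> hom G ?Q" by (rule Group.hom_compose[OF FactGroup_rcoset_hom(1)[OF U.normal_axioms] k])
          then have "(\<lambda>g. H #>\<^bsub>?Q\<^esub> g) \<circ> (k \<circ> ?f) \<in> hom G (?Q Mod H)"
            by (rule Group.hom_compose[OF _ FactGroup_rcoset_hom(1)[OF H]])
          then show ?thesis by (simp add: F_def o_def)
        qed
        have k1: "k \<one>\<^bsub>?Q\<^esub> = \<one>\<^bsub>?Q\<^esub>" using hom_one[OF k FactGroup_rcoset_hom(2,2)[OF U.normal_axioms]] .
        have Hs: "H #>\<^bsub>?Q\<^esub> x = \<one>\<^bsub>?Q Mod H\<^esub> \<longleftrightarrow> x \<in> H" if "x \<in> carrier ?Q" for x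
          using rcoset_eq_self_iff[OF H that] by simp
        have "F ` carrier G \<subseteq> {\<one>\<^bsub>?Q Mod H\<^esub>}"
        proof (rule gen[OF p_group_Mod[OF p OU(2)[OF less.prems] H] F less.prems])
          fix g assume "g \<in> U"
          then show "F g = \<one>\<^bsub>?Q Mod H\<^esub>" unfolding F_def fone[OF \<open>g \<in> U\<close>] k1
            using Hs[OF f.H.one_closed] subgroup.one_closed[OF normal_imp_subgroup[OF H]] by blast
        next
          fix x assume "x \<in> set xs"
          then show "F x = \<one>\<^bsub>?Q Mod H\<^esub>" unfolding F_def
            using Hs[OF kc[OF f.hom_closed]] kH[of "?f x"] xs by auto
        qed
        then have "k (?f g) \<in> H" if "g \<in> carrier G" for g
          using that Hs[OF kc[OF f.hom_closed[OF that]]] unfolding F_def by blast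
        then show ?thesis unfolding surj[symmetric] by blast
      qed
    qed
    then have "?f (c \<otimes> z) \<in> ?f ` commprods G N xs"
      unfolding commprods_image[OF FactGroup_rcoset_hom(3,2,1)[OF U.normal_axioms] N.subset xs] f.hom_mult[OF cG zG] .
    moreover have "c \<otimes> z = y" using cG yG by (simp add: z_def)
    ultimately show ?thesis by auto
  qed
qed

section \<open>Topological groups and free pro-p groups\<close>

locale top_group = group G for G :: "('a, 'b) monoid_scheme" (structure) +
  fixes T :: "'a topology"
  assumes topological_group: "topological_group G T"
begin

lemma topspace_eq: "topspace T = carrier G"
  using topological_group by (simp add: topological_group_def)

lemma cont_mult:
  assumes "continuous_map Y T f" "continuous_map Y T g"
  shows "continuous_map Y T (\<lambda>x. f x \<otimes> g x)"
proof -
  have "continuous_map Y (prod_topology T T) (\<lambda>x. (f x, g x))"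
    using assms by (simp add: continuous_map_pairedI)
  moreover have "continuous_map (prod_topology T T) T (\<lambda>(x, y). x \<otimes> y)"
    using topological_group by (simp add: topological_group_def)
  ultimately have "continuous_map Y T ((\<lambda>(x, y). x \<otimes> y) \<circ> (\<lambda>x. (f x, g x)))"
    by (rule continuous_map_compose)
  then show ?thesis by (simp add: o_def)
qed

lemma cont_inv:
  assumes "continuous_map Y T f" shows "continuous_map Y T (\<lambda>x. inv (f x))"
proof -
  have "continuous_map T T (\<lambda>x. inv x)"
    using topological_group by (simp add: topological_group_def)
  from continuous_map_compose[OF assms this] show ?thesis by (simp add: o_def)
qed

lemma cont_const: "c \<in> carrier G \<Longrightarrow> continuous_map Y T (\<lambda>x. c)"
  by (simp add: topspace_eq)

lemma cont_gcomm:
  assumes "continuous_map Y T f" "continuous_map Y T g"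
  shows "continuous_map Y T (\<lambda>x. gcomm G (f x) (g x))"
  unfolding gcomm_def by (intro cont_mult cont_inv assms)

lemma open_subgroupI:
  assumes H: "subgroup H G" and S: "openin T S" "\<one> \<in> S" "S \<subseteq> H"
  shows "openin T H"
proof (subst openin_subopen, intro ballI)
  fix h assume h: "h \<in> H"
  then have hG: "h \<in> carrier G" using subgroup.mem_carrier[OF H] by blast
  have c: "continuous_map T T (\<lambda>y. inv h \<otimes> y)"
    using hG by (intro cont_mult cont_const) auto
  show "\<exists>U. openin T U \<and> h \<in> U \<and> U \<subseteq> H"
  proof (intro exI conjI)
    show "openin T {y \<in> topspace T. inv h \<otimes> y \<in> S}" by (rule openin_continuous_map_preimage[OF c S(1)])
    show "h \<in> {y \<in> topspace T. inv h \<otimes> y \<in> S}" using hG S(2) by (simp add: topspace_eq)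
    show "{y \<in> topspace T. inv h \<otimes> y \<in> S} \<subseteq> H"
    proof
      fix y assume "y \<in> {y \<in> topspace T. inv h \<otimes> y \<in> S}"
      then have y: "y \<in> carrier G" "inv h \<otimes> y \<in> H" using S(3) by (auto simp: topspace_eq)
      then have "h \<otimes> (inv h \<otimes> y) \<in> H" using subgroup.m_closed[OF H h] by blast
      then show "y \<in> H" using y(1) hG by simp
    qed
  qed
qed

text \<open>In a compact Hausdorff space quasi-components are components, so every point other than
  the identity is separated from it by a clopen set. By compactness, finitely many of these sets
  exclude the whole complement of \<open>S\<close>.\<close>

lemma clopen_nbhd:
  assumes prof: "profinite_group G T" and S: "openin T S" "\<one> \<in> S"
  shows "\<exists>V. openin T V \<and> closedin T V \<and> \<one> \<in> V \<and> V \<subseteq> S"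
proof -
  have comp: "compact_space T" and haus: "Hausdorff_space T" and td: "totally_disconnected_space T"
    using prof by (simp_all add: profinite_group_def)
  have sep: "\<exists>C. openin T C \<and> closedin T C \<and> \<one> \<in> C \<and> y \<notin> C" if y: "y \<in> topspace T" "y \<noteq> \<one>" for y
  proof -
    have "\<not> connected_component_of T \<one> y"
      using td y(2) unfolding connected_component_of_def totally_disconnected_space_def by blast
    then have "\<not> quasi_component_of T \<one> y"
      using quasi_eq_connected_component_of[of T \<one>] comp haus by metis
    then obtain C where C: "openin T C" "closedin T C" "\<not> (\<one> \<in> C \<longleftrightarrow> y \<in> C)"
      using y(1) by (auto simp: quasi_component_of_def topspace_eq)
    show ?thesis
    proof (cases "\<one> \<in> C")
      case True then show ?thesis using C by blast
    next
      case False
      then have "\<one> \<in> topspace T - C" "y \<notin> topspace T - C" using C(3) by (auto simp: topspace_eq)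
      then show ?thesis
        using openin_diff[OF openin_topspace C(2)] closedin_diff[OF closedin_topspace C(1)] by blast
    qed
  qed
  define \<C> where "\<C> = {topspace T - C | C. openin T C \<and> closedin T C \<and> \<one> \<in> C}"
  have "closedin T (topspace T - S)" using S by blast
  then have "compactin T (topspace T - S)" using closedin_compact_space[OF comp] by blast
  moreover have "\<And>U. U \<in> \<C> \<Longrightarrow> openin T U" unfolding \<C>_def by blast
  moreover have "topspace T - S \<subseteq> \<Union>\<C>"
  proof
    fix y assume y: "y \<in> topspace T - S"
    then obtain C where "openin T C" "closedin T C" "\<one> \<in> C" "y \<notin> C" using sep[of y] S(2) by blast
    then show "y \<in> \<Union>\<C>" using y unfolding \<C>_def by blast
  qed
  ultimately obtain F where F: "finite F" "F \<subseteq> \<C>" "topspace T - S \<subseteq> \<Union>F"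
    unfolding compactin_def by meson
  have op: "openin T (\<Union>F)" using F(2) unfolding \<C>_def by blast
  have cl: "closedin T (\<Union>F)" using F(1,2) unfolding \<C>_def by (intro closedin_Union) blast+
  have "\<one> \<notin> \<Union>F" using F(2) unfolding \<C>_def by blast
  then have "\<one> \<in> topspace T - \<Union>F" "topspace T - \<Union>F \<subseteq> S" using F(3) by (auto simp: topspace_eq)
  then show ?thesis
    using openin_diff[OF openin_topspace cl] closedin_diff[OF closedin_topspace op] by blast
qed

text \<open>For a clopen \<open>V\<close> in \<open>S\<close>, the elements whose conjugates all map
  \<open>V\<close> into itself by right multiplication form a monoid \<open>M\<close> stable under
  conjugation. The tube lemma, with \<open>G \<times> V\<close> compact, shows that \<open>M\<close>
  contains a neighbourhood of the identity; then \<open>M \<inter> M^-1\<close> is open and normal,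
  and it lies in \<open>V\<close> because \<open>V\<close> contains the identity.\<close>

lemma open_normal_nbhd:
  assumes prof: "profinite_group G T" and S: "openin T S" "\<one> \<in> S"
  shows "\<exists>U. U \<lhd> G \<and> openin T U \<and> U \<subseteq> S"
proof -
  have comp: "compact_space T" using prof by (simp add: profinite_group_def)
  obtain V where V: "openin T V" "closedin T V" "\<one> \<in> V" "V \<subseteq> S" using clopen_nbhd[OF prof S] by blast
  have VG: "V \<subseteq> carrier G" using openin_subset[OF V(1)] by (simp add: topspace_eq)
  let ?P = "prod_topology (prod_topology T T) T"
  \<comment> \<open>For \<open>w = ((x, v), g)\<close> this is \<open>v (x g x^-1)\<close>.\<close>
  let ?f = "\<lambda>w. snd (fst w) \<otimes> (fst (fst w) \<otimes> snd w \<otimes> inv (fst (fst w)))"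
  have pr: "continuous_map ?P T (\<lambda>w. fst (fst w))" "continuous_map ?P T (\<lambda>w. snd (fst w))" "continuous_map ?P T snd"
    using continuous_map_compose[OF continuous_map_fst[of "prod_topology T T" T] continuous_map_fst]
      continuous_map_compose[OF continuous_map_fst[of "prod_topology T T" T] continuous_map_snd]
    by (simp_all add: o_def continuous_map_snd)
  have cf: "continuous_map ?P T ?f" by (intro cont_mult cont_inv pr)
  define W where "W = {w \<in> topspace ?P. ?f w \<in> V}"
  have "openin ?P W" unfolding W_def by (rule openin_continuous_map_preimage[OF cf V(1)])
  moreover have "compactin (prod_topology T T) (topspace T \<times> V)"
    using comp closedin_compact_space[OF comp V(2)] by (simp add: compactin_Times compact_space_def)
  moreover have "(topspace T \<times> V) \<times> {\<one>} \<subseteq> W" using VG by (auto simp: W_def topspace_eq)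
  ultimately obtain A O' where O': "openin T O'" "topspace T \<times> V \<subseteq> A" "\<one> \<in> O'" "A \<times> O' \<subseteq> W"
    using tube_lemma_left[of "prod_topology T T" T W "topspace T \<times> V" \<one>] by (auto simp: topspace_eq)
  define M where "M = {g \<in> carrier G. \<forall>x\<in>carrier G. \<forall>v\<in>V. v \<otimes> (x \<otimes> g \<otimes> inv x) \<in> V}"
  define U where "U = {g \<in> M. inv g \<in> M}"
  have O'M: "O' \<subseteq> M"
  proof
    fix g assume g: "g \<in> O'"
    then have "g \<in> carrier G" using openin_subset[OF O'(1)] by (auto simp: topspace_eq)
    moreover have "v \<otimes> (x \<otimes> g \<otimes> inv x) \<in> V" if "x \<in> carrier G" "v \<in> V" for x v
    proof -
      have "((x, v), g) \<in> W" using O'(2,4) that g by (auto simp: topspace_eq)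
      then show ?thesis by (simp add: W_def)
    qed
    ultimately show "g \<in> M" by (simp add: M_def)
  qed
  have Mm: "g \<otimes> h \<in> M" if g: "g \<in> M" and h: "h \<in> M" for g h
  proof -
    have gh: "g \<in> carrier G" "h \<in> carrier G" using g h by (auto simp: M_def)
    have "v \<otimes> (x \<otimes> (g \<otimes> h) \<otimes> inv x) \<in> V" if "x \<in> carrier G" "v \<in> V" for x v
    proof -
      have "v \<otimes> (x \<otimes> g \<otimes> inv x) \<otimes> (x \<otimes> h \<otimes> inv x) \<in> V" using g h that by (simp add: M_def)
      then show ?thesis using that gh VG by (simp add: m_assoc subset_iff)
    qed
    then show ?thesis using gh by (simp add: M_def)
  qed
  have M1: "\<one> \<in> M" using VG by (auto simp: M_def)
  have Mc: "y \<otimes> g \<otimes> inv y \<in> M" if g: "g \<in> M" and y: "y \<in> carrier G" for g y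
  proof -
    have gG: "g \<in> carrier G" using g by (auto simp: M_def)
    have "v \<otimes> (x \<otimes> (y \<otimes> g \<otimes> inv y) \<otimes> inv x) \<in> V" if "x \<in> carrier G" "v \<in> V" for x v
    proof -
      have "v \<otimes> ((x \<otimes> y) \<otimes> g \<otimes> inv (x \<otimes> y)) \<in> V" using g that y by (simp add: M_def)
      then show ?thesis using that gG y VG by (simp add: m_assoc inv_mult_group subset_iff)
    qed
    then show ?thesis using gG y by (simp add: M_def)
  qed
  have MG: "g \<in> carrier G" if "g \<in> M" for g using that by (simp add: M_def)
  have Us: "subgroup U G"
    by standard (use M1 Mm MG in \<open>auto simp: U_def inv_mult_group\<close>)
  have "U \<lhd> G"
  proof (rule normal_invI[OF Us])
    fix x h assume x: "x \<in> carrier G" and h: "h \<in> U"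
    then have "inv (x \<otimes> h \<otimes> inv x) = x \<otimes> inv h \<otimes> inv x" using MG by (simp add: U_def inv_mult_group m_assoc)
    then show "x \<otimes> h \<otimes> inv x \<in> U" using x h Mc by (auto simp: U_def)
  qed
  moreover have "openin T U"
  proof (rule open_subgroupI[OF Us])
    have "continuous_map T T (\<lambda>x. inv x)" by (rule cont_inv) simp
    then have "openin T {x \<in> topspace T. inv x \<in> O'}" by (rule openin_continuous_map_preimage[OF _ O'(1)])
    then show "openin T (O' \<inter> {x \<in> topspace T. inv x \<in> O'})" by (rule openin_Int[OF O'(1)])
    show "\<one> \<in> O' \<inter> {x \<in> topspace T. inv x \<in> O'}" using O'(3) by (simp add: topspace_eq)
    show "O' \<inter> {x \<in> topspace T. inv x \<in> O'} \<subseteq> U" using O'M by (auto simp: U_def)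
  qed
  moreover have "U \<subseteq> S"
  proof
    fix g assume "g \<in> U"
    then have g: "g \<in> carrier G" "\<forall>x\<in>carrier G. \<forall>v\<in>V. v \<otimes> (x \<otimes> g \<otimes> inv x) \<in> V" by (simp_all add: U_def M_def)
    from bspec[OF bspec[OF g(2) one_closed] V(3)] have "g \<in> V" using g(1) by simp
    then show "g \<in> S" using V(4) by blast
  qed
  ultimately show ?thesis by blast
qed

lemma commprods_compact:
  assumes N: "compactin T N" and xs: "set xs \<subseteq> carrier G"
  shows "compactin T (commprods G N xs)"
  using xs
proof (induction xs)
  case Nil then show ?case by (simp add: topspace_eq)
next
  case (Cons x xs)
  let ?f = "\<lambda>w. gcomm G (fst w) x \<otimes> snd w"
  have "continuous_map (prod_topology T T) T ?f"
    using Cons.prems by (intro cont_mult cont_gcomm cont_const continuous_map_fst continuous_map_snd) auto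
  moreover have "compactin (prod_topology T T) (N \<times> commprods G N xs)"
    using N Cons by (simp add: compactin_Times)
  ultimately have "compactin T (?f ` (N \<times> commprods G N xs))" by (rule image_compactin[rotated])
  moreover have "?f ` (N \<times> commprods G N xs) = commprods G N (x # xs)" by force
  ultimately show ?case by simp
qed

end

text \<open>The universal property quantifies over carriers in \<open>nat\<close>; such a copy makes
  it applicable to the lamplighter groups and to iterated quotients of \<open>G\<close>.\<close>

lemma p_group_nat_copy:
  assumes "p_group p P"
  shows "\<exists>(Q :: nat monoid) e. p_group p Q \<and> e \<in> iso P Q"
proof -
  interpret group P using assms by (simp add: p_group_def)
  have fin: "finite (carrier P)" using assms by (simp add: p_group_def)
  obtain e :: "_ \<Rightarrow> nat" where e: "inj_on e (carrier P)" using finite_imp_inj_to_nat_seg[OF fin] by blast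
  define d where "d = inv_into (carrier P) e"
  define Q where "Q = \<lparr>carrier = e ` carrier P, mult = (\<lambda>a b. e (d a \<otimes>\<^bsub>P\<^esub> d b)), one = e \<one>\<^bsub>P\<^esub>\<rparr>"
  have d: "d (e x) = x" if "x \<in> carrier P" for x using that e by (simp add: d_def)
  have "group Q"
  proof (rule groupI)
    fix x assume "x \<in> carrier Q"
    then obtain a where a: "a \<in> carrier P" "x = e a" by (auto simp: Q_def)
    show "\<exists>y\<in>carrier Q. y \<otimes>\<^bsub>Q\<^esub> x = \<one>\<^bsub>Q\<^esub>"
      using a d by (intro bexI[of _ "e (inv\<^bsub>P\<^esub> a)"]) (auto simp: Q_def)
  qed (use d in \<open>auto simp: Q_def m_assoc\<close>)
  moreover have "card (carrier Q) = card (carrier P)" using card_image[OF e] by (simp add: Q_def)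
  ultimately have "p_group p Q" using assms fin by (auto simp: p_group_def Q_def)
  moreover have "e \<in> iso P Q" using e d by (auto simp: iso_def hom_def bij_betw_def Q_def)
  ultimately show ?thesis by blast
qed

section \<open>Free pro-p groups and bounded products of commutators\<close>

locale free_pro_p =
  fixes p :: nat and G :: "('a, 'b) monoid_scheme" (structure) and T :: "'a topology" and B :: "'a set"
  assumes prime: "Factorial_Ring.prime p" and free: "free_pro_p_group_on p G T B"

sublocale free_pro_p \<subseteq> top_group G T
  using free by (auto simp: free_pro_p_group_on_def pro_p_group_def profinite_group_def topological_group_def
      top_group_def top_group_axioms_def)

context free_pro_p begin

lemma profinite: "profinite_group G T"
  using free by (simp add: free_pro_p_group_on_def pro_p_group_def)

lemma basis_subset: "B \<subseteq> carrier G"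
  using free by (simp add: free_pro_p_group_on_def)

lemma p_group_open_quotient:
  assumes "U \<lhd> G" "openin T U" shows "p_group p (G Mod U)"
proof -
  obtain k where k: "card (rcosets U) = p ^ k"
    using free assms by (auto simp: free_pro_p_group_on_def pro_p_group_def)
  moreover have "p ^ k > 0" using prime by (simp add: prime_gt_0_nat)
  ultimately have "finite (rcosets U)" using card_ge_0_finite by metis
  then show ?thesis using k normal.factorgroup_is_group[OF assms(1)] by (auto simp: p_group_def FactGroup_def)
qed

lemma extend_hom:
  fixes P :: "('c, 'd) monoid_scheme"
  assumes P: "p_group p P" and f: "f ` B \<subseteq> carrier P"
  shows "\<exists>\<phi>. \<phi> \<in> hom G P \<and> continuous_map T (discrete_topology (carrier P)) \<phi> \<and> (\<forall>x\<in>B. \<phi> x = f x)"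
proof -
  obtain Q :: "nat monoid" and e where Q: "p_group p Q" "e \<in> iso P Q" using p_group_nat_copy[OF P] by blast
  have gP: "group P" using P by (simp add: p_group_def)
  define d where "d = inv_into (carrier P) e"
  have e: "bij_betw e (carrier P) (carrier Q)" "e ` carrier P = carrier Q" using Q(2) by (auto simp: iso_def bij_betw_def)
  have d: "d \<in> hom Q P" using group.iso_set_sym[OF gP Q(2)] by (simp add: iso_def d_def)
  have "(e \<circ> f) ` B \<subseteq> carrier Q" using f e by auto
  then obtain \<phi> where \<phi>: "\<phi> \<in> hom G Q" "continuous_map T (discrete_topology (carrier Q)) \<phi>" "\<forall>x\<in>B. \<phi> x = (e \<circ> f) x"
    using free Q(1) unfolding free_pro_p_group_on_def by meson
  have "continuous_map (discrete_topology (carrier Q)) (discrete_topology (carrier P)) d"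
    using d by (auto simp: hom_def)
  from continuous_map_compose[OF \<phi>(2) this] have "continuous_map T (discrete_topology (carrier P)) (d \<circ> \<phi>)" .
  moreover have "d \<circ> \<phi> \<in> hom G P" by (rule Group.hom_compose[OF \<phi>(1) d])
  moreover have "\<forall>x\<in>B. (d \<circ> \<phi>) x = f x" using \<phi>(3) f e(1) by (auto simp: d_def bij_betw_def)
  ultimately show ?thesis by blast
qed

lemma hom_eqI:
  fixes P :: "('c, 'd) monoid_scheme"
  assumes P: "p_group p P"
    and f: "f \<in> hom G P" "continuous_map T (discrete_topology (carrier P)) f"
    and g: "g \<in> hom G P" "continuous_map T (discrete_topology (carrier P)) g"
    and eq: "\<And>x. x \<in> B \<Longrightarrow> f x = g x" and x: "x \<in> carrier G"
  shows "f x = g x"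
proof -
  obtain Q :: "nat monoid" and e where Q: "p_group p Q" "e \<in> iso P Q" using p_group_nat_copy[OF P] by blast
  have e: "e \<in> hom P Q" "inj_on e (carrier P)" using Q(2) by (auto simp: iso_def bij_betw_def)
  have ec: "continuous_map (discrete_topology (carrier P)) (discrete_topology (carrier Q)) e"
    using e by (auto simp: hom_def)
  have "(e \<circ> f) ` B \<subseteq> carrier Q" using basis_subset f(1) e(1) by (auto simp: hom_def)
  then obtain \<phi> where \<phi>: "\<forall>\<psi>. \<psi> \<in> hom G Q \<longrightarrow> continuous_map T (discrete_topology (carrier Q)) \<psi>
      \<longrightarrow> (\<forall>x\<in>B. \<psi> x = (e \<circ> f) x) \<longrightarrow> (\<forall>g\<in>carrier G. \<psi> g = \<phi> g)"
    using free Q(1) unfolding free_pro_p_group_on_def by meson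
  have "\<forall>h\<in>carrier G. (e \<circ> f) h = \<phi> h"
    using \<phi> Group.hom_compose[OF f(1) e(1)] continuous_map_compose[OF f(2) ec] by blast
  moreover have "\<forall>h\<in>carrier G. (e \<circ> g) h = \<phi> h"
    using \<phi> Group.hom_compose[OF g(1) e(1)] continuous_map_compose[OF g(2) ec] eq by simp
  ultimately have "e (f x) = e (g x)" using x by simp
  moreover have "f x \<in> carrier P" "g x \<in> carrier P" using f(1) g(1) x by (auto simp: hom_def)
  ultimately show ?thesis by (rule inj_onD[OF e(2)])
qed

text \<open>The fibres of \<open>f\<close> are unions of cosets \<open>x U\<close>, which are
  open.\<close>

lemma continuous_into_discreteI:
  assumes P: "group P" and f: "f \<in> hom G P" and U: "U \<lhd> G" "openin T U" "\<And>g. g \<in> U \<Longrightarrow> f g = \<one>\<^bsub>P\<^esub>"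
  shows "continuous_map T (discrete_topology (carrier P)) f"
proof -
  interpret f: group_hom G P f by (intro group_hom.intro group_hom_axioms.intro P f group_axioms)
  have Uc: "U \<subseteq> carrier G" using openin_subset[OF U(2)] by (simp add: topspace_eq)
  have "openin T {x \<in> topspace T. f x \<in> A}" for A
  proof (subst openin_subopen, intro ballI)
    fix x assume x: "x \<in> {x \<in> topspace T. f x \<in> A}"
    then have xG: "x \<in> carrier G" by (simp add: topspace_eq)
    let ?V = "{y \<in> topspace T. inv x \<otimes> y \<in> U}"
    have "continuous_map T T (\<lambda>y. inv x \<otimes> y)" using xG by (intro cont_mult cont_const) auto
    then have "openin T ?V" by (rule openin_continuous_map_preimage[OF _ U(2)])
    moreover have "x \<in> ?V" using xG normal_imp_subgroup[OF U(1)] by (simp add: topspace_eq subgroup.one_closed)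
    moreover have "?V \<subseteq> {x \<in> topspace T. f x \<in> A}"
    proof
      fix y assume y: "y \<in> ?V"
      then have yG: "y \<in> carrier G" by (simp add: topspace_eq)
      have "f y = f (x \<otimes> (inv x \<otimes> y))" using xG yG by simp
      also have "\<dots> = f x \<otimes>\<^bsub>P\<^esub> f (inv x \<otimes> y)" using xG yG by (intro f.hom_mult) auto
      also have "\<dots> = f x" using U(3) y xG by simp
      finally show "y \<in> {x \<in> topspace T. f x \<in> A}" using x y by simp
    qed
    ultimately show "\<exists>V. openin T V \<and> x \<in> V \<and> V \<subseteq> {x \<in> topspace T. f x \<in> A}" by blast
  qed
  then show ?thesis unfolding continuous_map_def by (auto simp: topspace_eq)
qed

text \<open>The set of products is compact, hence closed. A point \<open>y\<close> outside it would
  have a coset \<open>U y\<close> disjoint from it for some open normal \<open>U\<close>, while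
  \<open>finite_width_mod\<close> represents \<open>y\<close> modulo every such
  \<open>U\<close>.\<close>

theorem commsub_subset_commprods:
  assumes xs: "set xs = B" and N: "N \<lhd> G" "closedin T N"
  shows "commsub G N \<subseteq> commprods G N xs"
proof (rule subsetI, rule ccontr)
  fix y assume y: "y \<in> commsub G N" and ny: "y \<notin> commprods G N xs"
  have xsG: "set xs \<subseteq> carrier G" using xs basis_subset by simp
  have yG: "y \<in> carrier G"
    by (rule subgroup.mem_carrier[OF normal_imp_subgroup[OF commsub_normal[OF N(1)]] y])
  have comp: "compact_space T" "Hausdorff_space T" using profinite by (simp_all add: profinite_group_def)
  have "closedin T (commprods G N xs)"
    by (rule compactin_imp_closedin[OF comp(2) commprods_compact[OF closedin_compact_space[OF comp(1) N(2)] xsG]])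
  then have op: "openin T (topspace T - commprods G N xs)" by blast
  have c: "continuous_map T T (\<lambda>u. u \<otimes> y)" using yG by (intro cont_mult cont_const) auto
  have "openin T {u \<in> topspace T. u \<otimes> y \<in> topspace T - commprods G N xs}"
    by (rule openin_continuous_map_preimage[OF c op])
  moreover have "\<one> \<in> {u \<in> topspace T. u \<otimes> y \<in> topspace T - commprods G N xs}"
    using yG ny by (simp add: topspace_eq)
  ultimately obtain U where U: "U \<lhd> G" "openin T U" "U \<subseteq> {u \<in> topspace T. u \<otimes> y \<in> topspace T - commprods G N xs}"
    using open_normal_nbhd[OF profinite] by blast
  have "\<exists>c\<in>commprods G N xs. U #> y = U #> c"
  proof (rule finite_width_mod[where OU = "\<lambda>U. U \<lhd> G \<and> openin T U", OF prime _ _ _ _ xsG N(1) _ y])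
    show "p_group p (G Mod U)" if "U \<lhd> G \<and> openin T U" for U using that p_group_open_quotient by blast
    show "U' \<lhd> G \<and> openin T U'" if "U \<lhd> G \<and> openin T U" "U' \<lhd> G" "U \<subseteq> U'" for U U'
      using that open_subgroupI[OF normal_imp_subgroup[OF that(2)], of U]
        subgroup.one_closed[OF normal_imp_subgroup, of U G] by blast
    fix P :: "'a set set monoid" and f U
    assume P: "p_group p P" and f: "f \<in> hom G P" and V: "U \<lhd> G \<and> openin T U" "\<And>g. g \<in> U \<Longrightarrow> f g = \<one>\<^bsub>P\<^esub>"
      and fx: "\<And>x. x \<in> set xs \<Longrightarrow> f x = \<one>\<^bsub>P\<^esub>"
    have gP: "group P" using P by (simp add: p_group_def)
    interpret P: group P by (rule gP)
    \<comment> \<open>A homomorphism trivial on an open normal subgroup is continuous, so the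
      uniqueness half of the universal property compares it with the trivial one.\<close>
    have t: "(\<lambda>_. \<one>\<^bsub>P\<^esub>) \<in> hom G P" by (rule homI) auto
    have "f x = \<one>\<^bsub>P\<^esub>" if "x \<in> carrier G" for x
      by (rule hom_eqI[OF P f _ t _ _ that])
        (use V fx xs in \<open>auto intro!: continuous_into_discreteI[OF gP f, of U]\<close>)
    then show "f ` carrier G \<subseteq> {\<one>\<^bsub>P\<^esub>}" by auto
  qed (use U in auto)
  then obtain c where c: "c \<in> commprods G N xs" "U #> y = U #> c" by blast
  have "c \<in> carrier G" using c(1) commprods_subset[OF _ xsG, of N] N(1) by (meson normal_imp_subgroup subgroup.subset subsetD)
  then have "c \<in> U #> y" using c(2) rcos_self[OF _ normal_imp_subgroup[OF U(1)]] by simp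
  then obtain u where "u \<in> U" "c = u \<otimes> y" by (auto simp: r_coset_def)
  then show False using U(3) c(1) by auto
qed

end

section \<open>The lamplighter quotient\<close>

lemma pdvd_pdvd_uptoI: "1 < p \<Longrightarrow> (\<And>m. pdvd_upto p (p ^ m) f) \<Longrightarrow> pdvd p f"
  unfolding pdvd_iff_pdvd_upto using pdvd_upto_mono[OF _ less_imp_le[OF power_gt_expt[of p]]] by auto

lemma pdvd_trans: "pdvd p (f - g) \<Longrightarrow> pdvd p (g - h) \<Longrightarrow> pdvd p (f - h)"
  using pdvd_add[of p "f - g" "g - h"] by simp

lemma pdvd_sym: "pdvd p (f - g) \<Longrightarrow> pdvd p (g - f)"
  using pdvd_uminus[of p "f - g"] by simp

lemma pdvd_mult_cong: "pdvd p (f - f') \<Longrightarrow> pdvd p (g - g') \<Longrightarrow> pdvd p (f * g - f' * g')"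
  using pdvd_add[OF pdvd_mult_right[of p "f - f'" g] pdvd_mult_left[of p "g - g'" f']] by (simp add: algebra_simps)

lemma pdvd_upto_add_cong: "pdvd_upto p k (f - f') \<Longrightarrow> pdvd_upto p k (g - g') \<Longrightarrow> pdvd_upto p k (f + g - (f' + g'))"
  using pdvd_upto_add[of p k "f - f'" "g - g'"] by (simp add: algebra_simps)

lemma pdvd_upto_mult_cong: "pdvd_upto p k (f - f') \<Longrightarrow> pdvd_upto p k (g - g') \<Longrightarrow> pdvd_upto p k (f * g - f' * g')"
  using pdvd_upto_add[OF pdvd_upto_mult_right[of p k "f - f'" g] pdvd_upto_mult_left[of p k "g - g'" f']] by (simp add: algebra_simps)

locale free_pro_p_pair = free_pro_p +
  fixes u v assumes uB: "u \<in> B" and vB: "v \<in> B" and uv: "u \<noteq> v"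
begin

lemma p1: "1 < p" by (rule prime_gt_1_nat[OF prime])

lemma uG [simp]: "u \<in> carrier G" and vG [simp]: "v \<in> carrier G"
  using basis_subset uB vB by auto

text \<open>The reduction of the exponent \<open>1\<close> matters at level \<open>0\<close>, where
  the acting group is trivial.\<close>

definition gens :: "nat \<Rightarrow> 'a \<Rightarrow> int fps \<times> nat" where
  "gens m x = (if x = u then (red p (p ^ m) 1, 0) else if x = v then (0, 1 mod p ^ m) else (0, 0))"

definition phi :: "nat \<Rightarrow> 'a \<Rightarrow> int fps \<times> nat" where
  "phi m = (SOME \<phi>. \<phi> \<in> hom G (lampgroup p (p ^ m)) \<and>
     continuous_map T (discrete_topology (carrier (lampgroup p (p ^ m)))) \<phi> \<and> (\<forall>x\<in>B. \<phi> x = gens m x))"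

lemma phi: "phi m \<in> hom G (lampgroup p (p ^ m))"
    "continuous_map T (discrete_topology (carrier (lampgroup p (p ^ m)))) (phi m)"
    "\<And>x. x \<in> B \<Longrightarrow> phi m x = gens m x"
proof -
  have "1 mod p ^ m < p ^ m" by (rule mod_less_divisor) (use p1 in simp)
  then have "gens m ` B \<subseteq> carrier (lampgroup p (p ^ m))" using p1 by (auto simp: gens_def lampgroup_simps)
  from someI_ex[OF extend_hom[OF p_group_lampgroup[OF prime] this], folded phi_def]
  show "phi m \<in> hom G (lampgroup p (p ^ m))"
    "continuous_map T (discrete_topology (carrier (lampgroup p (p ^ m)))) (phi m)"
    "\<And>x. x \<in> B \<Longrightarrow> phi m x = gens m x" by blast+
qed

lemma group_lamp: "group (lampgroup p (p ^ m))" by (rule group_lampgroup[OF prime refl])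

lemma phi_hom: "group_hom G (lampgroup p (p ^ m)) (phi m)"
  by (intro group_hom.intro group_hom_axioms.intro phi group_lamp group_axioms)

text \<open>Truncating level \<open>Suc m\<close> gives a continuous homomorphism with the same
  values on the basis as \<open>phi m\<close>, so uniqueness applies.\<close>

lemma phi_Suc:
  assumes "g \<in> carrier G"
  shows "phi m g = (red p (p ^ m) (fst (phi (Suc m) g)), snd (phi (Suc m) g) mod p ^ m)"
proof -
  let ?t = "\<lambda>(a, s). (red p (p ^ m) a, s mod p ^ m)"
  note t = lampgroup_truncate[OF prime, of m]
  have c: "continuous_map (discrete_topology (carrier (lampgroup p (p ^ Suc m)))) (discrete_topology (carrier (lampgroup p (p ^ m)))) ?t"
    using t by (auto simp: hom_def)
  have "(?t \<circ> phi (Suc m)) g = phi m g"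
  proof (rule hom_eqI[OF p_group_lampgroup[OF prime] _ _ phi(1,2) _ assms])
    show "?t \<circ> phi (Suc m) \<in> hom G (lampgroup p (p ^ m))" by (rule Group.hom_compose[OF phi(1) t])
    show "continuous_map T (discrete_topology (carrier (lampgroup p (p ^ m)))) (?t \<circ> phi (Suc m))"
      by (rule continuous_map_compose[OF phi(2) c])
    fix x assume x: "x \<in> B"
    have "red p (p ^ m) (red p (p ^ Suc m) 1) = red p (p ^ m) 1"
      unfolding red_eq_iff by (rule pdvd_upto_mono[OF pdvd_upto_red]) (use p1 in simp)
    moreover have "1 mod p ^ Suc m mod p ^ m = 1 mod p ^ m" by (rule mod_mod_cancel) simp
    ultimately show "(?t \<circ> phi (Suc m)) x = phi m x" by (simp add: phi(3)[OF x] gens_def)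
  qed
  then show ?thesis by (simp add: case_prod_beta)
qed

section \<open>The limit over all levels: derivation and character\<close>

definition d :: "nat \<Rightarrow> 'a \<Rightarrow> int fps" where "d m g = fst (phi m g)"
definition s :: "nat \<Rightarrow> 'a \<Rightarrow> nat" where "s m g = snd (phi m g)"
text \<open>The limit is taken along the diagonal: the coefficient of \<open>X^n\<close> is read at
  level \<open>n\<close>, where it is stable modulo \<open>p\<close> because \<open>n < p^n\<close>.
  The same device gives \<open>chi\<close>.\<close>

definition D :: "'a \<Rightarrow> int fps" where "D g = Abs_fps (\<lambda>n. d n g $ n)"
definition chi :: "'a \<Rightarrow> int fps" where "chi g = Abs_fps (\<lambda>n. ((1 + fps_X) ^ s n g) $ n)"

lemma s_compat:
  assumes "g \<in> carrier G" "m \<le> m'" shows "[s m' g = s m g] (mod p ^ m)"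
  using assms(2)
proof (induction rule: dec_induct)
  case (step n)
  have "[s (Suc n) g = s n g] (mod p ^ n)" using phi_Suc[OF assms(1), of n] by (simp add: s_def cong_def)
  then have "[s (Suc n) g = s n g] (mod p ^ m)"
    using cong_dvd_modulus_nat step(1) le_imp_power_dvd by blast
  then show ?case using step(3) by (rule cong_trans)
qed simp

lemma d_compat:
  assumes "g \<in> carrier G" "m \<le> m'" shows "pdvd_upto p (p ^ m) (d m' g - d m g)"
  using assms(2)
proof (induction rule: dec_induct)
  case (step n)
  have "pdvd_upto p (p ^ n) (d n g - d (Suc n) g)"
    using pdvd_upto_red[of p "p ^ n" "d (Suc n) g"] phi_Suc[OF assms(1), of n] by (simp add: d_def)
  then have "pdvd_upto p (p ^ m) (d (Suc n) g - d n g)"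
    using pdvd_upto_mono[OF pdvd_upto_sym] power_increasing[OF step(1), of p] p1 by auto
  then show ?case using step(3) by (rule pdvd_upto_trans)
qed simp

lemma diagonal_pdvd_upto:
  assumes "\<And>m m'. m \<le> m' \<Longrightarrow> pdvd_upto p (p ^ m) (f m' - f m)"
  shows "pdvd_upto p (p ^ m) (Abs_fps (\<lambda>n. f n $ n) - f m)"
  unfolding pdvd_upto_def
proof (intro allI impI)
  fix n assume n: "n < p ^ m"
  show "int p dvd (Abs_fps (\<lambda>n. f n $ n) - f m) $ n"
  proof (cases "n \<le> m")
    case True
    have "n < p ^ n" using p1 by (simp add: power_gt_expt)
    then show ?thesis using pdvd_upto_sym[OF assms[OF True]] by (simp add: pdvd_upto_def)
  next
    case False
    then show ?thesis using assms[of m n] n by (simp add: pdvd_upto_def)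
  qed
qed

lemma D_pdvd_upto: "g \<in> carrier G \<Longrightarrow> pdvd_upto p (p ^ m) (D g - d m g)"
  unfolding D_def by (rule diagonal_pdvd_upto[OF d_compat])

lemma chi_pdvd_upto: "g \<in> carrier G \<Longrightarrow> pdvd_upto p (p ^ m) (chi g - (1 + fps_X) ^ s m g)"
  unfolding chi_def by (rule diagonal_pdvd_upto[OF power_cong_pdvd_upto[OF prime s_compat]])

lemma phi_mult:
  assumes "g \<in> carrier G" "h \<in> carrier G"
  shows "d m (g \<otimes> h) = red p (p ^ m) (d m g + (1 + fps_X) ^ s m g * d m h)"
    "s m (g \<otimes> h) = (s m g + s m h) mod p ^ m"
proof -
  interpret group_hom G "lampgroup p (p ^ m)" "phi m" by (rule phi_hom)
  have "phi m (g \<otimes> h) = (d m g, s m g) \<otimes>\<^bsub>lampgroup p (p ^ m)\<^esub> (d m h, s m h)"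
    using assms by (simp add: d_def s_def)
  then show "d m (g \<otimes> h) = red p (p ^ m) (d m g + (1 + fps_X) ^ s m g * d m h)"
    "s m (g \<otimes> h) = (s m g + s m h) mod p ^ m"
    unfolding lampgroup_simps by (simp_all add: d_def s_def)
qed

lemma D_mult:
  assumes "g \<in> carrier G" "h \<in> carrier G" shows "pdvd p (D (g \<otimes> h) - (D g + chi g * D h))"
proof (rule pdvd_pdvd_uptoI[OF p1])
  fix m
  have "pdvd_upto p (p ^ m) (D (g \<otimes> h) - d m (g \<otimes> h))" using assms by (intro D_pdvd_upto) simp
  moreover have "pdvd_upto p (p ^ m) (d m (g \<otimes> h) - (d m g + (1 + fps_X) ^ s m g * d m h))"
    unfolding phi_mult[OF assms] by (rule pdvd_upto_red)
  moreover have "pdvd_upto p (p ^ m) (d m g + (1 + fps_X) ^ s m g * d m h - (D g + chi g * D h))"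
    using assms by (intro pdvd_upto_add_cong pdvd_upto_mult_cong pdvd_upto_sym[OF D_pdvd_upto] pdvd_upto_sym[OF chi_pdvd_upto])
  ultimately show "pdvd_upto p (p ^ m) (D (g \<otimes> h) - (D g + chi g * D h))" by (blast intro: pdvd_upto_trans)
qed

lemma chi_mult:
  assumes "g \<in> carrier G" "h \<in> carrier G" shows "pdvd p (chi (g \<otimes> h) - chi g * chi h)"
proof (rule pdvd_pdvd_uptoI[OF p1])
  fix m
  have "pdvd_upto p (p ^ m) (chi (g \<otimes> h) - (1 + fps_X) ^ s m (g \<otimes> h))" using assms by (intro chi_pdvd_upto) simp
  moreover have "pdvd_upto p (p ^ m) ((1 + fps_X) ^ s m (g \<otimes> h) - (1 + fps_X) ^ (s m g + s m h))"
    unfolding phi_mult[OF assms] by (intro power_cong_pdvd_upto prime) (simp add: cong_def)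
  moreover have "pdvd_upto p (p ^ m) ((1 + fps_X) ^ (s m g + s m h) - chi g * chi h)"
    unfolding power_add using assms by (intro pdvd_upto_mult_cong pdvd_upto_sym[OF chi_pdvd_upto])
  ultimately show "pdvd_upto p (p ^ m) (chi (g \<otimes> h) - chi g * chi h)" by (blast intro: pdvd_upto_trans)
qed

lemma D_u: "pdvd p (D u - 1)" and chi_u: "pdvd p (chi u - 1)" and D_v: "pdvd p (D v)" and chi_v: "pdvd p (chi v - (1 + fps_X))"
proof -
  have pu: "d m u = red p (p ^ m) 1" "s m u = 0" for m using phi(3)[OF uB] by (simp_all add: d_def s_def gens_def)
  have pv: "d m v = 0" "s m v = 1 mod p ^ m" for m using phi(3)[OF vB] uv by (simp_all add: d_def s_def gens_def)
  show "pdvd p (D u - 1)" by (rule pdvd_pdvd_uptoI[OF p1], rule pdvd_upto_trans[OF D_pdvd_upto[OF uG]], unfold pu, rule pdvd_upto_red)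
  show "pdvd p (chi u - 1)" using chi_pdvd_upto[OF uG, unfolded pu] by (intro pdvd_pdvd_uptoI[OF p1]) simp
  show "pdvd p (D v)" using D_pdvd_upto[OF vG, unfolded pv] by (intro pdvd_pdvd_uptoI[OF p1]) simp
  have "pdvd_upto p (p ^ m) ((1 + fps_X) ^ s m v - (1 + fps_X) ^ 1)" for m
    unfolding pv by (intro power_cong_pdvd_upto prime) (simp add: cong_def)
  then show "pdvd p (chi v - (1 + fps_X))"
    by (intro pdvd_pdvd_uptoI[OF p1] pdvd_upto_trans[OF chi_pdvd_upto[OF vG]]) simp
qed

lemma phi_one: "phi m \<one> = (0, 0)"
proof -
  interpret group_hom G "lampgroup p (p ^ m)" "phi m" by (rule phi_hom)
  show ?thesis using hom_one by (simp add: lampgroup_simps)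
qed

definition N :: "'a set" where "N = {g \<in> carrier G. \<forall>m. phi m g = (0, 0)}"

lemma D_N: "g \<in> N \<Longrightarrow> pdvd p (D g)" and chi_N: "g \<in> N \<Longrightarrow> pdvd p (chi g - 1)"
proof -
  assume g: "g \<in> N"
  then have gG: "g \<in> carrier G" and z: "d m g = 0" "s m g = 0" for m by (simp_all add: N_def d_def s_def)
  show "pdvd p (D g)" using D_pdvd_upto[OF gG, unfolded z] by (intro pdvd_pdvd_uptoI[OF p1]) simp
  show "pdvd p (chi g - 1)" using chi_pdvd_upto[OF gG, unfolded z] by (intro pdvd_pdvd_uptoI[OF p1]) simp
qed

lemma one_N: "\<one> \<in> N" by (simp add: N_def phi_one)

lemmas D_one = D_N[OF one_N] and chi_one = chi_N[OF one_N]

lemma N_normal: "N \<lhd> G"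
proof -
  have "N = (\<Inter>m. kernel G (lampgroup p (p ^ m)) (phi m))"
    by (auto simp: N_def kernel_def lampgroup_simps)
  moreover have n: "kernel G (lampgroup p (p ^ m)) (phi m) \<lhd> G" for m
    by (rule group_hom.normal_kernel[OF phi_hom])
  have "subgroup N G" unfolding calculation
    by (rule subgroups_Inter) (auto intro: normal_imp_subgroup[OF n])
  then show ?thesis
  proof (rule normal_invI)
    fix x h assume "x \<in> carrier G" "h \<in> N"
    then show "x \<otimes> h \<otimes> inv x \<in> N"
      unfolding \<open>N = _\<close> using normal.inv_op_closed2[OF n] by blast
  qed
qed

lemma phi_level_open:
  "openin T {g \<in> carrier G. phi m g = a}" "closedin T {g \<in> carrier G. phi m g = a}"
proof -
  let ?C = "carrier (lampgroup p (p ^ m))"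
  have e: "{g \<in> carrier G. phi m g = a} = {g \<in> topspace T. phi m g \<in> {a} \<inter> ?C}"
    using phi(1)[of m] by (auto simp: topspace_eq hom_def)
  show "openin T {g \<in> carrier G. phi m g = a}"
    unfolding e by (rule openin_continuous_map_preimage[OF phi(2)]) auto
  show "closedin T {g \<in> carrier G. phi m g = a}"
    unfolding e by (rule closedin_continuous_map_preimage[OF phi(2)]) auto
qed

lemma N_closed: "closedin T N"
proof -
  have "N = (\<Inter>m. {g \<in> carrier G. phi m g = (0, 0)})" by (auto simp: N_def)
  moreover have "closedin T (\<Inter>m. {g \<in> carrier G. phi m g = (0, 0)})"
    by (intro closedin_Inter) (auto intro: phi_level_open)
  ultimately show ?thesis by simp
qed

end

section \<open>The limit element\<close>

context free_pro_p_pair begin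

section \<open>The derivation on the kernel of the character\<close>

lemma D_inv:
  assumes "g \<in> carrier G" shows "pdvd p (D (inv g) + chi (inv g) * D g)"
proof -
  have "pdvd p (D (inv g \<otimes> g) - (D (inv g) + chi (inv g) * D g))" using assms by (intro D_mult) auto
  from pdvd_diff[OF D_one this[unfolded l_inv[OF assms]]] show ?thesis by simp
qed

lemma chi_inv:
  assumes "g \<in> carrier G" shows "pdvd p (chi (inv g) * chi g - 1)"
proof -
  have "pdvd p (chi (inv g \<otimes> g) - chi (inv g) * chi g)" using assms by (intro chi_mult) auto
  from pdvd_trans[OF pdvd_sym[OF this] chi_one[folded l_inv[OF assms]]] show ?thesis by simp
qed

text \<open>These elements map into the abelian base of the pro-p lamplighter group, where
  \<open>D\<close> is additive.\<close>

definition chi_trivial :: "'a \<Rightarrow> bool" where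
  "chi_trivial g \<longleftrightarrow> g \<in> carrier G \<and> pdvd p (chi g - 1)"

lemma chi_trivial_mult:
  assumes "chi_trivial g" "chi_trivial h"
  shows "chi_trivial (g \<otimes> h)" "pdvd p (D (g \<otimes> h) - (D g + D h))"
proof -
  have gh: "g \<in> carrier G" "h \<in> carrier G" "pdvd p (chi g - 1)" "pdvd p (chi h - 1)"
    using assms by (auto simp: chi_trivial_def)
  show "chi_trivial (g \<otimes> h)"
    using pdvd_trans[OF chi_mult[OF gh(1,2)] pdvd_mult_cong[OF gh(3,4)]] gh by (simp add: chi_trivial_def)
  have "pdvd p (D g + chi g * D h - (D g + D h))"
    using pdvd_mult_right[OF gh(3), of "D h"] by (simp add: algebra_simps)
  then show "pdvd p (D (g \<otimes> h) - (D g + D h))" by (rule pdvd_trans[OF D_mult[OF gh(1,2)]])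
qed

lemma chi_trivial_inv:
  assumes "chi_trivial g" shows "chi_trivial (inv g)" "pdvd p (D (inv g) + D g)"
proof -
  have g: "g \<in> carrier G" "pdvd p (chi g - 1)" using assms by (auto simp: chi_trivial_def)
  have "pdvd p (chi (inv g) * (chi g - 1))" by (rule pdvd_mult_left[OF g(2)])
  from pdvd_diff[OF chi_inv[OF g(1)] this] have t: "pdvd p (chi (inv g) - 1)" by (simp add: algebra_simps)
  then show "chi_trivial (inv g)" using g by (simp add: chi_trivial_def)
  show "pdvd p (D (inv g) + D g)"
    using pdvd_diff[OF D_inv[OF g(1)] pdvd_mult_right[OF t, of "D g"]] by (simp add: algebra_simps)
qed

lemma chi_trivial_conj:
  assumes c: "c \<in> carrier G" "pdvd p (D c)" and g: "chi_trivial g"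
  shows "chi_trivial (c \<otimes> g \<otimes> inv c)" "pdvd p (D (c \<otimes> g \<otimes> inv c) - chi c * D g)"
proof -
  have gG: "g \<in> carrier G" "pdvd p (chi g - 1)" using g by (auto simp: chi_trivial_def)
  have "pdvd p (chi (c \<otimes> g \<otimes> inv c) - chi c * chi g * chi (inv c))"
    using c gG by (intro pdvd_trans[OF chi_mult pdvd_mult_cong[OF chi_mult]]) auto
  moreover have "pdvd p (chi c * chi g * chi (inv c) - 1)"
  proof -
    have "pdvd p (chi c * chi (inv c) * (chi g - 1) + (chi (inv c) * chi c - 1))"
      by (intro pdvd_add pdvd_mult_left gG chi_inv c)
    then show ?thesis by (simp add: algebra_simps)
  qed
  ultimately show "chi_trivial (c \<otimes> g \<otimes> inv c)" using c gG unfolding chi_trivial_def by (auto intro: pdvd_trans)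
  have Dc: "pdvd p (D (inv c))"
    using pdvd_diff[OF D_inv[OF c(1)] pdvd_mult_left[OF c(2), of "chi (inv c)"]] by simp
  have "pdvd p (D (c \<otimes> g \<otimes> inv c) - (D (c \<otimes> g) + chi (c \<otimes> g) * D (inv c)))"
    using c gG by (intro D_mult) auto
  moreover have "pdvd p (D (c \<otimes> g) + chi (c \<otimes> g) * D (inv c) - chi c * D g)"
  proof -
    have "pdvd p ((D (c \<otimes> g) - (D c + chi c * D g)) + D c + chi (c \<otimes> g) * D (inv c))"
      using c gG by (intro pdvd_add pdvd_mult_left Dc D_mult)
    then show ?thesis by (simp add: algebra_simps)
  qed
  ultimately show "pdvd p (D (c \<otimes> g \<otimes> inv c) - chi c * D g)" by (rule pdvd_trans)
qed

lemma chi_trivial_u: "chi_trivial u" using chi_u by (simp add: chi_trivial_def)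
lemma chi_trivial_one: "chi_trivial \<one>" using chi_one by (simp add: chi_trivial_def)

lemma v_pow: "pdvd p (D (v [^] (n::nat)))" "pdvd p (chi (v [^] (n::nat)) - (1 + fps_X) ^ n)"
proof (induction n)
  case 0
  { case 1 then show ?case using D_one by simp }
  { case 2 then show ?case using chi_one by simp }
next
  case (Suc n)
  have G: "v [^] n \<in> carrier G" by simp
  { case 1
    show ?case using pdvd_add[OF D_mult[OF G vG] pdvd_add[OF Suc(1) pdvd_mult_left[OF D_v, of "chi (v [^] n)"]]] by simp }
  { case 2
    show ?case using pdvd_trans[OF chi_mult[OF G vG] pdvd_mult_cong[OF Suc(2) chi_v]] by (simp add: mult.commute) }
qed

definition vpow :: "nat \<Rightarrow> 'a" where "vpow i = v [^] (p ^ i)"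
text \<open>\<open>D\<close> takes it to the measure with weight \<open>1\<close> at
  \<open>p^i\<close> and at \<open>-p^i\<close> and weight \<open>-2\<close> at \<open>0\<close>.
  The balance at \<open>0\<close> makes these series tend to \<open>0\<close>; the pairing of the
  two conjugates is what \<open>u_bseq\<close> uses.\<close>

definition factor :: "nat \<Rightarrow> 'a" where
  "factor i = (vpow i \<otimes> u \<otimes> inv (vpow i)) \<otimes> (inv (vpow i) \<otimes> u \<otimes> vpow i) \<otimes> inv u \<otimes> inv u"

lemma vpow_closed [simp]: "vpow i \<in> carrier G" by (simp add: vpow_def)
lemma factor_closed [simp]: "factor i \<in> carrier G" by (simp add: factor_def)

lemma D_inv_vpow: "pdvd p (D (inv (vpow i)))"
  using pdvd_diff[OF D_inv[OF vpow_closed[of i]] pdvd_mult_left[OF v_pow(1)[of "p ^ i", folded vpow_def], of "chi (inv (vpow i))"]]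
  by simp

lemma factor_D: "chi_trivial (factor i)" "pdvd p (D (factor i) - (chi (vpow i) + chi (inv (vpow i)) - 2))"
proof -
  let ?a = "vpow i \<otimes> u \<otimes> inv (vpow i)" and ?b = "inv (vpow i) \<otimes> u \<otimes> vpow i"
  note a = chi_trivial_conj[OF vpow_closed v_pow(1)[of "p ^ i", folded vpow_def] chi_trivial_u]
  note b = chi_trivial_conj[OF inv_closed[OF vpow_closed] D_inv_vpow chi_trivial_u, of i, simplified]
  note c = chi_trivial_inv[OF chi_trivial_u]
  note ab = chi_trivial_mult[OF a(1) b(1)]
  note abc = chi_trivial_mult[OF ab(1) c(1)]
  note abcc = chi_trivial_mult[OF abc(1) c(1)]
  show "chi_trivial (factor i)" unfolding factor_def by (rule abcc(1))
  have Du: "pdvd p (x * D u - x)" for x using pdvd_mult_left[OF D_u, of x] by (simp add: algebra_simps)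
  have "pdvd p ((D (factor i) - (D (?a \<otimes> ?b \<otimes> inv u) + D (inv u))) + (D (?a \<otimes> ?b \<otimes> inv u) - (D (?a \<otimes> ?b) + D (inv u)))
     + (D (?a \<otimes> ?b) - (D ?a + D ?b)) + (D ?a - chi (vpow i) * D u) + (D ?b - chi (inv (vpow i)) * D u)
     + (chi (vpow i) * D u - chi (vpow i)) + (chi (inv (vpow i)) * D u - chi (inv (vpow i)))
     + (D (inv u) + D u) + (D (inv u) + D u) - (D u - 1) - (D u - 1))"
    unfolding factor_def by (intro pdvd_add pdvd_diff abcc(2) abc(2) ab(2) a(2) b(2) c(2) Du D_u)
  then show "pdvd p (D (factor i) - (chi (vpow i) + chi (inv (vpow i)) - 2))" by (simp add: algebra_simps)
qed

lemma chi_vpow: "pdvd p (chi (vpow i) - (1 + fps_X) ^ (p ^ i))"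
  unfolding vpow_def by (rule v_pow)

lemma chi_inv_vpow:
  assumes "i \<le> m" shows "pdvd_upto p (p ^ m) (chi (inv (vpow i)) - (1 + fps_X) ^ (p ^ m - p ^ i))"
proof -
  let ?x = "chi (inv (vpow i))" and ?a = "(1 + fps_X :: int fps) ^ (p ^ i)" and ?b = "(1 + fps_X :: int fps) ^ (p ^ m - p ^ i)"
  have "p ^ i \<le> p ^ m" using assms p1 by (simp add: power_increasing)
  then have ab: "pdvd_upto p (p ^ m) (?a * ?b - 1)"
    using one_plus_X_power_prime_power[OF prime, of m 1] by (simp flip: power_add)
  have "pdvd p (?x * chi (vpow i) - 1)" by (intro chi_inv) simp
  then have 1: "pdvd p (?x * ?a - 1)" using pdvd_diff[of p "?x * chi (vpow i) - 1" "?x * (chi (vpow i) - ?a)"] pdvd_mult_left[OF chi_vpow, of ?x]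
    by (simp add: algebra_simps)
  \<comment> \<open>The expression equals \<open>x - b\<close>: two inverses of \<open>a\<close>
    agree.\<close>
  have "pdvd_upto p (p ^ m) ((?x * ?a - 1) * ?b - ?x * (?a * ?b - 1))"
    by (rule pdvd_upto_diff[OF pdvd_upto_mult_right pdvd_upto_mult_left[OF ab]]) (use 1 in \<open>simp add: pdvd_iff_pdvd_upto\<close>)
  then show ?thesis by (simp add: algebra_simps)
qed

definition factor_series :: "nat \<Rightarrow> int fps" where "factor_series i = chi (vpow i) + chi (inv (vpow i)) - 2"

lemma factor_series_small:
  assumes "i < m" shows "pdvd_upto p (p ^ m) (factor_series i - ((1 + fps_X) ^ (p ^ i) + (1 + fps_X) ^ (p ^ m - p ^ i) - 2))"
proof -
  have "pdvd_upto p (p ^ m) ((chi (vpow i) - (1 + fps_X) ^ (p ^ i)) + (chi (inv (vpow i)) - (1 + fps_X) ^ (p ^ m - p ^ i)))"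
    using assms by (intro pdvd_upto_add chi_inv_vpow) (use chi_vpow[of i] in \<open>simp_all add: pdvd_iff_pdvd_upto\<close>)
  then show ?thesis by (simp add: factor_series_def algebra_simps)
qed

text \<open>Both powers are congruent to \<open>1\<close> modulo \<open>p\<close> and
  \<open>X^(p^i)\<close>, which the weight \<open>-2\<close> cancels. For the inverse this is
  \<open>chi_inv_vpow\<close> at level \<open>i\<close>, where the exponent is
  \<open>0\<close>.\<close>

lemma factor_series_large:
  assumes "m \<le> i" shows "pdvd_upto p (p ^ m) (factor_series i)"
proof -
  have le: "p ^ m \<le> p ^ i" using assms p1 by (simp add: power_increasing)
  have "pdvd_upto p (p ^ i) ((chi (vpow i) - (1 + fps_X) ^ (p ^ i)) + (chi (inv (vpow i)) - (1 + fps_X) ^ (p ^ i - p ^ i))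
      + ((1 + fps_X) ^ (p ^ i * 1) - 1))"
    by (intro pdvd_upto_add chi_inv_vpow one_plus_X_power_prime_power prime) (use chi_vpow[of i] in \<open>simp_all add: pdvd_iff_pdvd_upto\<close>)
  then have "pdvd_upto p (p ^ i) (factor_series i)" by (simp add: factor_series_def algebra_simps)
  then show ?thesis by (rule pdvd_upto_mono[OF _ le])
qed

primrec bseq :: "nat set \<Rightarrow> nat \<Rightarrow> 'a" where
  "bseq I 0 = \<one>"
| "bseq I (Suc k) = (if k \<in> I then bseq I k \<otimes> factor k else bseq I k)"

lemma bseq_D: "chi_trivial (bseq I k)" "pdvd p (D (bseq I k) - (\<Sum>i\<in>I \<inter> {..<k}. factor_series i))"
proof (induction k)
  case 0
  { case 1 then show ?case using chi_trivial_one by simp }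
  { case 2 then show ?case using D_one by simp }
next
  case (Suc k)
  note m = chi_trivial_mult[OF Suc(1) factor_D(1)[of k]]
  { case 1 then show ?case using m(1) Suc by simp }
  { case 2
    show ?case
    proof (cases "k \<in> I")
      case True
      have "I \<inter> {..<Suc k} = insert k (I \<inter> {..<k})" using True by auto
      then have s: "(\<Sum>i\<in>I \<inter> {..<Suc k}. factor_series i) = factor_series k + (\<Sum>i\<in>I \<inter> {..<k}. factor_series i)" by simp
      have "pdvd p ((D (bseq I k \<otimes> factor k) - (D (bseq I k) + D (factor k))) + (D (bseq I k) - (\<Sum>i\<in>I \<inter> {..<k}. factor_series i))
          + (D (factor k) - factor_series k))"
        unfolding factor_series_def by (intro pdvd_add m(2) factor_D(2) Suc(2)[unfolded factor_series_def])
      then show ?thesis using True unfolding s by (simp add: algebra_simps)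
    next
      case False
      then have "I \<inter> {..<Suc k} = I \<inter> {..<k}" using less_antisym by fastforce
      then show ?thesis using Suc(2) False by simp
    qed }
qed

lemma bseq_closed [simp]: "bseq I k \<in> carrier G" by (induction k) auto

text \<open>Factors with index at least \<open>m\<close> contribute nothing modulo \<open>p\<close>
  and \<open>X^(p^m)\<close>.\<close>

lemma bseq_atom_series:
  assumes "m \<le> k" shows "pdvd_upto p (p ^ m) (D (bseq I k) - atom_series p I (\<lambda>_. 1) m)"
proof -
  have "I \<inter> {..<k} = (I \<inter> {..<m}) \<union> (I \<inter> {m..<k})" using assms by auto
  then have s: "(\<Sum>i\<in>I \<inter> {..<k}. factor_series i) = (\<Sum>i\<in>I \<inter> {..<m}. factor_series i) + (\<Sum>i\<in>I \<inter> {m..<k}. factor_series i)"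
    by (simp add: sum.union_disjoint[of "I \<inter> {..<m}" "I \<inter> {m..<k}"] disjoint_iff)
  have 1: "pdvd_upto p (p ^ m) (\<Sum>i\<in>I \<inter> {m..<k}. factor_series i)" by (intro pdvd_upto_sum factor_series_large) auto
  have 2: "pdvd_upto p (p ^ m) ((\<Sum>i\<in>I \<inter> {..<m}. factor_series i) - atom_series p I (\<lambda>_. 1) m)"
    unfolding atom_series_def sum_subtractf[symmetric] using factor_series_small by (intro pdvd_upto_sum) auto
  have 3: "pdvd_upto p (p ^ m) (D (bseq I k) - (\<Sum>i\<in>I \<inter> {..<k}. factor_series i))"
    using bseq_D(2) by (simp add: pdvd_iff_pdvd_upto)
  from pdvd_upto_add[OF pdvd_upto_add[OF 3 1] 2] show ?thesis unfolding s by (simp add: algebra_simps)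
qed

section \<open>Commutators of u with the limit element\<close>

lemma snd_phi_conj:
  assumes "x \<in> carrier G" "h \<in> carrier G" "s m h = 0"
  shows "s m (x \<otimes> h \<otimes> inv x) = 0"
proof -
  have "s m \<one> = 0" using phi_one by (simp add: s_def)
  then have "(s m x + s m (inv x)) mod p ^ m = 0" using phi_mult(2)[of x "inv x" m] assms(1) by simp
  moreover have "s m (x \<otimes> h \<otimes> inv x) = (s m x + s m (inv x)) mod p ^ m"
    using assms by (simp add: phi_mult(2) mod_add_left_eq)
  ultimately show ?thesis by simp
qed

lemma is_group_G: "Group.group G" by (rule group_axioms)

text \<open>Both elements map into the abelian base at every level, so their commutator maps to the
  identity.\<close>

lemma gcomm_in_N:
  assumes g: "g \<in> carrier G" "\<And>m. s m g = 0" and h: "h \<in> carrier G" "\<And>m. s m h = 0"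
  shows "gcomm G g h \<in> N"
proof -
  have "phi m (gcomm G g h) = (0, 0)" for m
  proof -
    interpret group_hom G "lampgroup p (p ^ m)" "phi m" by (rule phi_hom)
    have e: "phi m g = (d m g, 0)" "phi m h = (d m h, 0)" using g(2)[of m] h(2)[of m] by (simp_all add: d_def s_def prod_eq_iff)
    have "phi m g \<otimes>\<^bsub>lampgroup p (p ^ m)\<^esub> phi m h = phi m h \<otimes>\<^bsub>lampgroup p (p ^ m)\<^esub> phi m g"
      unfolding e lampgroup_simps by (simp add: add.commute)
    then have "gcomm (lampgroup p (p ^ m)) (phi m g) (phi m h) = \<one>\<^bsub>lampgroup p (p ^ m)\<^esub>"
      using g(1) h(1) by (simp add: H.gcomm_eq_one_iff)
    then show ?thesis using gcomm_hom[OF is_group_G group_lamp phi(1) g(1) h(1)]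
      by (simp add: lampgroup_simps)
  qed
  then show ?thesis using g(1) h(1) by (simp add: N_def)
qed

lemma u_bseq: "gcomm G u (bseq I k) \<in> commsub G N"
proof -
  let ?M = "commsub G N"
  interpret M: normal ?M G by (rule commsub_normal[OF N_normal])
  have mult: "gcomm G u (g \<otimes> h) \<in> ?M"
    if "g \<in> carrier G" "h \<in> carrier G" "gcomm G u g \<in> ?M" "gcomm G u h \<in> ?M" for g h
    using that M.inv_op_closed2[OF that(1,4)] by (simp add: gcomm_mult_right)
  have "gcomm G u (inv u) = \<one>" by (simp add: gcomm_def)
  then have iu: "gcomm G u (inv u) \<in> ?M" using M.one_closed by simp
  have factorM: "gcomm G u (factor i) \<in> ?M" for i
  proof -
    let ?c = "vpow i"
    let ?a = "?c \<otimes> u \<otimes> inv ?c" and ?b = "inv ?c \<otimes> u \<otimes> ?c"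
    have su: "s m u = 0" for m using phi(3)[OF uB, of m] by (simp add: s_def gens_def)
    have n: "gcomm G u ?a \<in> N" by (intro gcomm_in_N su snd_phi_conj) auto
    \<comment> \<open>Conjugation by \<open>c^-1\<close> takes \<open>u\<close> to \<open>b\<close>
      and \<open>a\<close> to \<open>u\<close>, hence \<open>[a, u]\<close> to
      \<open>[u, b]\<close>. So \<open>[u, a b] = [u, a] a [u, b] a^-1\<close> is the commutator of
      \<open>[u, a]\<close> with \<open>a c^-1\<close>.\<close>
    have "gcomm G u (?a \<otimes> ?b) = gcomm G (gcomm G u ?a) (?a \<otimes> inv ?c)"
      by (simp add: gcomm_def m_assoc inv_mult_group)
    also have "\<dots> \<in> ?M" unfolding commsub_def
      by (rule generate.incl, rule CollectI, intro exI conjI, rule refl, rule n, simp)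
    finally have "gcomm G u (?a \<otimes> ?b) \<in> ?M" .
    then show ?thesis unfolding factor_def by (intro mult[OF _ _ mult[OF _ _ _ iu] iu]) auto
  qed
  show ?thesis
  proof (induction k)
    case 0
    have "gcomm G u \<one> = \<one>" by (simp add: gcomm_def)
    then show ?case using M.one_closed by simp
  next
    case (Suc k)
    show ?case
    proof (cases "k \<in> I")
      case True
      then show ?thesis using mult[OF bseq_closed factor_closed Suc factorM] by simp
    next
      case False then show ?thesis using Suc by simp
    qed
  qed
qed

text \<open>Compactness gives a cluster point, which is enough: \<open>phi m\<close> is locally
  constant, and a closed set containing the sequence contains its cluster points.\<close>

lemma bseq_limit_exists:
  "\<exists>b\<in>carrier G. (\<forall>m. pdvd_upto p (p ^ m) (D b - atom_series p I (\<lambda>_. 1) m)) \<and>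
     (\<forall>C. closedin T C \<longrightarrow> (\<forall>k. bseq I k \<in> C) \<longrightarrow> b \<in> C)"
proof -
  have comp: "compact_space T" using profinite by (simp add: profinite_group_def)
  define C where "C n = T closure_of {bseq I k | k. n \<le> k}" for n
  have "(\<Inter>n. C n) \<noteq> {}"
  proof (rule compact_space_imp_nest[OF comp])
    show "closedin T (C n)" for n by (simp add: C_def)
    have "bseq I n \<in> C n" for n
      unfolding C_def by (rule subsetD[OF closure_of_subset]) (auto simp: topspace_eq)
    then show "C n \<noteq> {}" for n by blast
    show "decseq C" unfolding decseq_def C_def by (auto intro!: closure_of_mono)
  qed
  then obtain b where b: "\<And>n. b \<in> C n" by blast
  have bG: "b \<in> carrier G" using b[of 0] closure_of_subset_topspace[of T] unfolding C_def topspace_eq by blast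
  have "pdvd_upto p (p ^ m) (D b - atom_series p I (\<lambda>_. 1) m)" for m
  proof -
    let ?U = "{g \<in> carrier G. phi m g = phi m b}"
    \<comment> \<open>The fibre of \<open>phi m\<close> through \<open>b\<close> is open, so it
      contains a term of the sequence of index at least \<open>m\<close>.\<close>
    have "\<forall>U. b \<in> U \<and> openin T U \<longrightarrow> (\<exists>y. y \<in> {bseq I k | k. m \<le> k} \<and> y \<in> U)"
      using b[of m] unfolding C_def in_closure_of by (rule conjunct2)
    from spec[OF this, of ?U] obtain g where g: "g \<in> {bseq I k | k. m \<le> k}" "g \<in> ?U"
      using phi_level_open(1)[of m "phi m b"] bG by auto
    then obtain k where k: "m \<le> k" "phi m (bseq I k) = phi m b" by auto
    have "pdvd_upto p (p ^ m) ((D b - d m b) - (D (bseq I k) - d m (bseq I k)) + (D (bseq I k) - atom_series p I (\<lambda>_. 1) m))"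
      by (intro pdvd_upto_add pdvd_upto_diff D_pdvd_upto bG bseq_atom_series k(1)) simp
    then show ?thesis using k(2) by (simp add: d_def)
  qed
  moreover have "b \<in> Y" if "closedin T Y" "\<forall>k. bseq I k \<in> Y" for Y
  proof -
    have "C 0 \<subseteq> Y" unfolding C_def by (rule closure_of_minimal[OF _ that(1)]) (use that(2) in auto)
    then show ?thesis using b[of 0] by blast
  qed
  ultimately show ?thesis using bG by blast
qed

text \<open>That \<open>[u, g]\<close> lies in \<open>commprods G N xs\<close> is a closed condition
  on \<open>g\<close>; it holds along the sequence and therefore for \<open>b\<close>.\<close>

lemma exists_limit_element:
  assumes xs: "set xs = B"
  shows "\<exists>b\<in>carrier G. (\<forall>m. pdvd_upto p (p ^ m) (D b - atom_series p I (\<lambda>_. 1) m)) \<and> gcomm G u b \<in> commprods G N xs"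
proof -
  obtain b where b: "b \<in> carrier G" "\<forall>m. pdvd_upto p (p ^ m) (D b - atom_series p I (\<lambda>_. 1) m)"
    "\<forall>C. closedin T C \<longrightarrow> (\<forall>k. bseq I k \<in> C) \<longrightarrow> b \<in> C" using bseq_limit_exists by blast
  have comp: "compact_space T" "Hausdorff_space T" using profinite by (simp_all add: profinite_group_def)
  have cl: "closedin T (commprods G N xs)"
    by (rule compactin_imp_closedin[OF comp(2) commprods_compact[OF closedin_compact_space[OF comp(1) N_closed]]])
      (use xs basis_subset in simp)
  have c: "continuous_map T T (\<lambda>g. gcomm G u g)" by (intro cont_gcomm cont_const) auto
  have "closedin T {g \<in> topspace T. gcomm G u g \<in> commprods G N xs}"
    by (rule closedin_continuous_map_preimage[OF c cl])
  moreover have "bseq I k \<in> {g \<in> topspace T. gcomm G u g \<in> commprods G N xs}" for k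
    using u_bseq commsub_subset_commprods[OF xs N_normal N_closed] by (auto simp: topspace_eq)
  ultimately have "b \<in> {g \<in> topspace T. gcomm G u g \<in> commprods G N xs}" using b(3) by blast
  then show ?thesis using b(1,2) by blast
qed

end

section \<open>Chains\<close>

definition supp :: "('w \<Rightarrow> int) \<Rightarrow> 'w set" where "supp c = {y. c y \<noteq> 0}"

definition lin :: "('w \<Rightarrow> 'r::comm_ring_1) \<Rightarrow> ('w \<Rightarrow> int) \<Rightarrow> 'r" where
  "lin f c = (\<Sum>y\<in>supp c. of_int (c y) * f y)"

definition unit_chain :: "'w \<Rightarrow> 'w \<Rightarrow> int" where "unit_chain w y = (if y = w then 1 else 0)"

lemma fin_chain_supp: "fin_chain c S \<longleftrightarrow> finite (supp c) \<and> supp c \<subseteq> S"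
  by (simp add: fin_chain_def supp_def)

lemma lin_superset: "finite S \<Longrightarrow> supp c \<subseteq> S \<Longrightarrow> lin f c = (\<Sum>y\<in>S. of_int (c y) * f y)"
  unfolding lin_def by (rule sum.mono_neutral_left) (auto simp: supp_def)

lemma supp_add: "supp (\<lambda>y. c y + c' y) \<subseteq> supp c \<union> supp c'"
  and supp_diff: "supp (\<lambda>y. c y - c' y) \<subseteq> supp c \<union> supp c'"
  by (auto simp: supp_def)

lemma fin_chain_add: "fin_chain c S \<Longrightarrow> fin_chain c' S \<Longrightarrow> fin_chain (\<lambda>y. c y + c' y) S"
  and fin_chain_diff: "fin_chain c S \<Longrightarrow> fin_chain c' S \<Longrightarrow> fin_chain (\<lambda>y. c y - c' y) S"
  unfolding fin_chain_supp using supp_add[of c c'] supp_diff[of c c']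
  by (meson finite_UnI finite_subset le_sup_iff order_trans sup_least)+

lemma fin_chain_unit: "w \<in> S \<Longrightarrow> fin_chain (unit_chain w) S"
  by (auto simp: fin_chain_def unit_chain_def)

lemma lin_add:
  assumes "fin_chain c S" "fin_chain c' S"
  shows "lin f (\<lambda>y. c y + c' y) = lin f c + lin f c'"
proof -
  have "finite (supp c \<union> supp c')" using assms by (simp add: fin_chain_supp)
  then show ?thesis
    using lin_superset[of "supp c \<union> supp c'" c f] lin_superset[of "supp c \<union> supp c'" c' f]
      lin_superset[OF _ supp_add, of c c' f]
    by (simp add: sum.distrib distrib_right)
qed

lemma lin_diff:
  assumes "fin_chain c S" "fin_chain c' S"
  shows "lin f (\<lambda>y. c y - c' y) = lin f c - lin f c'"
proof -
  have "finite (supp c \<union> supp c')" using assms by (simp add: fin_chain_supp)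
  then show ?thesis
    using lin_superset[of "supp c \<union> supp c'" c f] lin_superset[of "supp c \<union> supp c'" c' f]
      lin_superset[OF _ supp_diff, of c c' f]
    by (simp add: sum_subtractf left_diff_distrib)
qed

lemma lin_unit: "lin f (unit_chain w) = f w"
  using lin_superset[of "{w}" "unit_chain w" f] by (simp add: supp_def unit_chain_def)

section \<open>Boundary maps of the bar complex\<close>

definition dface :: "('a, 'b) monoid_scheme \<Rightarrow> 'a \<Rightarrow> 'a \<times> 'a \<Rightarrow> int" where
  "dface G x gh = (if snd gh = x then 1 else 0) - (if fst gh \<otimes>\<^bsub>G\<^esub> snd gh = x then 1 else 0)
       + (if fst gh = x then 1 else 0)"

lemma bar_d2_eq_lin: "bar_d2 G c x = lin (dface G x) c"
  by (simp add: bar_d2_def lin_def supp_def dface_def)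

text \<open>Boundary and coboundary are adjoint: evaluating \<open>f\<close> on the boundary of
  \<open>e\<close> evaluates its coboundary on \<open>e\<close>. The set \<open>S\<close> in the
  proof collects all faces of the cells of \<open>e\<close>.\<close>

lemma lin_bar_d3:
  fixes f :: "'a \<times> 'a \<Rightarrow> 'r::comm_ring_1"
  assumes e: "finite (supp e)"
  shows "finite (supp (bar_d3 G e))"
    and "lin f (bar_d3 G e) = (\<Sum>(g, h, k)\<in>supp e. of_int (e (g, h, k)) *
      (f (h, k) - f (g \<otimes>\<^bsub>G\<^esub> h, k) + f (g, h \<otimes>\<^bsub>G\<^esub> k) - f (g, h)))"
proof -
  define S where "S = (\<Union>(g, h, k)\<in>supp e. {(h, k), (g \<otimes>\<^bsub>G\<^esub> h, k), (g, h \<otimes>\<^bsub>G\<^esub> k), (g, h)})"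
  have S: "finite S" unfolding S_def using e by (auto intro!: finite_UN_I)
  have z: "bar_d3 G e y = 0" if "y \<notin> S" for y
    unfolding bar_d3_def by (rule sum.neutral) (use that in \<open>auto simp: S_def supp_def\<close>)
  then have sub: "supp (bar_d3 G e) \<subseteq> S" by (auto simp: supp_def)
  then show "finite (supp (bar_d3 G e))" using S finite_subset by blast
  have del: "(\<Sum>y\<in>S. (if a = y then 1 else 0) * f y) = f a" if "a \<in> S" for a
    using S that by (simp add: if_distrib[of "\<lambda>x. x * _"] sum.delta' cong: if_cong)
  have "lin f (bar_d3 G e) = (\<Sum>y\<in>S. of_int (bar_d3 G e y) * f y)" by (rule lin_superset[OF S sub])
  also have "\<dots> = (\<Sum>y\<in>S. \<Sum>(g, h, k)\<in>supp e. of_int (e (g, h, k)) *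
      ((if (h, k) = y then 1 else 0) * f y - (if (g \<otimes>\<^bsub>G\<^esub> h, k) = y then 1 else 0) * f y
       + (if (g, h \<otimes>\<^bsub>G\<^esub> k) = y then 1 else 0) * f y - (if (g, h) = y then 1 else 0) * f y))"
    unfolding bar_d3_def supp_def[symmetric] of_int_sum sum_distrib_right
    by (intro sum.cong refl) (auto simp: algebra_simps)
  also have "\<dots> = (\<Sum>(g, h, k)\<in>supp e. of_int (e (g, h, k)) *
      ((\<Sum>y\<in>S. (if (h, k) = y then 1 else 0) * f y) - (\<Sum>y\<in>S. (if (g \<otimes>\<^bsub>G\<^esub> h, k) = y then 1 else 0) * f y)
       + (\<Sum>y\<in>S. (if (g, h \<otimes>\<^bsub>G\<^esub> k) = y then 1 else 0) * f y) - (\<Sum>y\<in>S. (if (g, h) = y then 1 else 0) * f y)))"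
    by (subst sum.swap) (intro sum.cong refl, simp only: case_prod_beta sum_distrib_left sum_subtractf sum.distrib distrib_left right_diff_distrib)
  also have "\<dots> = (\<Sum>(g, h, k)\<in>supp e. of_int (e (g, h, k)) *
      (f (h, k) - f (g \<otimes>\<^bsub>G\<^esub> h, k) + f (g, h \<otimes>\<^bsub>G\<^esub> k) - f (g, h)))"
  proof (intro sum.cong refl, clarify)
    fix g h k assume "(g, h, k) \<in> supp e"
    then have "(h, k) \<in> S" "(g \<otimes>\<^bsub>G\<^esub> h, k) \<in> S" "(g, h \<otimes>\<^bsub>G\<^esub> k) \<in> S" "(g, h) \<in> S" unfolding S_def by force+
    then show "of_int (e (g, h, k)) * ((\<Sum>y\<in>S. (if (h, k) = y then 1 else 0) * f y) - (\<Sum>y\<in>S. (if (g \<otimes>\<^bsub>G\<^esub> h, k) = y then 1 else 0) * f y)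
       + (\<Sum>y\<in>S. (if (g, h \<otimes>\<^bsub>G\<^esub> k) = y then 1 else 0) * f y) - (\<Sum>y\<in>S. (if (g, h) = y then 1 else 0) * f y))
      = of_int (e (g, h, k)) * (f (h, k) - f (g \<otimes>\<^bsub>G\<^esub> h, k) + f (g, h \<otimes>\<^bsub>G\<^esub> k) - f (g, h))"
      by (simp only: del)
  qed
  finally show "lin f (bar_d3 G e) = (\<Sum>(g, h, k)\<in>supp e. of_int (e (g, h, k)) *
      (f (h, k) - f (g \<otimes>\<^bsub>G\<^esub> h, k) + f (g, h \<otimes>\<^bsub>G\<^esub> k) - f (g, h)))" .
qed

text \<open>The first two cells have boundary \<open>y x - x y\<close>; since
  \<open>x y = [x, y] (y x)\<close>, the third turns this into \<open>-[x, y]\<close>.\<close>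

definition comm_chain :: "('a, 'b) monoid_scheme \<Rightarrow> 'a \<Rightarrow> 'a \<Rightarrow> 'a \<times> 'a \<Rightarrow> int" where
  "comm_chain G x y = (\<lambda>z. unit_chain (x, y) z - unit_chain (y, x) z
     - unit_chain (gcomm G x y, y \<otimes>\<^bsub>G\<^esub> x) z)"

lemma (in group) comm_chain:
  assumes "x \<in> carrier G" "y \<in> carrier G"
  shows "fin_chain (comm_chain G x y) (carrier G \<times> carrier G)"
    and "lin f (comm_chain G x y) = f (x, y) - f (y, x) - f (gcomm G x y, y \<otimes> x)"
    and "bar_d2 G (comm_chain G x y) z = - (if gcomm G x y = z then 1 else 0)"
proof -
  let ?S = "carrier G \<times> carrier G"
  have u: "fin_chain (unit_chain (x, y)) ?S" "fin_chain (unit_chain (y, x)) ?S"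
      "fin_chain (unit_chain (gcomm G x y, y \<otimes> x)) ?S"
    using assms by (auto intro!: fin_chain_unit)
  note d = fin_chain_diff[OF u(1,2)]
  show "fin_chain (comm_chain G x y) ?S" unfolding comm_chain_def by (rule fin_chain_diff[OF d u(3)])
  have l: "lin f (comm_chain G x y) = f (x, y) - f (y, x) - f (gcomm G x y, y \<otimes> x)" for f :: "'a \<times> 'a \<Rightarrow> 'r::comm_ring_1"
    unfolding comm_chain_def by (simp add: lin_diff[OF d u(3)] lin_diff[OF u(1,2)] lin_unit)
  show "lin f (comm_chain G x y) = f (x, y) - f (y, x) - f (gcomm G x y, y \<otimes> x)" by (rule l)
  have "gcomm G x y \<otimes> (y \<otimes> x) = x \<otimes> y" using assms by (simp add: gcomm_def m_assoc)
  then show "bar_d2 G (comm_chain G x y) z = - (if gcomm G x y = z then 1 else 0)"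
    unfolding bar_d2_eq_lin l by (simp add: dface_def)
qed

text \<open>The chain is assembled from cells that each have an entry in \<open>N\<close>, so every
  \<open>F i\<close> vanishes on it modulo \<open>p\<close>, while its boundary is the 1-cell
  \<open>y\<close>.\<close>

lemma (in group) commprods_chain:
  fixes F :: "'i \<Rightarrow> 'a \<times> 'a \<Rightarrow> int fps"
  assumes N: "N \<lhd> G" and xs: "set xs \<subseteq> carrier G"
    and F: "\<And>i n g. n \<in> N \<Longrightarrow> g \<in> carrier G \<Longrightarrow> pdvd p (F i (n, g))" "\<And>i n g. n \<in> N \<Longrightarrow> g \<in> carrier G \<Longrightarrow> pdvd p (F i (g, n))"
    and y: "y \<in> commprods G N xs"
  shows "\<exists>C. fin_chain C (carrier G \<times> carrier G) \<and> (\<forall>z. bar_d2 G C z = (if y = z then 1 else 0))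
     \<and> (\<forall>i. pdvd p (lin (F i) C))"
  using xs y
proof (induction xs arbitrary: y)
  case Nil
  then have y: "y = \<one>" by simp
  have "\<one> \<in> N" using normal_imp_subgroup[OF N] by (rule subgroup.one_closed)
  \<comment> \<open>The degenerate cell on \<open>(\<one>, \<one>)\<close> has boundary
    \<open>\<one>\<close>.\<close>
  then show ?case
    by (intro exI[of _ "unit_chain (\<one>, \<one>)"]) (auto simp: y bar_d2_eq_lin lin_unit dface_def fin_chain_unit F)
next
  case (Cons x xs)
  interpret N: normal N G by (rule N)
  obtain n t where nt: "y = gcomm G n x \<otimes> t" "n \<in> N" "t \<in> commprods G N xs" using Cons.prems(2) by auto
  have G: "x \<in> carrier G" "n \<in> carrier G" "set xs \<subseteq> carrier G" using Cons.prems nt by auto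
  have tN: "t \<in> N" using commprods_in_normal[OF N G(3)] nt(3) by blast
  have kN: "gcomm G n x \<in> N"
  proof -
    have "gcomm G n x = n \<otimes> (x \<otimes> inv n \<otimes> inv x)" using G by (simp add: gcomm_def m_assoc)
    then show ?thesis using nt(2) G N.inv_op_closed2 by auto
  qed
  let ?S = "carrier G \<times> carrier G"
  obtain C where C: "fin_chain C ?S" "\<And>z. bar_d2 G C z = (if t = z then 1 else 0)" "\<And>i. pdvd p (lin (F i) C)"
    using Cons.IH[OF G(3) nt(3)] by blast
  note cc = comm_chain[OF G(2,1)]
  let ?u = "unit_chain (gcomm G n x, t)"
  have u: "fin_chain ?u ?S" using kN tN by (intro fin_chain_unit) auto
  note d = fin_chain_diff[OF C(1) cc(1)]
  \<comment> \<open>With \<open>k = [n, x]\<close>, subtracting \<open>comm_chain\<close> adds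
    \<open>k\<close> to the boundary \<open>t\<close> of \<open>C\<close>, and subtracting the cell
    \<open>(k, t)\<close> turns \<open>t + k\<close> into \<open>k t = y\<close>.\<close>
  let ?C = "\<lambda>z. C z - comm_chain G n x z - ?u z"
  have l: "lin f ?C = lin f C - lin f (comm_chain G n x) - f (gcomm G n x, t)" for f :: "'a \<times> 'a \<Rightarrow> 'r::comm_ring_1"
    unfolding lin_diff[OF d u] lin_diff[OF C(1) cc(1)] lin_unit ..
  show ?case
  proof (intro exI[of _ ?C] conjI allI)
    show "fin_chain ?C ?S" by (rule fin_chain_diff[OF d u])
    fix z show "bar_d2 G ?C z = (if y = z then 1 else 0)"
      unfolding bar_d2_eq_lin l unfolding bar_d2_eq_lin[symmetric] C(2) cc(3)
      by (simp add: dface_def nt(1))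
  next
    fix i show "pdvd p (lin (F i) ?C)" unfolding l cc(2)
      using G nt(2) tN kN N.subset by (intro pdvd_diff C(3) F) auto
  qed
qed

text \<open>The series \<open>(1 + X)^-1 - 1\<close>.\<close>

definition X_dual :: "int fps" where "X_dual = Abs_fps (\<lambda>n. if n = 0 then 0 else (-1) ^ n)"

lemma X_dual_nth_0: "X_dual $ 0 = 0" by (simp add: X_dual_def)

lemma one_plus_X_dual: "(1 + X_dual) * (1 + fps_X) = 1"
proof -
  have "1 + X_dual = Abs_fps (\<lambda>n. (-1) ^ n)" by (rule fps_ext) (simp add: X_dual_def)
  moreover have "Abs_fps (\<lambda>n. (-1) ^ n) * (1 + fps_X) = (1 :: int fps)"
  proof (rule fps_ext)
    fix n show "(Abs_fps (\<lambda>n. (-1) ^ n) * (1 + fps_X)) $ n = (1 :: int fps) $ n"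
      by (cases n) (simp_all add: distrib_left)
  qed
  ultimately show ?thesis by simp
qed

lemma pdvd_upto_compose: "pdvd_upto p k f \<Longrightarrow> pdvd_upto p k (f oo X_dual)"
  unfolding pdvd_upto_def fps_compose_nth by (auto intro!: dvd_sum)

lemma pdvd_compose: "pdvd p f \<Longrightarrow> pdvd p (f oo X_dual)"
  by (simp add: pdvd_iff_pdvd_upto pdvd_upto_compose)

section \<open>The cycles\<close>

lemma lin_pdvd:
  assumes "\<And>y. int p dvd c y" shows "pdvd p (lin f c)"
  unfolding lin_def using assms by (intro pdvd_sum pdvd_of_int) auto

lemma pdvd_of_int_cong: "int p dvd a - b \<Longrightarrow> pdvd p (of_int a - of_int b)"
  using pdvd_of_int[of p "a - b" 1] by simp

lemma atom_series_if:
  "atom_series p E \<epsilon> m = (\<Sum>i<m. if i \<in> E then of_int (\<epsilon> i) *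
      ((1 + fps_X) ^ (p ^ i) + (1 + fps_X) ^ (p ^ m - p ^ i) - 2) else 0)"
  unfolding atom_series_def by (simp add: sum.inter_restrict[symmetric] Int_commute)

lemma atom_series_diff:
  "atom_series p I (\<lambda>_. 1) m - atom_series p J (\<lambda>_. 1) m
     = atom_series p ((I - J) \<union> (J - I)) (\<lambda>i. if i \<in> I then 1 else -1) m"
  unfolding atom_series_if sum_subtractf[symmetric] by (intro sum.cong) auto

context free_pro_p_pair begin

definition D' :: "'a \<Rightarrow> int fps" where "D' g = D g oo X_dual"
definition chi' :: "'a \<Rightarrow> int fps" where "chi' g = chi g oo X_dual"

lemma D'_mult:
  assumes "g \<in> carrier G" "h \<in> carrier G" shows "pdvd p (D' (g \<otimes> h) - (D' g + chi' g * D' h))"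
  using pdvd_compose[OF D_mult[OF assms]] X_dual_nth_0
  by (simp add: D'_def chi'_def fps_compose_sub_distrib fps_compose_add_distrib fps_compose_mult_distrib)

text \<open>At each level \<open>chi g\<close> is a power of \<open>1 + X\<close>, and the
  substitution turns it into the same power of the inverse.\<close>

lemma chi'_chi:
  assumes "g \<in> carrier G" shows "pdvd p (chi' g * chi g - 1)"
proof (rule pdvd_pdvd_uptoI[OF p1])
  fix m
  have X: "(1 + fps_X) oo X_dual = 1 + X_dual" using X_dual_nth_0 by (simp add: fps_compose_add_distrib)
  have "(1 + fps_X) ^ n oo X_dual = (1 + X_dual) ^ n" for n
    by (induction n) (simp_all only: power_0 power_Suc fps_compose_mult_distrib[OF X_dual_nth_0] X fps_compose_1)
  then have "pdvd_upto p (p ^ m) (chi' g - (1 + X_dual) ^ s m g)"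
    using pdvd_upto_compose[OF chi_pdvd_upto[OF assms, of m]] by (simp add: chi'_def fps_compose_sub_distrib)
  from pdvd_upto_mult_cong[OF this chi_pdvd_upto[OF assms]] show "pdvd_upto p (p ^ m) (chi' g * chi g - 1)"
    by (simp add: power_mult_distrib[symmetric] one_plus_X_dual)
qed

text \<open>The coefficient of \<open>X^i\<close> in the first factor of
  \<open>D' g \<otimes> chi g D h\<close>; tensors are handled through these coefficients.\<close>

definition F :: "nat \<Rightarrow> 'a \<times> 'a \<Rightarrow> int fps" where
  "F i = (\<lambda>(g, h). of_int (D' g $ i) * (chi g * D h))"

lemma F_N:
  assumes "n \<in> N" shows "pdvd p (F i (n, g))" "pdvd p (F i (g, n))"
proof -
  have "pdvd p (D' n)" unfolding D'_def by (rule pdvd_compose[OF D_N[OF assms]])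
  then show "pdvd p (F i (n, g))" unfolding F_def prod.case by (intro pdvd_of_int) (simp add: pdvd_def)
  show "pdvd p (F i (g, n))" unfolding F_def prod.case by (intro pdvd_mult_left D_N assms)
qed

text \<open>After expanding \<open>D' (g h)\<close> and \<open>D (h k)\<close> by the derivation
  rule, all terms cancel except the relation \<open>1 - chi' g \<otimes> chi g\<close> applied to
  \<open>D' h \<otimes> chi h D k\<close>.\<close>

lemma F_coboundary:
  assumes G: "g \<in> carrier G" "h \<in> carrier G" "k \<in> carrier G"
  shows "pdvd p (F i (h, k) - F i (g \<otimes> h, k) + F i (g, h \<otimes> k) - F i (g, h)
     - (of_int (D' h $ i) * (chi h * D k) - of_int ((chi' g * D' h) $ i) * (chi g * (chi h * D k))))"
proof -
  have 1: "pdvd p (F i (g \<otimes> h, k) - (of_int (D' g $ i + (chi' g * D' h) $ i) * ((chi g * chi h) * D k)))"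
    unfolding F_def prod.case
    by (intro pdvd_mult_cong pdvd_of_int_cong chi_mult G) (use D'_mult[OF G(1,2)] in \<open>simp_all add: pdvd_def\<close>)
  have 2: "pdvd p (F i (g, h \<otimes> k) - of_int (D' g $ i) * (chi g * (D h + chi h * D k)))"
    unfolding F_def prod.case by (intro pdvd_mult_cong D_mult G) simp_all
  from pdvd_diff[OF 2 1] show ?thesis
    by (simp add: F_def algebra_simps)
qed

text \<open>The boundary of \<open>comm_chain G u b\<close> is cancelled by a chain \<open>C\<close>
  from \<open>commprods_chain\<close>. Under \<open>F\<close> both \<open>C\<close> and the cell
  containing \<open>[u, b]\<close> vanish modulo \<open>p\<close>, and the cells
  \<open>(u, b)\<close> and \<open>(b, u)\<close> leave
  \<open>1 \<otimes> D b - D' b \<otimes> chi b\<close>.\<close>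

lemma exists_cycle:
  assumes xs: "set xs = B"
  shows "\<exists>z b. z \<in> bar_cycles2 p G \<and> b \<in> carrier G \<and> (\<forall>m. pdvd_upto p (p ^ m) (D b - atom_series p I (\<lambda>_. 1) m))
     \<and> (\<forall>i. pdvd p (lin (F i) z - ((if i = 0 then D b else 0) - of_int (D' b $ i) * chi b)))"
proof -
  have xsG: "set xs \<subseteq> carrier G" using xs basis_subset by simp
  obtain b where b: "b \<in> carrier G" "\<forall>m. pdvd_upto p (p ^ m) (D b - atom_series p I (\<lambda>_. 1) m)" "gcomm G u b \<in> commprods G N xs"
    using exists_limit_element[OF xs] by blast
  obtain C where C: "fin_chain C (carrier G \<times> carrier G)" "\<And>z. bar_d2 G C z = (if gcomm G u b = z then 1 else 0)"
    "\<And>i. pdvd p (lin (F i) C)"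
  proof -
    have "\<exists>C. fin_chain C (carrier G \<times> carrier G) \<and> (\<forall>z. bar_d2 G C z = (if gcomm G u b = z then 1 else 0))
        \<and> (\<forall>i. pdvd p (lin (F i) C))"
      by (rule commprods_chain[OF N_normal xsG _ _ b(3)]) (simp_all add: F_N)
    then show thesis using that by blast
  qed
  have kN: "gcomm G u b \<in> N" using commprods_in_normal[OF N_normal xsG] b(3) by blast
  note cc = comm_chain[OF uG b(1)]
  define z where "z = (\<lambda>y. comm_chain G u b y + C y)"
  have l: "lin f z = lin f (comm_chain G u b) + lin f C" for f :: "'a \<times> 'a \<Rightarrow> 'r::comm_ring_1"
    unfolding z_def by (rule lin_add[OF cc(1) C(1)])
  have "bar_d2 G z x = 0" for x
    unfolding bar_d2_eq_lin l unfolding bar_d2_eq_lin[symmetric] cc(3) C(2) by simp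
  then have "z \<in> bar_cycles2 p G"
    using fin_chain_add[OF cc(1) C(1)] by (simp add: bar_cycles2_def z_def)
  moreover have "pdvd p (lin (F i) z - ((if i = 0 then D b else 0) - of_int (D' b $ i) * chi b))" for i
  proof -
    have "pdvd p (D' u - 1)" using pdvd_compose[OF D_u] by (simp add: D'_def fps_compose_sub_distrib)
    then have "pdvd p (of_int (D' u $ i) - of_int (if i = 0 then 1 else 0))"
      by (intro pdvd_of_int_cong) (auto simp: pdvd_def split: if_splits dest: spec[of _ i])
    then have 1: "pdvd p (F i (u, b) - of_int (if i = 0 then 1 else 0) * (1 * D b))"
      unfolding F_def prod.case by (intro pdvd_mult_cong chi_u) simp_all
    have 2: "pdvd p (F i (b, u) - of_int (D' b $ i) * (chi b * 1))"
      unfolding F_def prod.case by (intro pdvd_mult_cong D_u) simp_all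
    from pdvd_add[OF pdvd_diff[OF pdvd_diff[OF 1 2] F_N(1)[OF kN, of i "b \<otimes> u"]] C(3)[of i]]
    show ?thesis unfolding l cc(2) by (cases "i = 0") (simp_all add: algebra_simps)
  qed
  ultimately show ?thesis using b(1,2) by blast
qed

section \<open>Comparison of the cycles and the cardinality count\<close>

abbreviation R :: "int fps set" where "R \<equiv> chispan p (carrier G) chi"

lemma R_mult: "f \<in> R \<Longrightarrow> g \<in> R \<Longrightarrow> f * g \<in> R"
proof (rule chispan_mult)
  fix g h assume "g \<in> carrier G" "h \<in> carrier G"
  then show "\<exists>k\<in>carrier G. pdvd p (chi g * chi h - chi k)"
    using pdvd_sym[OF chi_mult] by (intro bexI[of _ "g \<otimes> h"]) auto
qed

lemma R_of_int: "of_int n \<in> R" 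
  by (rule chispan_of_int[where chi = chi, OF one_closed chi_one])

text \<open>Evaluating \<open>F\<close> on a boundary gives only relations, so homologous cycles
  would express \<open>1 \<otimes> b0\<close>, up to terms with second factor in \<open>R\<close>,
  by relations. If the sets differ at infinitely many places, atoms show that no nonzero multiple of
  \<open>b0\<close> by \<open>R\<close> lies in \<open>R\<close>, and
  \<open>tensor_not_boundary\<close> excludes this.\<close>

lemma homologous_imp_finite_diff:
  assumes zI: "b \<in> carrier G" "\<And>m. pdvd_upto p (p ^ m) (D b - atom_series p I (\<lambda>_. 1) m)"
      "\<And>i. pdvd p (lin (F i) z - ((if i = 0 then D b else 0) - of_int (D' b $ i) * chi b))"
    and zJ: "b' \<in> carrier G" "\<And>m. pdvd_upto p (p ^ m) (D b' - atom_series p J (\<lambda>_. 1) m)"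
      "\<And>i. pdvd p (lin (F i) z' - ((if i = 0 then D b' else 0) - of_int (D' b' $ i) * chi b'))"
    and hom: "(z, z') \<in> bar_homologous2 p G"
  shows "finite ((I - J) \<union> (J - I))"
proof (rule ccontr)
  assume inf: "infinite ((I - J) \<union> (J - I))"
  obtain e where e: "fin_chain e (carrier G \<times> carrier G \<times> carrier G)"
      "\<And>y. (z y - z' y - bar_d3 G e y) mod int p = 0"
    and zz: "z \<in> bar_cycles2 p G" "z' \<in> bar_cycles2 p G"
    using hom by (auto simp: bar_homologous2_def)
  have fz: "fin_chain z UNIV" "fin_chain z' UNIV" using zz by (auto simp: bar_cycles2_def fin_chain_def)
  have fe: "finite (supp e)" using e(1) by (simp add: fin_chain_supp)
  note d3 = lin_bar_d3[OF fe, where G = G]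
  have fd: "fin_chain (bar_d3 G e) UNIV" using d3(1) by (simp add: fin_chain_supp)
  define b0 where "b0 = D b - D b'"
  define beta where "beta i = of_int (D' b $ i) * chi b - of_int (D' b' $ i) * chi b'" for i
  \<comment> \<open>A cell \<open>(g, h, k)\<close> of \<open>e\<close> contributes the relation for
    \<open>chi g\<close> applied to \<open>a \<otimes> c\<close>, as in
    \<open>F_coboundary\<close>.\<close>
  define a where "a t = (case t of (g, h, k) \<Rightarrow> D' h)" for t :: "'a \<times> 'a \<times> 'a"
  define c where "c t = (case t of (g, h, k) \<Rightarrow> chi h * D k)" for t :: "'a \<times> 'a \<times> 'a"
  show False
  proof (rule tensor_not_boundary[OF prime, where R = R and b = b0 and T = "supp e" and e = e and a = a and c = c
        and chi = "\<lambda>(g, h, k). chi g" and chi' = "\<lambda>(g, h, k). chi' g" and beta = beta])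
    show "f + g \<in> R" if "f \<in> R" "g \<in> R" for f g by (rule chispan_add[OF that])
    show "f * g \<in> R" if "f \<in> R" "g \<in> R" for f g by (rule R_mult[OF that])
    show "of_int n \<in> R" for n by (rule R_of_int)
    show "f \<in> R" if "pdvd p f" for f by (rule chispan.zero[OF that])
    show "pdvd p r" if r: "r \<in> R" "r * b0 \<in> R" for r
    proof (rule atom_series_multiple_not_in_span[OF prime, where S = "carrier G" and chi = chi and s = s and b = b0
          and E = "(I - J) \<union> (J - I)" and \<epsilon> = "\<lambda>i. if i \<in> I then 1 else -1"])
      show "\<not> int p dvd (if i \<in> I then 1 else - 1)" for i using p1 by auto
      show "pdvd_upto p (p ^ m) (b0 - atom_series p ((I - J) \<union> (J - I)) (\<lambda>i. if i \<in> I then 1 else -1) m)" for m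
        unfolding atom_series_diff[symmetric] b0_def
        using pdvd_upto_diff[OF zI(2)[of m] zJ(2)[of m]] by (simp add: algebra_simps)
    qed (use inf r chi_pdvd_upto s_compat in auto)
    show "finite (supp e)" by (rule fe)
    have eG: "supp e \<subseteq> carrier G \<times> carrier G \<times> carrier G" using e(1) by (simp add: fin_chain_supp)
    show "(case t of (g, h, k) \<Rightarrow> chi g) \<in> R" if "t \<in> supp e" for t
      using that eG by (auto intro: chispan_mem)
    show "pdvd p ((case t of (g, h, k) \<Rightarrow> chi' g) * (case t of (g, h, k) \<Rightarrow> chi g) - 1)" if "t \<in> supp e" for t
      using that eG by (auto intro: chi'_chi)
    have cR: "of_int n * chi g \<in> R" if "g \<in> carrier G" for n g
      by (rule R_mult[OF R_of_int chispan_mem[OF that]])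
    show "beta i \<in> R" for i
    proof -
      have "of_int (D' b $ i) * chi b + of_int (- D' b' $ i) * chi b' \<in> R"
        by (intro chispan_add cR zI(1) zJ(1))
      then show ?thesis by (simp add: beta_def)
    qed
    fix i
    let ?S = "\<Sum>t\<in>supp e. of_int (e t) * (of_int (a t $ i) * c t
        - of_int (((case t of (g, h, k) \<Rightarrow> chi' g) * a t) $ i) * ((case t of (g, h, k) \<Rightarrow> chi g) * c t))"
    have d3S: "pdvd p (lin (F i) (bar_d3 G e) - ?S)"
      unfolding d3(2) sum_subtractf[symmetric]
    proof (rule pdvd_sum)
      fix t assume t: "t \<in> supp e"
      obtain g h k where ghk: "t = (g, h, k)" by (cases t)
      have G: "g \<in> carrier G" "h \<in> carrier G" "k \<in> carrier G" using t eG ghk by auto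
      show "pdvd p ((case t of (g, h, k) \<Rightarrow> of_int (e (g, h, k)) * (F i (h, k) - F i (g \<otimes> h, k) + F i (g, h \<otimes> k) - F i (g, h)))
          - of_int (e t) * (of_int (a t $ i) * c t
        - of_int (((case t of (g, h, k) \<Rightarrow> chi' g) * a t) $ i) * ((case t of (g, h, k) \<Rightarrow> chi g) * c t)))"
        unfolding ghk prod.case a_def c_def right_diff_distrib[symmetric]
        by (rule pdvd_mult_left[OF F_coboundary[OF G]])
    qed
    have "lin (F i) (\<lambda>y. z y - z' y - bar_d3 G e y) = lin (F i) z - lin (F i) z' - lin (F i) (bar_d3 G e)"
      unfolding lin_diff[OF fin_chain_diff[OF fz] fd] lin_diff[OF fz] ..
    moreover have "pdvd p (lin (F i) (\<lambda>y. z y - z' y - bar_d3 G e y))"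
      by (rule lin_pdvd) (use e(2) in \<open>simp add: mod_0_imp_dvd\<close>)
    ultimately have "pdvd p (lin (F i) z - lin (F i) z' - lin (F i) (bar_d3 G e))" by simp
    from pdvd_add[OF pdvd_diff[OF pdvd_add[OF this d3S] zI(3)[of i]] zJ(3)[of i]]
    show "pdvd p ((if i = 0 then b0 else 0) - beta i - ?S)"
      by (cases "i = 0") (simp_all add: b0_def beta_def algebra_simps)
  qed
qed

text \<open>Each class contains \<open>z I\<close> for only countably many \<open>I\<close>, because
  any two such sets have finite symmetric difference. Countably many classes therefore cannot
  exhaust all subsets of the natural numbers.\<close>

lemma uncountable_H2:
  assumes "finite B" shows "uncountable (H2_disc_mod p G)"
proof
  assume cnt: "countable (H2_disc_mod p G)"
  obtain xs where xs: "set xs = B" using finite_list[OF assms] by blast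
  have "\<forall>I. \<exists>z b. z \<in> bar_cycles2 p G \<and> b \<in> carrier G \<and> (\<forall>m. pdvd_upto p (p ^ m) (D b - atom_series p I (\<lambda>_. 1) m))
     \<and> (\<forall>i. pdvd p (lin (F i) z - ((if i = 0 then D b else 0) - of_int (D' b $ i) * chi b)))"
    using exists_cycle[OF xs] by blast
  then obtain z b where zb: "\<And>I. z I \<in> bar_cycles2 p G" "\<And>I. b I \<in> carrier G"
    "\<And>I m. pdvd_upto p (p ^ m) (D (b I) - atom_series p I (\<lambda>_. 1) m)"
    "\<And>I i. pdvd p (lin (F i) (z I) - ((if i = 0 then D (b I) else 0) - of_int (D' (b I) $ i) * chi (b I)))"
    by metis
  define cls where "cls I = bar_homologous2 p G `` {z I}" for I
  have refl: "(z I, z I) \<in> bar_homologous2 p G" for I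
    using zb(1)[of I] unfolding bar_homologous2_def
    by (auto intro!: exI[of _ "\<lambda>_. 0"] simp: fin_chain_def bar_d3_def)
  have eq: "finite ((I - J) \<union> (J - I))" if "cls I = cls J" for I J
  proof -
    have "z J \<in> cls I" unfolding that using refl[of J] by (simp add: cls_def)
    then have "(z I, z J) \<in> bar_homologous2 p G" by (simp add: cls_def)
    from homologous_imp_finite_diff[OF zb(2-4) zb(2-4) this] show ?thesis .
  qed
  have fib: "countable {I. cls I = K}" for K
  proof (cases "\<exists>I. cls I = K")
    case True
    then obtain I where I: "cls I = K" by blast
    have "{J. cls J = K} \<subseteq> (\<lambda>A. (I - A) \<union> (A - I)) ` {A. finite A}"
    proof
      fix J assume "J \<in> {J. cls J = K}"
      then have "finite ((I - J) \<union> (J - I))" using eq[of I J] I by simp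
      moreover have "J = (I - ((I - J) \<union> (J - I))) \<union> (((I - J) \<union> (J - I)) - I)" by blast
      ultimately show "J \<in> (\<lambda>A. (I - A) \<union> (A - I)) ` {A. finite A}" by blast
    qed
    then show ?thesis using countable_Collect_finite countable_image countable_subset by blast
  qed simp
  have "(UNIV :: nat set set) = (\<Union>K\<in>H2_disc_mod p G. {I. cls I = K})"
    using zb(1) by (auto simp: H2_disc_mod_def cls_def intro!: quotientI)
  moreover have "countable (\<Union>K\<in>H2_disc_mod p G. {I. cls I = K})" by (rule countable_UN[OF cnt fib])
  ultimately have "countable (UNIV :: nat set set)" by simp
  then have "\<exists>f :: nat \<Rightarrow> nat set. range f = UNIV" using uncountable_def by blast
  then show False using Cantors_theorem[of "UNIV :: nat set"] by simp
qed

end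

theorem mainTheorem1:
  fixes p :: nat and G :: "('a, 'b) monoid_scheme" and T :: "'a topology" and B :: "'a set"
  assumes "Factorial_Ring.prime p"
    and "free_pro_p_group_on p G T B"
    and "finite B" and "card B \<ge> 2"
  shows "uncountable (H2_disc_mod p G)"
proof -
  obtain u v where "u \<in> B" "v \<in> B" "u \<noteq> v"
    using card_le_Suc0_iff_eq[OF assms(3)] assms(4) by fastforce
  then interpret free_pro_p_pair p G T B u v
    using assms by (intro free_pro_p_pair.intro free_pro_p.intro free_pro_p_pair_axioms.intro)
  show ?thesis by (rule uncountable_H2[OF assms(3)])
qed

end
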